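(* Almost surely, for the Hausdorff distance on compact subsets of the closed unit disk $\mathbb D$, \[\mathbb X^g_\infty\ \underset{g\to\infty}{\longrightarrow}\ \mathbb D,\] where $(\mathbb X^g_\infty)_{g\ge0}$ is the sequence of random sieves $\mathbb X^g_\infty=\overline{R^g(\mathbb X^0_\infty)}$ defined in the context.
   Context: Sieves. $\mathbb S^1$ is the unit circle, $[x,y]$ the line segment (chord) between $x,y\in\mathbb S^1$. A sieve is a compact subset of $\mathbb D$ that is the union of $\mathbb S^1$ and a set of chords; it is a lamination if its chords do not cross except possibly at endpoints. Brownian triangulation. Let $\mathbb e:[0,1]\to\mathbb R_+$ be a Brownian excursion of duration $1$. For $0\le s\le1$ and $0<t<\mathbb e(s)$ put $g(s,t)=\sup\{u<s:\mathbb e(u)=t\}$, $d(s,t)=\inf\{u>s:\mathbb e(u)=t\}$ and $c(s,t)=[e^{-2\pi i g(s,t)},e^{-2\pi i d(s,t)}]$. Then $\mathbb X^0_\infty=\mathbb L^{(2)}_\infty$ is the closure of $\mathbb S^1\cup\bigcup_{(s,t):\,0<t<\mathbb e(s)}c(s,t)$; it is a.s. a lamination (its chords are all the chords contained in it). Rotations. For points $A,B\in\mathbb S^1$ let $\mathrm{arc}(A,B)$ be the arc from $A$ to $B$ in counterclockwise order, containing $A$ but not $B$. Given three distinct points $\{A,B,C\}$ of $\mathbb S^1$, named so that they appear in the order $A,B,C$ when turning counterclockwise starting at $1$, let $D$ be the point of $\mathrm{arc}(A,C)$ such that $\mathrm{arc}(A,D)$ and $\mathrm{arc}(B,C)$ have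 the same length. Let $\Psi$ be the piecewise rotation of the circle sending $\mathrm{arc}(A,B)$ to $\mathrm{arc}(D,C)$, $\mathrm{arc}(B,C)$ to $\mathrm{arc}(A,D)$ and fixing $\mathrm{arc}(C,A)$ pointwise. $R_{\{A,B,C\}}$ replaces each chord $[X,Y]$ of a sieve by $[\Psi(X),\Psi(Y)]$ (keeping $\mathbb S^1$). Let $(\{A_i,B_i,C_i\})_{i\ge1}$ be an i.i.d. sequence of triples of independent uniform points on $\mathbb S^1$, independent of $\mathbb e$. Then $R^0$ is the identity and $R^g=R_{\{A_g,B_g,C_g\}}\circ R^{g-1}$ for $g\ge1$. *)

theory Defs
  imports "HOL-Probability.Probability"
begin

section \<open>Hausdorff distance\<close>

definition hausdorff_dist :: "'a::metric_space set \<Rightarrow> 'a set \<Rightarrow> real" where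
  "hausdorff_dist K L = max (SUP x\<in>K. infdist x L) (SUP y\<in>L. infdist y K)"

section \<open>Chords and sieves\<close>

text \<open>A chord is the closed segment between two points of the unit circle; the endpoints may
  coincide, which only produces points of the circle. The sets of chords that rotations produce
  are kept as sets of segments, since crossing chords cannot in general
  be recovered from their union.\<close>

definition is_chord :: "complex set \<Rightarrow> bool" where
  "is_chord c \<longleftrightarrow> (\<exists>X\<in>sphere 0 1. \<exists>Y\<in>sphere 0 1. c = closed_segment X Y)"

definition chords_in :: "complex set \<Rightarrow> complex set set" where
  "chords_in K = {c. is_chord c \<and> c \<subseteq> K}"

definition chord_union :: "complex set set \<Rightarrow> complex set" where
  "chord_union \<C> = sphere 0 1 \<union> \<Union>\<C>"

section \<open>Brownian triangulation\<close>

definition left_end :: "(real \<Rightarrow> real) \<Rightarrow> real \<Rightarrow> real \<Rightarrow> real" where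
  "left_end f s t = Sup {u\<in>{0..1}. u < s \<and> f u = t}"

definition right_end :: "(real \<Rightarrow> real) \<Rightarrow> real \<Rightarrow> real \<Rightarrow> real" where
  "right_end f s t = Inf {u\<in>{0..1}. u > s \<and> f u = t}"

definition excursion_chord :: "(real \<Rightarrow> real) \<Rightarrow> real \<Rightarrow> real \<Rightarrow> complex set" where
  "excursion_chord f s t =
     closed_segment (cis (- 2 * pi * left_end f s t)) (cis (- 2 * pi * right_end f s t))"

definition excursion_lamination :: "(real \<Rightarrow> real) \<Rightarrow> complex set" where
  "excursion_lamination f =
     closure (chord_union {excursion_chord f s t |s t. s \<in> {0..1} \<and> 0 < t \<and> t < f s})"

text \<open>The finite-dimensional densities of the normalized Brownian excursion, under Ito's measure
  conditioned on duration one, at times \<open>0 < t\<^sub>0 < \<dots> < t\<^sub>n < 1\<close>: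
  \<open>2 \<surd>(2\<pi>) q(t\<^sub>0, x\<^sub>0) p(t\<^sub>1 - t\<^sub>0, x\<^sub>0, x\<^sub>1) \<dots> p(t\<^sub>n - t\<^sub>n\<^sub>-\<^sub>1, x\<^sub>n\<^sub>-\<^sub>1, x\<^sub>n) q(1 - t\<^sub>n, x\<^sub>n)\<close>
  for positive \<open>x\<^sub>i\<close>, where \<open>q(\<cdot>, x)\<close> is the density of the hitting time of 0 for Brownian motion
  started at \<open>x\<close>, and \<open>p\<close> is the transition density of Brownian motion killed at 0.\<close>

definition hitting_density :: "real \<Rightarrow> real \<Rightarrow> real" where
  "hitting_density t x = x / sqrt (2 * pi * t ^ 3) * exp (- (x\<^sup>2) / (2 * t))"

definition killed_density :: "real \<Rightarrow> real \<Rightarrow> real \<Rightarrow> real" where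
  "killed_density t x y =
     (exp (- ((x - y)\<^sup>2) / (2 * t)) - exp (- ((x + y)\<^sup>2) / (2 * t))) / sqrt (2 * pi * t)"

definition excursion_density :: "nat \<Rightarrow> (nat \<Rightarrow> real) \<Rightarrow> (nat \<Rightarrow> real) \<Rightarrow> real" where
  "excursion_density n t x =
     (if \<forall>i\<le>n. 0 < x i
      then 2 * sqrt (2 * pi) * hitting_density (t 0) (x 0)
           * (\<Prod>i<n. killed_density (t (Suc i) - t i) (x i) (x (Suc i)))
           * hitting_density (1 - t n) (x n)
      else 0)"

definition brownian_excursion :: "'w measure \<Rightarrow> ('w \<Rightarrow> real \<Rightarrow> real) \<Rightarrow> bool" where
  "brownian_excursion M e \<longleftrightarrow>
     (\<forall>t\<in>{0..1}. (\<lambda>\<omega>. e \<omega> t) \<in> borel_measurable M) \<and>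
     (AE \<omega> in M. continuous_on {0..1} (e \<omega>) \<and> e \<omega> 0 = 0 \<and> e \<omega> 1 = 0 \<and>
        (\<forall>t\<in>{0<..<1}. 0 < e \<omega> t)) \<and>
     (\<forall>n t. 0 < t 0 \<and> (\<forall>i<n. t i < t (Suc i)) \<and> t n < 1 \<longrightarrow>
        distributed M (\<Pi>\<^sub>M i\<in>{..n}. lborel) (\<lambda>\<omega>. \<lambda>i\<in>{..n}. e \<omega> (t i))
          (\<lambda>x. ennreal (excursion_density n t x)))"

section \<open>Rotations\<close>

text \<open>Length of the counterclockwise arc from one point of the circle to another, in \<open>[0, 2\<pi>)\<close>.\<close>

definition arc_length :: "complex \<Rightarrow> complex \<Rightarrow> real" where
  "arc_length A B = Arg2pi (B / A)"

definition circle_arc :: "complex \<Rightarrow> complex \<Rightarrow> complex set" where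
  "circle_arc A B = {Z\<in>sphere 0 1. arc_length A Z < arc_length A B}"

definition ccw_triple :: "complex set \<Rightarrow> complex \<times> complex \<times> complex" where
  "ccw_triple S = (THE (A, B, C). S = {A, B, C} \<and>
     arc_length 1 A < arc_length 1 B \<and> arc_length 1 B < arc_length 1 C)"

definition swap_point :: "complex \<Rightarrow> complex \<Rightarrow> complex \<Rightarrow> complex" where
  "swap_point A B C = (THE D. D \<in> circle_arc A C \<and> arc_length A D = arc_length B C)"

text \<open>Multiplication by \<open>D / A\<close> is the rotation taking \<open>A\<close> to \<open>D\<close> (and then \<open>B\<close> to \<open>C\<close>), and
  multiplication by \<open>A / B\<close> is the one taking \<open>B\<close> to \<open>A\<close> (and then \<open>C\<close> to \<open>D\<close>).\<close>

definition piecewise_rotation :: "complex set \<Rightarrow> complex \<Rightarrow> complex" where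
  "piecewise_rotation S Z =
     (case ccw_triple S of (A, B, C) \<Rightarrow>
        if Z \<in> circle_arc A B then Z * (swap_point A B C / A)
        else if Z \<in> circle_arc B C then Z * (A / B)
        else Z)"

definition rotate_chords :: "complex set \<Rightarrow> complex set set \<Rightarrow> complex set set" where
  "rotate_chords S \<C> =
     {closed_segment (piecewise_rotation S X) (piecewise_rotation S Y) |X Y.
        X \<in> sphere 0 1 \<and> Y \<in> sphere 0 1 \<and> closed_segment X Y \<in> \<C>}"

primrec iterated_rotation ::
  "(nat \<Rightarrow> complex set) \<Rightarrow> nat \<Rightarrow> complex set set \<Rightarrow> complex set set" where
  "iterated_rotation T 0 \<C> = \<C>"
| "iterated_rotation T (Suc g) \<C> = rotate_chords (T (Suc g)) (iterated_rotation T g \<C>)"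

definition rotated_sieve :: "(nat \<Rightarrow> complex set) \<Rightarrow> (real \<Rightarrow> real) \<Rightarrow> nat \<Rightarrow> complex set" where
  "rotated_sieve T f g =
     closure (chord_union (iterated_rotation T g (chords_in (excursion_lamination f))))"

definition uniform_circle :: "complex measure" where
  "uniform_circle = distr (uniform_measure lborel {0..<1}) borel (\<lambda>u. cis (2 * pi * u))"

definition uniform_triple :: "(complex \<times> complex \<times> complex) measure" where
  "uniform_triple = uniform_circle \<Otimes>\<^sub>M uniform_circle \<Otimes>\<^sub>M uniform_circle"

text \<open>The library's \<open>indep_var\<close> requires both variables to take values in the same type.\<close>

definition indep_variables ::
  "'w measure \<Rightarrow> 'a measure \<Rightarrow> ('w \<Rightarrow> 'a) \<Rightarrow> 'b measure \<Rightarrow> ('w \<Rightarrow> 'b) \<Rightarrow> bool" where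
  "indep_variables M N X N' Y \<longleftrightarrow> X \<in> measurable M N \<and> Y \<in> measurable M N' \<and>
     prob_space.indep_set M {X -` E \<inter> space M |E. E \<in> sets N} {Y -` E \<inter> space M |E. E \<in> sets N'}"

end

theory Submission
  imports Defs
begin

text \<open>Every single rotation already creates macroscopic chords in a fresh random position. Before
  step \<open>j\<close>, the sieve contains arbitrarily small chords whose endpoints lie on both sides of the middle
  cut point \<open>b\<close>: pulled back by the first \<open>j - 1\<close> rotations, \<open>b\<close> is a time that is independent of the
  excursion, hence a.s. not a one-sided local minimum, and small excursion chords surround it. Step
  \<open>j\<close> tears these chords apart into chords converging to \<open>[a, c]\<close>, where \<open>a\<close> and \<open>c\<close> are the outer
  cut points. At time \<open>g \<ge> j\<close> this chord has been carried into a given pair of arcs iff \<open>(a, c)\<close> lies in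
  the preimage of the pair under rotations \<open>j + 1, \<dots>, g\<close>. That preimage depends only on the later
  steps and its measure does not shrink, since rotations preserve Lebesgue measure. Integrating out the steps
  \<open>g, g - 1, \<dots>, 1\<close> in this backward order, the probability that no step \<open>j \<le> g\<close> succeeds is
  exponentially small in \<open>g\<close>, and the Borel--Cantelli lemma concludes.\<close>

section \<open>Rotations in angular coordinates\<close>

text \<open>Two difficulties shape the development. Rotations are only piecewise continuous, so
  points are measured in full turns: a rotation then exchanges two adjacent intervals and is exactly
  a translation away from its cut points. Since excursion chords are drawn clockwise, time
  \<open>u\<close> has coordinate \<open>1 - u\<close>; this is why the time to be tested has the
  form \<open>1 - bwd w j x\<close>.

  The excursion, in turn, is given by its finite-dimensional densities, and these replace a zero-one
  law at a fixed time. Moving away from that time, they are dominated by a Gaussian walk with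
  rapidly growing steps, which stays above its starting value during \<open>n\<close> steps with
  mass at most a constant times \<open>(1 - tail_const) ^ n\<close> plus an arbitrarily small error.
  Fubini's theorem then replaces the fixed time by the random one, for which the property needs a
  jointly measurable form (\<open>dyadic_wiggle\<close>).\<close>

definition circ :: "real \<Rightarrow> complex" where
  "circ x = cis (2 * pi * x)"

definition swap_at :: "real \<Rightarrow> real \<Rightarrow> real \<Rightarrow> real \<Rightarrow> real" where
  "swap_at a b c x =
     (if a \<le> x \<and> x < b then x + (c - b) else if b \<le> x \<and> x < c then x - (b - a) else x)"

lemma circ_in_sphere [simp]: "circ x \<in> sphere 0 1"
  by (simp add: circ_def)

lemma norm_circ [simp]: "norm (circ x) = 1"
  by (simp add: circ_def)

lemma circ_divide: "circ y / circ x = circ (y - x)"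
  by (simp add: circ_def cis_divide right_diff_distrib)

lemma circ_mult: "circ x * circ y = circ (x + y)"
  by (simp add: circ_def cis_mult distrib_left)

lemma circ_add_one: "circ (x + 1) = circ x"
  by (simp add: circ_def distrib_left cis_mult[symmetric])

lemma Arg2pi_circ: "0 \<le> x \<Longrightarrow> x < 1 \<Longrightarrow> Arg2pi (circ x) = 2 * pi * x"
  by (rule Arg2pi_unique[of 1]) (auto simp: circ_def cis_conv_exp)

lemma circ_surj:
  assumes "z \<in> sphere 0 1"
  obtains x where "0 \<le> x" "x < 1" "z = circ x"
proof
  show "0 \<le> Arg2pi z / (2 * pi)" "Arg2pi z / (2 * pi) < 1"
    using Arg2pi[of z] by auto
  show "z = circ (Arg2pi z / (2 * pi))"
    using Arg2pi_eq[of z] assms by (simp add: circ_def cis_conv_exp)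
qed

lemma arc_length_circ:
  assumes "0 \<le> x" "x < 1" "0 \<le> y" "y < 1"
  shows "arc_length (circ x) (circ y) = 2 * pi * (if x \<le> y then y - x else y - x + 1)"
proof (cases "x \<le> y")
  case True
  then show ?thesis using assms by (simp add: arc_length_def circ_divide Arg2pi_circ)
next
  case False
  then show ?thesis
    using assms Arg2pi_circ[of "y - x + 1"] by (simp add: arc_length_def circ_divide circ_add_one)
qed

lemma arc_length_1_circ: "0 \<le> x \<Longrightarrow> x < 1 \<Longrightarrow> arc_length 1 (circ x) = 2 * pi * x"
  using arc_length_circ[of 0 x] by (simp add: circ_def)

lemma circ_in_circle_arc:
  assumes "0 \<le> a" "a < b" "b < 1" "0 \<le> x" "x < 1"
  shows "circ x \<in> circle_arc (circ a) (circ b) \<longleftrightarrow> a \<le> x \<and> x < b"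
  using assms by (auto simp: circle_arc_def arc_length_circ)

lemma ccw_triple_circ:
  assumes "0 \<le> a" "a < b" "b < c" "c < 1"
  shows "ccw_triple {circ a, circ b, circ c} = (circ a, circ b, circ c)"
  unfolding ccw_triple_def
proof (rule the_equality)
  have l: "arc_length 1 (circ a) = 2 * pi * a" "arc_length 1 (circ b) = 2 * pi * b"
    "arc_length 1 (circ c) = 2 * pi * c"
    using assms by (simp_all add: arc_length_1_circ)
  show "case (circ a, circ b, circ c) of (A, B, C) \<Rightarrow> {circ a, circ b, circ c} = {A, B, C} \<and>
      arc_length 1 A < arc_length 1 B \<and> arc_length 1 B < arc_length 1 C"
    using assms by (simp add: l)
  fix S :: "complex \<times> complex \<times> complex"
  obtain A B C where S: "S = (A, B, C)" by (cases S)
  assume "case S of (A, B, C) \<Rightarrow> {circ a, circ b, circ c} = {A, B, C} \<and>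
      arc_length 1 A < arc_length 1 B \<and> arc_length 1 B < arc_length 1 C"
  then have *: "{circ a, circ b, circ c} = {A, B, C}"
      "arc_length 1 A < arc_length 1 B" "arc_length 1 B < arc_length 1 C"
    by (auto simp: S)
  have "A \<in> {circ a, circ b, circ c}" "B \<in> {circ a, circ b, circ c}" "C \<in> {circ a, circ b, circ c}"
    unfolding *(1) by auto
  \<comment> \<open>Of the 27 ways to choose \<open>A\<close>, \<open>B\<close>, \<open>C\<close>
    among the three points, only the sorted one satisfies both strict inequalities.\<close>
  then show "S = (circ a, circ b, circ c)"
    using *(2,3) assms unfolding S
    by (elim insertE emptyE) (simp_all add: l)
qed

lemma swap_point_circ:
  assumes "0 \<le> a" "a < b" "b < c" "c < 1"
  shows "swap_point (circ a) (circ b) (circ c) = circ (a + c - b)"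
  unfolding swap_point_def
proof (rule the_equality)
  show "circ (a + c - b) \<in> circle_arc (circ a) (circ c) \<and>
      arc_length (circ a) (circ (a + c - b)) = arc_length (circ b) (circ c)"
    using assms by (auto simp: circ_in_circle_arc arc_length_circ)
  fix D assume D: "D \<in> circle_arc (circ a) (circ c) \<and> arc_length (circ a) D = arc_length (circ b) (circ c)"
  then have "D \<in> sphere 0 1" by (simp add: circle_arc_def)
  then obtain d where d: "0 \<le> d" "d < 1" "D = circ d" by (rule circ_surj)
  with D assms have "a \<le> d" by (simp add: circ_in_circle_arc)
  with D d assms have "d - a = c - b" by (simp add: arc_length_circ)
  then have "d = a + c - b" by simp
  then show "D = circ (a + c - b)" using d by simp
qed

lemma piecewise_rotation_circ:
  assumes "0 \<le> a" "a < b" "b < c" "c < 1" "0 \<le> x" "x < 1"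
  shows "piecewise_rotation {circ a, circ b, circ c} (circ x) = circ (swap_at a b c x)"
  using assms
  by (auto simp: piecewise_rotation_def ccw_triple_circ swap_point_circ circ_in_circle_arc swap_at_def
      circ_divide circ_mult algebra_simps)

section \<open>Interval exchanges and their orbits\<close>

type_synonym triple = "real \<times> real \<times> real"

text \<open>Triples keep the order in which their points are drawn, so that a step has a product
  law; the sorted names that a rotation uses are recovered afterwards.\<close>

definition tmin :: "triple \<Rightarrow> real" where
  "tmin = (\<lambda>(p, q, r). min p (min q r))"

definition tmax :: "triple \<Rightarrow> real" where
  "tmax = (\<lambda>(p, q, r). max p (max q r))"

definition tmid :: "triple \<Rightarrow> real" where
  "tmid t = (case t of (p, q, r) \<Rightarrow> p + q + r - tmin t - tmax t)"

definition tset :: "triple \<Rightarrow> real set" where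
  "tset = (\<lambda>(p, q, r). {p, q, r})"

definition generic :: "triple \<Rightarrow> bool" where
  "generic = (\<lambda>(p, q, r). p \<noteq> q \<and> p \<noteq> r \<and> q \<noteq> r \<and> {p, q, r} \<subseteq> {0<..<1})"

definition tswap :: "triple \<Rightarrow> real \<Rightarrow> real" where
  "tswap t = swap_at (tmin t) (tmid t) (tmax t)"

text \<open>The inverse of an exchange is the exchange with the two lengths interchanged, so its
  middle point is \<open>a + c - b\<close>, the point \<open>D\<close> of the rotation.\<close>

definition tswap_inv :: "triple \<Rightarrow> real \<Rightarrow> real" where
  "tswap_inv t = swap_at (tmin t) (tmin t + tmax t - tmid t) (tmax t)"

text \<open>The steps applied are \<open>s + 1, ..., s + n\<close>: a point created by step
  \<open>j\<close> is followed with \<open>s = j\<close>, whereas \<open>s = j - 1\<close> lets step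
  \<open>j\<close> act on it as well.\<close>

primrec fwd :: "(nat \<Rightarrow> triple) \<Rightarrow> nat \<Rightarrow> nat \<Rightarrow> real \<Rightarrow> real" where
  "fwd w s 0 x = x"
| "fwd w s (Suc n) x = tswap (w (Suc (s + n))) (fwd w s n x)"

primrec bwd :: "(nat \<Rightarrow> triple) \<Rightarrow> nat \<Rightarrow> real \<Rightarrow> real" where
  "bwd w 0 x = x"
| "bwd w (Suc n) x = bwd w n (tswap_inv (w (Suc n)) x)"

lemma generic_sorted:
  assumes "generic t"
  shows "0 < tmin t" "tmin t < tmid t" "tmid t < tmax t" "tmax t < 1"
    "tset t = {tmin t, tmid t, tmax t}"
  using assms by (cases t; force simp: generic_def tmin_def tmid_def tmax_def tset_def min_def max_def)+

lemma tswap_mem0: "generic t \<Longrightarrow> 0 \<le> x \<Longrightarrow> x < 1 \<Longrightarrow> 0 \<le> tswap t x \<and> tswap t x < 1"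
  using generic_sorted[of t] by (auto simp: tswap_def swap_at_def)

lemma tswap_inv_mem: "generic t \<Longrightarrow> 0 < x \<Longrightarrow> x < 1 \<Longrightarrow> 0 < tswap_inv t x \<and> tswap_inv t x < 1"
  using generic_sorted[of t] by (auto simp: tswap_inv_def swap_at_def)

lemma tswap_tswap_inv: "generic t \<Longrightarrow> tswap t (tswap_inv t x) = x"
  using generic_sorted[of t] by (auto simp: tswap_def tswap_inv_def swap_at_def)

lemma bwd_mem: "(\<And>i. 1 \<le> i \<Longrightarrow> i \<le> n \<Longrightarrow> generic (w i)) \<Longrightarrow> 0 < x \<Longrightarrow> x < 1 \<Longrightarrow> 0 < bwd w n x \<and> bwd w n x < 1"
  by (induction n arbitrary: x) (auto simp: tswap_inv_mem)

lemma fwd_bwd: "(\<And>i. 1 \<le> i \<Longrightarrow> i \<le> n \<Longrightarrow> generic (w i)) \<Longrightarrow> fwd w 0 n (bwd w n x) = x"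
  by (induction n arbitrary: x) (auto simp: tswap_tswap_inv)

lemma fwd_add: "fwd w s (m + n) x = fwd w (s + m) n (fwd w s m x)"
  by (induction n) (auto simp: add.assoc)

lemma fwd_mem0: "(\<And>i. 1 \<le> i \<Longrightarrow> generic (w i)) \<Longrightarrow> 0 \<le> x \<Longrightarrow> x < 1 \<Longrightarrow> 0 \<le> fwd w s n x \<and> fwd w s n x < 1"
  by (induction n) (auto simp: tswap_mem0)

definition cuts :: "(nat \<Rightarrow> triple) \<Rightarrow> nat \<Rightarrow> complex set" where
  "cuts w i = circ ` tset (w i)"

lemma iterated_rotation_circ:
  assumes g: "\<And>i. 1 \<le> i \<Longrightarrow> generic (w i)" and "0 \<le> x" "x < 1" "0 \<le> y" "y < 1"
    and C: "closed_segment (circ x) (circ y) \<in> iterated_rotation (cuts w) s \<C>"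
  shows "closed_segment (circ (fwd w s n x)) (circ (fwd w s n y)) \<in> iterated_rotation (cuts w) (s + n) \<C>"
proof (induction n)
  case 0
  then show ?case using C by simp
next
  case (Suc n)
  let ?t = "w (Suc (s + n))"
  note t = generic_sorted[of ?t, OF g]
  have "piecewise_rotation (cuts w (Suc (s + n))) (circ z) = circ (tswap ?t z)" if "0 \<le> z" "z < 1" for z
    using t piecewise_rotation_circ[of "tmin ?t" "tmid ?t" "tmax ?t" z] that
    by (simp add: cuts_def tswap_def)
  then show ?case
    using Suc fwd_mem0[OF g] assms by (auto simp: rotate_chords_def intro!: exI)
qed

text \<open>Exact translation is used instead of continuity because it remembers on which side of a
  cut point an image lies, and the side decides where the next exchange throws it.\<close>

definition loc_transl :: "(real \<Rightarrow> real) \<Rightarrow> real \<Rightarrow> bool" where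
  "loc_transl \<phi> x \<longleftrightarrow> (\<exists>\<eta>>0. \<forall>y. \<bar>y - x\<bar> < \<eta> \<longrightarrow> \<phi> y = \<phi> x + (y - x))"

lemma loc_transl_id: "loc_transl (\<lambda>x. x) x"
  by (auto simp: loc_transl_def intro: exI[of _ 1])

lemma loc_transl_comp:
  assumes "loc_transl \<phi> x" "loc_transl \<psi> (\<phi> x)"
  shows "loc_transl (\<lambda>x. \<psi> (\<phi> x)) x"
proof -
  obtain \<eta> where \<eta>: "\<eta> > 0" "\<And>y. \<bar>y - x\<bar> < \<eta> \<Longrightarrow> \<phi> y = \<phi> x + (y - x)"
    using assms(1) unfolding loc_transl_def by blast
  obtain \<eta>' where \<eta>': "\<eta>' > 0" "\<And>y. \<bar>y - \<phi> x\<bar> < \<eta>' \<Longrightarrow> \<psi> y = \<psi> (\<phi> x) + (y - \<phi> x)"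
    using assms(2) unfolding loc_transl_def by blast
  have "\<psi> (\<phi> y) = \<psi> (\<phi> x) + (y - x)" if "\<bar>y - x\<bar> < min \<eta> \<eta>'" for y
    using \<eta>(2)[of y] \<eta>'(2)[of "\<phi> y"] that by simp
  then show ?thesis
    unfolding loc_transl_def using \<eta>(1) \<eta>'(1) by (metis min_less_iff_conj)
qed

lemma loc_transl_tswap:
  assumes "generic t" "x \<notin> tset t"
  shows "loc_transl (tswap t) x"
proof -
  note t = generic_sorted[OF assms(1)]
  have *: "x \<noteq> tmin t" "x \<noteq> tmid t" "x \<noteq> tmax t" using assms(2) t(5) by auto
  show ?thesis
    unfolding loc_transl_def
    by (rule exI[of _ "min \<bar>x - tmin t\<bar> (min \<bar>x - tmid t\<bar> \<bar>x - tmax t\<bar>)"])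
       (use * t(1-4) in \<open>auto simp: tswap_def swap_at_def\<close>)
qed

lemma loc_transl_fwd:
  assumes "\<And>i. 1 \<le> i \<Longrightarrow> generic (w i)" "\<And>m. m < n \<Longrightarrow> fwd w s m x \<notin> tset (w (Suc (s + m)))"
  shows "loc_transl (fwd w s n) x"
  using assms(2)
proof (induction n)
  case 0
  then show ?case using loc_transl_id by (simp add: loc_transl_def)
next
  case (Suc n)
  have "loc_transl (fwd w s n) x" by (rule Suc.IH) (simp add: Suc.prems)
  moreover have "loc_transl (tswap (w (Suc (s + n)))) (fwd w s n x)"
    by (rule loc_transl_tswap) (simp_all add: Suc.prems assms(1))
  ultimately show ?case using loc_transl_comp by simp
qed

section \<open>Chords created by one step\<close>

definition wiggle :: "(real \<Rightarrow> real) \<Rightarrow> real \<Rightarrow> bool" where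
  "wiggle f u \<longleftrightarrow> (\<forall>h>0. (\<exists>v. u - h < v \<and> v < u \<and> f v < f u) \<and> (\<exists>v. u < v \<and> v < u + h \<and> f v < f u))"

text \<open>A level just below \<open>f u\<close> is crossed on both sides of \<open>u\<close>
  within distance \<open>h\<close>, and the nearest crossings on the two sides are the endpoints of
  an excursion chord. The clockwise parametrization puts \<open>u\<close> at \<open>1 - u\<close>
  and interchanges left and right.\<close>

lemma small_chord:
  assumes f: "continuous_on {0..1} f" "\<And>t. t \<in> {0<..<1} \<Longrightarrow> 0 < f t"
    and u: "0 < u" "u < 1" and "wiggle f u" "0 < h"
  obtains x y where "1 - u - h < x" "x < 1 - u" "1 - u < y" "y < 1 - u + h"
    "closed_segment (circ x) (circ y) \<in> chords_in (excursion_lamination f)"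
proof -
  define h' where "h' = min h (min u (1 - u))"
  have h': "0 < h'" "h' \<le> h" "h' \<le> u" "h' \<le> 1 - u" using u \<open>0 < h\<close> by (auto simp: h'_def)
  obtain v1 v2 where v: "u - h' < v1" "v1 < u" "f v1 < f u" "u < v2" "v2 < u + h'" "f v2 < f u"
    using \<open>wiggle f u\<close> h'(1) unfolding wiggle_def by blast
  have v01: "0 < v1" "v2 < 1" using v h' by auto
  have pos: "0 < f v1" using f(2)[of v1] v v01 u by auto
  define t where "t = (max (f v1) (f v2) + f u) / 2"
  have t: "f v1 < t" "f v2 < t" "t < f u" using v by (auto simp: t_def)
  have cont: "continuous_on {a..b} f" if "0 \<le> a" "b \<le> 1" for a b
    using continuous_on_subset[OF f(1)] that by auto
  define l where "l = left_end f u t"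
  define r where "r = right_end f u t"
  have l: "v1 < l \<and> l < u"
  proof -
    let ?S = "{w\<in>{0..1}. w < u \<and> f w = t}"
    have "\<exists>w. v1 \<le> w \<and> w \<le> u \<and> f w = t"
      by (rule IVT') (use t v v01 u cont in auto)
    then obtain w where w: "v1 \<le> w" "w \<le> u" "f w = t" by blast
    have wv: "v1 < w" "w < u" using w t v by (auto simp: less_le)
    \<comment> \<open>Continuity at \<open>u\<close> keeps all times of height \<open>t\<close> at
      distance at least \<open>d\<close> from \<open>u\<close>. The supremum is thus strictly below
      \<open>u\<close>, and the chord really straddles \<open>u\<close>.\<close>
    obtain d where d: "d > 0" "\<And>y. y \<in> {0..1} \<Longrightarrow> dist y u < d \<Longrightarrow> dist (f y) (f u) < f u - t"
      using f(1) u t unfolding continuous_on_iff by (metis atLeastAtMost_iff diff_gt_0_iff_gt less_imp_le)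
    have ub: "y \<le> u - d" if "y \<in> ?S" for y
      using d(2)[of y] that by (force simp: dist_real_def)
    have "w \<le> Sup ?S"
      using wv w u v01 by (intro cSup_upper) (auto intro!: bdd_aboveI[of _ u])
    moreover have "Sup ?S \<le> u - d"
      using wv w u v01 ub by (intro cSup_least) auto
    ultimately show ?thesis using wv d by (simp add: l_def left_end_def)
  qed
  have r: "u < r \<and> r < v2"
  proof -
    let ?S = "{w\<in>{0..1}. w > u \<and> f w = t}"
    have "\<exists>w. u \<le> w \<and> w \<le> v2 \<and> f w = t"
      by (rule IVT2') (use t v v01 u cont in auto)
    then obtain w where w: "u \<le> w" "w \<le> v2" "f w = t" by blast
    have wv: "u < w" "w < v2" using w t v by (auto simp: less_le)
    obtain d where d: "d > 0" "\<And>y. y \<in> {0..1} \<Longrightarrow> dist y u < d \<Longrightarrow> dist (f y) (f u) < f u - t"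
      using f(1) u t unfolding continuous_on_iff by (metis atLeastAtMost_iff diff_gt_0_iff_gt less_imp_le)
    have lb: "u + d \<le> y" if "y \<in> ?S" for y
      using d(2)[of y] that by (force simp: dist_real_def)
    have "Inf ?S \<le> w"
      using wv w u v01 by (intro cInf_lower) (auto intro!: bdd_belowI[of _ u])
    moreover have "u + d \<le> Inf ?S"
      using wv w u v01 lb by (intro cInf_greatest) auto
    ultimately show ?thesis using wv d by (simp add: r_def right_end_def)
  qed
  have "cis (- 2 * pi * z) = circ (1 - z)" for z
    using circ_add_one[of "- z"] by (simp add: circ_def)
  then have eq: "excursion_chord f u t = closed_segment (circ (1 - r)) (circ (1 - l))"
    by (simp add: excursion_chord_def l_def r_def closed_segment_commute)
  have "excursion_chord f u t \<subseteq> excursion_lamination f"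
    unfolding excursion_lamination_def chord_union_def
  proof (rule order.trans[OF _ closure_subset])
    have "excursion_chord f u t \<in> {excursion_chord f s t |s t. s \<in> {0..1} \<and> 0 < t \<and> t < f s}"
      using u t pos by (intro CollectI exI[of _ u] exI[of _ t]) simp
    then show "excursion_chord f u t \<subseteq> sphere 0 1 \<union> \<Union> {excursion_chord f s t |s t. s \<in> {0..1} \<and> 0 < t \<and> t < f s}"
      by blast
  qed
  then have "closed_segment (circ (1 - r)) (circ (1 - l)) \<in> chords_in (excursion_lamination f)"
    using eq by (auto simp: chords_in_def is_chord_def intro: circ_in_sphere)
  then show ?thesis
    using that[of "1 - r" "1 - l"] l r v h' by auto
qed

definition grid_arc :: "nat \<Rightarrow> nat \<Rightarrow> real set" where
  "grid_arc n k = {real k / real n <..< real (Suc k) / real n}"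

text \<open>The second condition makes compositions of rotations translations near the cut points: they are
  discontinuous only where an orbit meets a later cut point.\<close>

definition good_path :: "(real \<Rightarrow> real) \<Rightarrow> (nat \<Rightarrow> triple) \<Rightarrow> bool" where
  "good_path f w \<longleftrightarrow> (\<forall>i\<ge>1. generic (w i)) \<and>
     (\<forall>i\<ge>1. \<forall>k>i. \<forall>s n. s + n < k \<longrightarrow> (\<forall>p\<in>tset (w i). \<forall>q\<in>tset (w k). q \<noteq> fwd w s n p)) \<and>
     (\<forall>j. wiggle f (1 - bwd w j (tmid (w (Suc j)))))"

text \<open>The orbits start after step \<open>j\<close>: the chord between the outer cut points is
  the limit of chords that step \<open>j\<close> itself has just torn.\<close>

definition hit :: "(nat \<Rightarrow> triple) \<Rightarrow> nat \<Rightarrow> nat \<Rightarrow> real set \<Rightarrow> real set \<Rightarrow> bool" where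
  "hit w j m I J \<longleftrightarrow> (let x = fwd w j m (tmin (w j)); y = fwd w j m (tmax (w j)) in
     x \<in> I \<and> y \<in> J \<or> x \<in> J \<and> y \<in> I)"

text \<open>\<open>U\<close> is the point that arrives at the middle cut point after
  \<open>j\<close> steps. A tiny chord around \<open>U\<close> is translated to one around
  \<open>tmid\<close>, torn by step \<open>Suc j\<close>, and from then on its endpoints follow
  \<open>tmin\<close> and \<open>tmax\<close> rigidly. Openness of \<open>I\<close> and
  \<open>J\<close> absorbs the small offset.\<close>

lemma chord_of_hit:
  assumes f: "continuous_on {0..1} f" "\<And>t. t \<in> {0<..<1} \<Longrightarrow> 0 < f t"
    and w: "good_path f w" and "open I" "open J" "hit w (Suc j) m I J"
  obtains x y where "x \<in> I" "y \<in> J"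
    "closed_segment (circ x) (circ y) \<in> iterated_rotation (cuts w) (Suc j + m) (chords_in (excursion_lamination f))"
proof -
  have gen: "\<And>i. 1 \<le> i \<Longrightarrow> generic (w i)" using w by (auto simp: good_path_def)
  have neq: "q \<noteq> fwd w s n p" if "1 \<le> i" "i < k" "s + n < k" "p \<in> tset (w i)" "q \<in> tset (w k)" for i k s n p q
    using w that unfolding good_path_def by blast
  let ?t = "w (Suc j)"
  have t: "0 < tmin ?t" "tmin ?t < tmid ?t" "tmid ?t < tmax ?t" "tmax ?t < 1" "tset ?t = {tmin ?t, tmid ?t, tmax ?t}"
    using generic_sorted[of ?t] gen by auto
  define U where "U = bwd w j (tmid ?t)"
  have U: "0 < U" "U < 1" using bwd_mem[of j w "tmid ?t"] gen t by (auto simp: U_def)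
  have fU: "fwd w 0 j U = tmid ?t" using fwd_bwd[of j w] gen by (auto simp: U_def)
  have wig: "wiggle f (1 - U)" using w by (auto simp: good_path_def U_def)
  have L0: "loc_transl (fwd w 0 j) U"
  proof (rule loc_transl_fwd[OF gen])
    fix m assume m: "m < j"
    show "fwd w 0 m U \<notin> tset (w (Suc (0 + m)))"
    proof
      assume "fwd w 0 m U \<in> tset (w (Suc (0 + m)))"
      \<comment> \<open>If the orbit of \<open>U\<close> met a cut point of step
        \<open>Suc m\<close>, then \<open>tmid ?t\<close> would be the image of that cut point under
        steps \<open>Suc m, ..., j\<close>, which \<open>good_path\<close> excludes.\<close>
      moreover have "tmid ?t = fwd w (0 + m) (j - m) (fwd w 0 m U)"
        using fwd_add[of w 0 m "j - m" U] m fU by simp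
      ultimately show False
        using neq[of "Suc m" "Suc j" m "j - m"] m t(5) by auto
    qed
  qed auto
  have L1: "loc_transl (fwd w (Suc j) m) p" if "p \<in> tset ?t" for p
  proof (rule loc_transl_fwd[OF gen])
    show "fwd w (Suc j) k p \<notin> tset (w (Suc (Suc j + k)))" for k
      using neq[of "Suc j" "Suc (Suc j + k)" "Suc j" k p] that by auto
  qed auto
  obtain \<eta> where \<eta>: "\<eta> > 0" "\<And>y. \<bar>y - U\<bar> < \<eta> \<Longrightarrow> fwd w 0 j y = tmid ?t + (y - U)"
    using L0 fU by (auto simp: loc_transl_def)
  obtain \<eta>1 where \<eta>1: "\<eta>1 > 0" "\<And>y. \<bar>y - tmin ?t\<bar> < \<eta>1 \<Longrightarrow> fwd w (Suc j) m y = fwd w (Suc j) m (tmin ?t) + (y - tmin ?t)"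
    using L1[of "tmin ?t"] t(5) by (auto simp: loc_transl_def)
  obtain \<eta>2 where \<eta>2: "\<eta>2 > 0" "\<And>y. \<bar>y - tmax ?t\<bar> < \<eta>2 \<Longrightarrow> fwd w (Suc j) m y = fwd w (Suc j) m (tmax ?t) + (y - tmax ?t)"
    using L1[of "tmax ?t"] t(5) by (auto simp: loc_transl_def)
  let ?P = "fwd w (Suc j) m (tmin ?t)" and ?Q = "fwd w (Suc j) m (tmax ?t)"
  have "\<exists>I' J'. open I' \<and> open J' \<and> ?P \<in> I' \<and> ?Q \<in> J' \<and> (I' = I \<and> J' = J \<or> I' = J \<and> J' = I)"
    using assms(4-6) unfolding hit_def Let_def by metis
  then obtain I' J' where IJ: "open I'" "open J'" "?P \<in> I'" "?Q \<in> J'" "I' = I \<and> J' = J \<or> I' = J \<and> J' = I" by blast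
  obtain \<eta>3 where \<eta>3: "\<eta>3 > 0" "\<And>y. \<bar>y - ?P\<bar> < \<eta>3 \<Longrightarrow> y \<in> I'"
    using IJ(1,3) unfolding open_dist dist_real_def by blast
  obtain \<eta>4 where \<eta>4: "\<eta>4 > 0" "\<And>y. \<bar>y - ?Q\<bar> < \<eta>4 \<Longrightarrow> y \<in> J'"
    using IJ(2,4) unfolding open_dist dist_real_def by blast
  \<comment> \<open>The entries \<open>U\<close> and \<open>1 - U\<close> keep the chord's
    coordinates in the unit interval. The two gaps make the endpoints enter step
    \<open>Suc j\<close> inside the two exchanged intervals, one in each.\<close>
  define S where "S = {\<eta>, \<eta>1, \<eta>2, \<eta>3, \<eta>4, U, 1 - U, tmid ?t - tmin ?t, tmax ?t - tmid ?t}"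
  define h where "h = Min S"
  have "finite S" by (simp add: S_def)
  then have le: "h \<le> y" if "y \<in> S" for y using that by (simp add: h_def)
  have h: "h \<le> \<eta>" "h \<le> \<eta>1" "h \<le> \<eta>2" "h \<le> \<eta>3" "h \<le> \<eta>4" "h \<le> U" "h \<le> 1 - U"
    "h \<le> tmid ?t - tmin ?t" "h \<le> tmax ?t - tmid ?t"
    by (rule le, simp add: S_def)+
  have "0 < y" if "y \<in> S" for y
    using that U \<eta>(1) \<eta>1(1) \<eta>2(1) \<eta>3(1) \<eta>4(1) t(2,3) by (auto simp: S_def)
  moreover have "Min S \<in> S" using \<open>finite S\<close> by (intro Min_in) (auto simp: S_def)
  ultimately have h0: "0 < h" by (simp add: h_def)
  obtain x y where xy: "U - h < x" "x < U" "U < y" "y < U + h"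
      "closed_segment (circ x) (circ y) \<in> chords_in (excursion_lamination f)"
    using small_chord[OF f _ _ wig h0] U by auto
  \<comment> \<open>The tearing: the endpoint just below \<open>tmid\<close> moves up by
    \<open>tmax - tmid\<close>, the one just above it moves down by
    \<open>tmid - tmin\<close>.\<close>
  have fx: "fwd w 0 (Suc j) x = tmax ?t - (U - x)"
    using \<eta>(2)[of x] xy h t by (simp add: tswap_def swap_at_def)
  have fy: "fwd w 0 (Suc j) y = tmin ?t + (y - U)"
    using \<eta>(2)[of y] xy h t by (simp add: tswap_def swap_at_def)
  have X: "fwd w 0 (Suc j + m) x = ?Q - (U - x)"
    unfolding fwd_add fx using \<eta>2(2)[of "tmax ?t - (U - x)"] xy h by simp
  have Y: "fwd w 0 (Suc j + m) y = ?P + (y - U)"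
    unfolding fwd_add fy using \<eta>1(2)[of "tmin ?t + (y - U)"] xy h by simp
  have "closed_segment (circ (fwd w 0 (Suc j + m) x)) (circ (fwd w 0 (Suc j + m) y))
     \<in> iterated_rotation (cuts w) (0 + (Suc j + m)) (chords_in (excursion_lamination f))"
    by (rule iterated_rotation_circ[OF gen]) (use xy h U in auto)
  moreover have "fwd w 0 (Suc j + m) x \<in> J'" "fwd w 0 (Suc j + m) y \<in> I'"
    unfolding X Y using \<eta>4(2) \<eta>3(2) xy h by auto
  ultimately show ?thesis
    using IJ(5) that by (auto simp: closed_segment_commute)
qed

section \<open>From chords to the Hausdorff distance\<close>

lemma cball_on_chord:
  fixes z :: complex
  assumes "z \<in> cball 0 1"
  obtains a b where "0 \<le> a" "a < 1" "0 \<le> b" "b < 1" "z \<in> closed_segment (circ a) (circ b)"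
proof -
  \<comment> \<open>The horizontal chord through \<open>z\<close>, with half-length
    \<open>s\<close>. For \<open>s = 0\<close> it is a single point and the affine parameter below
    would divide by zero.\<close>
  define s where "s = sqrt (1 - (Im z)\<^sup>2)"
  have n: "(Re z)\<^sup>2 + (Im z)\<^sup>2 \<le> 1"
    using assms by (simp add: cmod_def)
  have im: "(Im z)\<^sup>2 \<le> 1" using n by (smt (verit) zero_le_power2)
  have s: "0 \<le> s" "s\<^sup>2 = 1 - (Im z)\<^sup>2" using im by (auto simp: s_def)
  have Re: "\<bar>Re z\<bar> \<le> s"
    by (rule power2_le_imp_le) (use n s in simp_all)
  define X where "X = Complex (- s) (Im z)"
  define Y where "Y = Complex s (Im z)"
  have "X \<in> sphere 0 1" "Y \<in> sphere 0 1"
    using s by (simp_all add: X_def Y_def cmod_def)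
  then obtain a b where ab: "0 \<le> a" "a < 1" "X = circ a" "0 \<le> b" "b < 1" "Y = circ b"
    by (metis circ_surj)
  have "z \<in> closed_segment X Y"
  proof (cases "s = 0")
    case True
    then show ?thesis using Re by (simp add: X_def Y_def complex_eq_iff)
  next
    case False
    then have "0 < s" using s(1) by simp
    then show ?thesis unfolding in_segment
      using Re
      by (intro exI[of _ "(Re z + s) / (2 * s)"]) (simp add: X_def Y_def complex_eq_iff field_simps abs_le_iff)
  qed
  with ab that show ?thesis by auto
qed

lemma dist_circ: "dist (circ x) (circ y) \<le> 2 * pi * \<bar>x - y\<bar>"
proof -
  have "dist (circ x) (circ y) = norm (circ y * (circ (x - y) - 1))"
    by (simp add: circ_mult right_diff_distrib dist_norm)
  also have "\<dots> = norm (cis (2 * pi * (x - y)) - 1)"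
    by (simp add: norm_mult) (simp add: circ_def)
  also have "\<dots> \<le> \<bar>2 * pi * (x - y)\<bar>"
    using dist_exp_i_1[of "2 * pi * (x - y)"] abs_sin_x_le_abs_x[of "2 * pi * (x - y) / 2"]
    by (simp add: cis_conv_exp)
  finally show ?thesis by (simp add: abs_mult)
qed

lemma dist_closed_segment:
  fixes a b a' b' :: complex
  assumes "z \<in> closed_segment a b" "dist a a' \<le> r" "dist b b' \<le> r"
  obtains z' where "z' \<in> closed_segment a' b'" "dist z z' \<le> r"
proof -
  obtain u where u: "0 \<le> u" "u \<le> 1" "z = (1 - u) *\<^sub>R a + u *\<^sub>R b"
    using assms(1) by (auto simp: in_segment)
  let ?z = "(1 - u) *\<^sub>R a' + u *\<^sub>R b'"
  have "z - ?z = (1 - u) *\<^sub>R (a - a') + u *\<^sub>R (b - b')"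
    by (simp add: u algebra_simps)
  then have "dist z ?z \<le> (1 - u) * dist a a' + u * dist b b'"
    using u by (metis abs_of_nonneg diff_ge_0_iff_ge dist_norm norm_scaleR norm_triangle_ineq)
  also have "\<dots> \<le> (1 - u) * r + u * r"
    using u assms by (intro add_mono mult_left_mono) auto
  also have "\<dots> = r" by (simp add: algebra_simps)
  finally have "dist z ?z \<le> r" .
  moreover have "?z \<in> closed_segment a' b'" using u by (auto simp: in_segment)
  ultimately show ?thesis using that by blast
qed

text \<open>One of the two suprema vanishes because \<open>K\<close> lies in the disk, so only the
  density of \<open>K\<close> in the disk has to be checked.\<close>

lemma hausdorff_dist_cball_le:
  assumes K: "K \<subseteq> cball 0 (1::real)" "K \<noteq> {}" and "0 \<le> \<epsilon>"
    and near: "\<And>z. z \<in> cball (0::complex) 1 \<Longrightarrow> \<exists>z'\<in>K. dist z z' \<le> \<epsilon>"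
  shows "\<bar>hausdorff_dist K (cball 0 1)\<bar> \<le> \<epsilon>"
proof -
  have 1: "(SUP x\<in>K. infdist x (cball (0::complex) 1)) = 0"
    using K by (subst SUP_cong[OF refl, of _ _ "\<lambda>_. 0"]) auto
  have "(SUP y\<in>cball 0 1. infdist y K) \<le> \<epsilon>"
    using near by (intro cSUP_least) (auto intro: infdist_le2)
  then show ?thesis
    using \<open>0 \<le> \<epsilon>\<close> by (simp add: hausdorff_dist_def 1)
qed

lemma segments_in_cball:
  assumes "\<And>c. c \<in> \<C> \<Longrightarrow> is_chord c"
  shows "closure (chord_union \<C>) \<subseteq> cball 0 1"
proof (rule closure_minimal)
  have "closed_segment X Y \<subseteq> cball 0 1" if "X \<in> sphere 0 1" "Y \<in> sphere 0 1" for X Y :: complex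
    using that by (intro closed_segment_subset) auto
  then have "c \<subseteq> cball 0 1" if "c \<in> \<C>" for c
    using assms[OF that] unfolding is_chord_def by blast
  then show "chord_union \<C> \<subseteq> cball 0 1" by (auto simp: chord_union_def)
qed auto

lemma piecewise_rotation_circ_in_sphere:
  assumes "generic (w i)" "X \<in> sphere 0 1"
  shows "piecewise_rotation (circ ` tset (w i)) X \<in> sphere 0 1"
proof -
  obtain x where x: "0 \<le> x" "x < 1" "X = circ x" using assms(2) by (rule circ_surj)
  then show ?thesis
    using piecewise_rotation_circ[of "tmin (w i)" "tmid (w i)" "tmax (w i)" x] generic_sorted[OF assms(1)]
    by simp
qed

lemma rotated_sieve_subset:
  assumes "\<And>i. 1 \<le> i \<Longrightarrow> generic (w i)"
  shows "rotated_sieve (cuts w) f g \<subseteq> cball 0 1"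
  unfolding rotated_sieve_def
proof (rule segments_in_cball)
  show "is_chord c" if "c \<in> iterated_rotation (cuts w) g (chords_in (excursion_lamination f))" for c
    using that
  proof (cases g)
    case (Suc n)
    have "\<And>X. X \<in> sphere 0 1 \<Longrightarrow> piecewise_rotation (cuts w (Suc n)) X \<in> sphere 0 1"
      unfolding cuts_def by (rule piecewise_rotation_circ_in_sphere) (simp_all add: assms)
    then show ?thesis using that unfolding Suc iterated_rotation.simps rotate_chords_def is_chord_def
      by blast
  qed (auto simp: chords_in_def)
qed

text \<open>For each \<open>n\<close> there are finitely many pairs of grid arcs, so all of them are
  hit simultaneously for large \<open>g\<close>. Moving both endpoints of a chord by at most
  \<open>1 / n\<close> of a turn moves its points by at most \<open>2 * pi / n\<close>.\<close>

lemma rotated_sieve_tendsto: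
  assumes f: "continuous_on {0..1} f" "\<And>t. t \<in> {0<..<1} \<Longrightarrow> 0 < f t"
    and w: "good_path f w"
    and hit: "\<And>n k l. k < n \<Longrightarrow> l < n \<Longrightarrow>
      \<forall>\<^sub>F g in sequentially. \<exists>j<g. hit w (Suc j) (g - Suc j) (grid_arc n k) (grid_arc n l)"
  shows "(\<lambda>g. hausdorff_dist (rotated_sieve (cuts w) f g) (cball 0 1)) \<longlonglongrightarrow> 0"
proof (rule tendstoI)
  fix \<epsilon> :: real assume "0 < \<epsilon>"
  obtain n :: nat where n: "2 * pi / \<epsilon> < real n" using reals_Archimedean2 by blast
  have n0: "0 < real n" using n \<open>0 < \<epsilon>\<close> by (smt (verit) divide_pos_pos pi_gt_zero)
  have nn: "2 * pi / n < \<epsilon>" using n n0 \<open>0 < \<epsilon>\<close> by (simp add: field_simps)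
  have gen: "\<And>i. 1 \<le> i \<Longrightarrow> generic (w i)" using w by (auto simp: good_path_def)
  have "\<forall>\<^sub>F g in sequentially. \<forall>k\<in>{..<n}. \<forall>l\<in>{..<n}. \<exists>j<g. hit w (Suc j) (g - Suc j) (grid_arc n k) (grid_arc n l)"
    by (intro eventually_ball_finite ballI hit) auto
  then show "\<forall>\<^sub>F g in sequentially. dist (hausdorff_dist (rotated_sieve (cuts w) f g) (cball 0 1)) 0 < \<epsilon>"
  proof eventually_elim
    case (elim g)
    \<comment> \<open>The arcs are open, as \<open>chord_of_hit\<close> demands, so a grid point
      \<open>a\<close> lies in none of them. It is assigned to its half-open cell and only compared
      with the points of the arc.\<close>
    have grid: "\<exists>k<n. \<forall>x\<in>grid_arc n k. \<bar>a - x\<bar> \<le> 1 / n" if "0 \<le> a" "a < 1" for a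
    proof -
      define k where "k = nat \<lfloor>a * n\<rfloor>"
      have k: "real k \<le> a * n" "a * n < real k + 1"
        using that n0 unfolding k_def by auto
      have kn: "k < n" using k that n0
        by (metis mult.commute mult_less_cancel_left2 not_le of_nat_less_iff order.strict_trans1 order_le_less)
      have "real k / n \<le> a" "a < (real k + 1) / n" using k n0 by (auto simp: field_simps)
      then have "\<forall>x\<in>grid_arc n k. \<bar>a - x\<bar> \<le> 1 / n"
        by (auto simp: grid_arc_def add_divide_distrib abs_le_iff)
      with kn show ?thesis by blast
    qed
    have "\<bar>hausdorff_dist (rotated_sieve (cuts w) f g) (cball 0 1)\<bar> \<le> 2 * pi / n"
    proof (rule hausdorff_dist_cball_le)
      show "rotated_sieve (cuts w) f g \<subseteq> cball 0 1" using gen by (rule rotated_sieve_subset)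
      show "rotated_sieve (cuts w) f g \<noteq> {}"
        using circ_in_sphere[of 0] by (auto simp: rotated_sieve_def chord_union_def)
      show "0 \<le> 2 * pi / n" by simp
      fix z :: complex assume "z \<in> cball 0 1"
      then obtain a b where ab: "0 \<le> a" "a < 1" "0 \<le> b" "b < 1" "z \<in> closed_segment (circ a) (circ b)"
        by (rule cball_on_chord)
      obtain k where k: "k < n" "\<forall>x\<in>grid_arc n k. \<bar>a - x\<bar> \<le> 1 / n" using grid ab by blast
      obtain l where l: "l < n" "\<forall>x\<in>grid_arc n l. \<bar>b - x\<bar> \<le> 1 / n" using grid ab by blast
      obtain j where j: "j < g" "hit w (Suc j) (g - Suc j) (grid_arc n k) (grid_arc n l)"
        using elim k l by blast
      obtain x y where xy: "x \<in> grid_arc n k" "y \<in> grid_arc n l"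
        "closed_segment (circ x) (circ y) \<in> iterated_rotation (cuts w) (Suc j + (g - Suc j)) (chords_in (excursion_lamination f))"
        by (rule chord_of_hit[OF f w _ _ j(2)]) (auto simp: grid_arc_def)
      have sub: "closed_segment (circ x) (circ y) \<subseteq> rotated_sieve (cuts w) f g"
        unfolding rotated_sieve_def chord_union_def
        using xy(3) j(1) by (intro order.trans[OF _ closure_subset]) auto
      have "dist (circ a) (circ x) \<le> 2 * pi / n"
        using dist_circ[of a x] k xy(1) mult_left_mono[of "\<bar>a - x\<bar>" "1 / n" "2 * pi"] by fastforce
      moreover have "dist (circ b) (circ y) \<le> 2 * pi / n"
        using dist_circ[of b y] l xy(2) mult_left_mono[of "\<bar>b - y\<bar>" "1 / n" "2 * pi"] by fastforce
      ultimately obtain z' where "z' \<in> closed_segment (circ x) (circ y)" "dist z z' \<le> 2 * pi / n"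
        using dist_closed_segment[OF ab(5)] by blast
      then show "\<exists>z'\<in>rotated_sieve (cuts w) f g. dist z z' \<le> 2 * pi / n"
        using sub by blast
    qed
    with nn show ?case by simp
  qed
qed

section \<open>Sequences of uniform triples\<close>

definition unif :: "real measure" where
  "unif = uniform_measure lborel {0..<1}"

definition triples :: "triple measure" where
  "triples = unif \<Otimes>\<^sub>M (unif \<Otimes>\<^sub>M unif)"

definition triple_seqs :: "(nat \<Rightarrow> triple) measure" where
  "triple_seqs = (\<Pi>\<^sub>M i\<in>{1..}. triples)"

lemma sets_unif [simp, measurable_cong]: "sets unif = sets borel"
  by (simp add: unif_def)

lemma space_unif [simp]: "space unif = UNIV"
  by (simp add: unif_def)

lemma emeasure_unif: "A \<in> sets borel \<Longrightarrow> emeasure unif A = emeasure lborel ({0..<1} \<inter> A)"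
  by (simp add: unif_def divide_ennreal_def)

lemma prob_space_unif: "prob_space unif"
  unfolding unif_def by (rule prob_space_uniform_measure) auto

lemma sets_triples [simp, measurable_cong]: "sets triples = sets (borel \<Otimes>\<^sub>M (borel \<Otimes>\<^sub>M borel))"
  unfolding triples_def by (intro sets_pair_measure_cong sets_unif)

lemma space_triples [simp]: "space triples = UNIV"
  by (simp add: triples_def space_pair_measure)

lemma prob_space_triples: "prob_space triples"
  unfolding triples_def by (intro prob_space_pair prob_space_unif)

lemma prob_space_triple_seqs: "prob_space triple_seqs"
  unfolding triple_seqs_def by (intro prob_space_PiM prob_space_triples)

interpretation unif: prob_space unif by (rule prob_space_unif)
interpretation triples: prob_space triples by (rule prob_space_triples)
interpretation triple_seqs: prob_space triple_seqs by (rule prob_space_triple_seqs)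

lemma AE_unif_neq: "AE x in unif. x \<noteq> c"
proof -
  have "emeasure unif {c} = 0"
    by (subst emeasure_unif) (auto simp: Int_insert_right)
  then show ?thesis by (intro AE_I[of _ _ "{c}"]) auto
qed

lemma AE_unif_01: "AE x in unif. x \<in> {0<..<1}"
proof -
  have "AE x in unif. x \<in> {0..<1}"
    unfolding unif_def by (rule AE_uniform_measureI) auto
  with AE_unif_neq[of 0] show ?thesis by eventually_elim auto
qed

lemma AE_triplesI:
  assumes "Measurable.pred (borel \<Otimes>\<^sub>M (borel \<Otimes>\<^sub>M borel)) P"
    and "AE p in unif. AE q in unif. AE r in unif. P (p, q, r)"
  shows "AE t in triples. P t"
proof -
  interpret a: pair_sigma_finite unif unif ..
  interpret ab: prob_space "unif \<Otimes>\<^sub>M unif" by (intro prob_space_pair prob_space_unif)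
  interpret b: pair_sigma_finite unif "unif \<Otimes>\<^sub>M unif" ..
  note [measurable] = assms(1)
  show ?thesis
    unfolding triples_def
  proof (rule b.AE_pair_measure)
    show "{t \<in> space (unif \<Otimes>\<^sub>M unif \<Otimes>\<^sub>M unif). P t} \<in> sets (unif \<Otimes>\<^sub>M unif \<Otimes>\<^sub>M unif)"
      by measurable
    show "AE p in unif. AE s in unif \<Otimes>\<^sub>M unif. P (p, s)"
      using assms(2)
    proof eventually_elim
      case (elim p)
      show ?case by (rule a.AE_pair_measure) (use elim in measurable)
    qed
  qed
qed

lemma AE_generic: "AE t in triples. generic t"
proof (rule AE_triplesI)
  show "Measurable.pred (borel \<Otimes>\<^sub>M (borel \<Otimes>\<^sub>M borel)) generic"
    unfolding generic_def by simp
  show "AE p in unif. AE q in unif. AE r in unif. generic (p, q, r)"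
    using AE_unif_01
  proof eventually_elim
    case (elim p)
    show ?case using AE_unif_01 AE_unif_neq[of p]
    proof eventually_elim
      case (elim q)
      show ?case using AE_unif_01 AE_unif_neq[of p] AE_unif_neq[of q]
        by eventually_elim (use elim \<open>p \<in> {0<..<1}\<close> in \<open>auto simp: generic_def\<close>)
    qed
  qed
qed

lemma AE_tset_disjoint:
  assumes "finite F"
  shows "AE t in triples. tset t \<inter> F = {}"
proof -
  have "AE t in triples. c \<notin> tset t" for c
  proof (rule AE_triplesI)
    show "Measurable.pred (borel \<Otimes>\<^sub>M (borel \<Otimes>\<^sub>M borel)) (\<lambda>t. c \<notin> tset t)"
      by (simp add: tset_def split_beta')
    show "AE p in unif. AE q in unif. AE r in unif. c \<notin> tset (p, q, r)"
      using AE_unif_neq[of c]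
    proof eventually_elim
      case (elim p)
      show ?case using AE_unif_neq[of c]
      proof eventually_elim
        case (elim q)
        show ?case using AE_unif_neq[of c]
          by eventually_elim (use elim \<open>p \<noteq> c\<close> in \<open>auto simp: tset_def\<close>)
      qed
    qed
  qed
  then have "AE t in triples. \<forall>c\<in>F. c \<notin> tset t"
    using assms by (simp add: AE_finite_all)
  then show ?thesis by eventually_elim auto
qed

section \<open>Resampling a single step\<close>

lemma triple_seqs_split:
  assumes "i \<ge> 1"
  shows "distr (triples \<Otimes>\<^sub>M (\<Pi>\<^sub>M i\<in>{1..} - {i}. triples)) triple_seqs (\<lambda>(x, X). X(i := x)) = triple_seqs"
  using distr_pair_PiM_eq_PiM[of "{1..} - {i}" "\<lambda>_. triples" i] assms prob_space_triples
  by (simp add: triple_seqs_def insert_absorb)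

lemma measurable_triple_seqs_upd:
  assumes "i \<ge> 1"
  shows "(\<lambda>(x, X). X(i := x)) \<in> measurable (triples \<Otimes>\<^sub>M (\<Pi>\<^sub>M i\<in>{1..} - {i}. triples)) triple_seqs"
proof -
  have "(\<lambda>(x, X). X(i := x)) \<in> measurable (triples \<Otimes>\<^sub>M (\<Pi>\<^sub>M i\<in>{1..} - {i}. triples)) (\<Pi>\<^sub>M i\<in>insert i ({1..} - {i}). triples)"
    unfolding split_beta' by (rule measurable_fun_upd[where J = "{1..} - {i}"]) auto
  then show ?thesis using assms by (simp add: triple_seqs_def insert_absorb)
qed

text \<open>Fubini's theorem with all the other steps frozen: step \<open>i\<close> is a fresh
  uniform triple given them.\<close>

lemma AE_triple_seqs_coordI:
  assumes "i \<ge> 1" and P: "{w \<in> space triple_seqs. P w} \<in> sets triple_seqs"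
    and "\<And>w. AE t in triples. P (w(i := t))"
  shows "AE w in triple_seqs. P w"
proof -
  let ?R = "\<Pi>\<^sub>M i\<in>{1..} - {i}. triples"
  interpret R: prob_space ?R by (intro prob_space_PiM prob_space_triples)
  interpret p: pair_sigma_finite triples ?R ..
  note m = measurable_triple_seqs_upd[OF assms(1)]
  have "AE (x, X) in triples \<Otimes>\<^sub>M ?R. P (X(i := x))"
  proof -
    have S: "{z \<in> space (triples \<Otimes>\<^sub>M ?R). P ((snd z)(i := fst z))} \<in> sets (triples \<Otimes>\<^sub>M ?R)"
      using measurable_sets[OF m P] measurable_space[OF m]
      by (auto simp: vimage_def Int_def split_beta' conj_commute cong: conj_cong)
    have "AE X in ?R. AE x in triples. P (X(i := x))" using assms(3) by simp
    then have "AE x in triples. AE X in ?R. P (X(i := x))"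
      by (rule iffD2[OF p.AE_commute[of "\<lambda>x X. P (X(i := x))", OF S]])
    then show ?thesis
      unfolding split_beta' by (rule iffD1[OF p.AE_pair_iff[of "\<lambda>x X. P (X(i := x))", OF S]])
  qed
  then have "AE w in distr (triples \<Otimes>\<^sub>M ?R) triple_seqs (\<lambda>(x, X). X(i := x)). P w"
    by (subst AE_distr_iff[OF m P]) (simp add: split_beta')
  then show ?thesis by (simp only: triple_seqs_split[OF assms(1)])
qed

text \<open>Conditioning in fibre form. As \<open>Q\<close> does not read step \<open>i\<close>, it
  is constant along each fibre and leaves the inner integral, where \<open>R\<close> contributes at
  most \<open>\<kappa>\<close>. The bound \<open>le\<close> is asked for at every point of
  \<open>Q\<close>, so conditional expectations do not appear.\<close>

lemma emeasure_triple_seqs_coord: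
  assumes "i \<ge> 1" and Q: "{w \<in> space triple_seqs. Q w} \<in> sets triple_seqs"
    and R: "{w \<in> space triple_seqs. Q w \<and> R w} \<in> sets triple_seqs"
    and indep: "\<And>w t. Q (w(i := t)) \<longleftrightarrow> Q w"
    and le: "\<And>w. Q w \<Longrightarrow> emeasure triples {t. R (w(i := t))} \<le> \<kappa>"
  shows "emeasure triple_seqs {w \<in> space triple_seqs. Q w \<and> R w} \<le> \<kappa> * emeasure triple_seqs {w \<in> space triple_seqs. Q w}"
proof -
  let ?R = "\<Pi>\<^sub>M i\<in>{1..} - {i}. triples"
  interpret R: prob_space ?R by (intro prob_space_PiM prob_space_triples)
  interpret p: pair_sigma_finite triples ?R ..
  note m = measurable_triple_seqs_upd[OF assms(1)]
  have em: "emeasure triple_seqs {w \<in> space triple_seqs. P w} = (\<integral>\<^sup>+X. emeasure triples {t. P (X(i := t))} \<partial>?R)"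
    if P: "{w \<in> space triple_seqs. P w} \<in> sets triple_seqs" for P
  proof -
    have "emeasure triple_seqs {w \<in> space triple_seqs. P w} =
        emeasure (distr (triples \<Otimes>\<^sub>M ?R) triple_seqs (\<lambda>(x, X). X(i := x))) {w \<in> space triple_seqs. P w}"
      by (simp only: triple_seqs_split[OF assms(1)])
    also have "\<dots> = emeasure (triples \<Otimes>\<^sub>M ?R) ((\<lambda>(x, X). X(i := x)) -` {w \<in> space triple_seqs. P w} \<inter> space (triples \<Otimes>\<^sub>M ?R))"
      by (rule emeasure_distr[OF m P])
    also have "\<dots> = (\<integral>\<^sup>+X. emeasure triples ((\<lambda>x. (x, X)) -` ((\<lambda>(x, X). X(i := x)) -` {w \<in> space triple_seqs. P w} \<inter> space (triples \<Otimes>\<^sub>M ?R))) \<partial>?R)"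
      by (rule p.emeasure_pair_measure_alt2) (rule measurable_sets[OF m P])
    also have "\<dots> = (\<integral>\<^sup>+X. emeasure triples {t. P (X(i := t))} \<partial>?R)"
    proof (rule nn_integral_cong)
      fix X assume "X \<in> space ?R"
      then have "(x, X) \<in> space (triples \<Otimes>\<^sub>M ?R)" for x by (simp add: space_pair_measure)
      moreover from this have "X(i := x) \<in> space triple_seqs" for x
        using measurable_space[OF m, of "(x, X)"] by simp
      ultimately show "emeasure triples ((\<lambda>x. (x, X)) -` ((\<lambda>(x, X). X(i := x)) -` {w \<in> space triple_seqs. P w} \<inter> space (triples \<Otimes>\<^sub>M ?R)))
         = emeasure triples {t. P (X(i := t))}"
        by (intro arg_cong[where f = "emeasure triples"]) auto
    qed
    finally show ?thesis .
  qed
  have "emeasure triple_seqs {w \<in> space triple_seqs. Q w \<and> R w} = (\<integral>\<^sup>+X. emeasure triples {t. Q X \<and> R (X(i := t))} \<partial>?R)"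
    by (simp add: em[OF R] indep)
  also have "\<dots> \<le> (\<integral>\<^sup>+X. \<kappa> * emeasure triples {t. Q X} \<partial>?R)"
  proof (rule nn_integral_mono)
    show "emeasure triples {t. Q X \<and> R (X(i := t))} \<le> \<kappa> * emeasure triples {t. Q X}" for X
      using le[of X] triples.emeasure_space_1 by (cases "Q X") auto
  qed
  also have "\<dots> = \<kappa> * (\<integral>\<^sup>+X. emeasure triples {t. Q X} \<partial>?R)"
  proof (rule nn_integral_cmult)
    \<comment> \<open>Step \<open>i\<close> is absent from \<open>?R\<close>. Any default value may
      be filled in, since \<open>Q\<close> ignores it, and this exhibits \<open>Q\<close> as an
      event of the remaining steps.\<close>
    have "{X \<in> space ?R. Q X} \<in> sets ?R"
    proof -
      have "(\<lambda>X. X(i := undefined)) \<in> measurable ?R triple_seqs"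
        using measurable_compose[OF _ m, of "\<lambda>X. (undefined, X)" ?R] by simp
      note um = this
      have "(\<lambda>X. X(i := undefined)) -` {w \<in> space triple_seqs. Q w} \<inter> space ?R = {X \<in> space ?R. Q X}"
        using measurable_space[OF um] by (auto simp: indep)
      then show ?thesis using measurable_sets[OF um Q] by simp
    qed
    then have "(\<lambda>X. if Q X then 1 else 0 :: ennreal) \<in> borel_measurable ?R" by simp
    moreover have "(\<lambda>X. emeasure triples {t. Q X}) = (\<lambda>X. if Q X then 1 else 0)"
      using triples.emeasure_space_1 by auto
    ultimately show "(\<lambda>X. emeasure triples {t. Q X}) \<in> borel_measurable ?R" by simp
  qed
  also have "(\<integral>\<^sup>+X. emeasure triples {t. Q X} \<partial>?R) = emeasure triple_seqs {w \<in> space triple_seqs. Q w}"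
    by (simp add: em[OF Q] indep)
  finally show ?thesis .
qed


section \<open>Measurability and genericity of orbits\<close>

lemma measurable_tmin [measurable]: "tmin \<in> borel_measurable (borel \<Otimes>\<^sub>M (borel \<Otimes>\<^sub>M borel))"
  unfolding tmin_def by measurable

lemma measurable_tmax [measurable]: "tmax \<in> borel_measurable (borel \<Otimes>\<^sub>M (borel \<Otimes>\<^sub>M borel))"
  unfolding tmax_def by measurable

lemma measurable_tmid [measurable]: "tmid \<in> borel_measurable (borel \<Otimes>\<^sub>M (borel \<Otimes>\<^sub>M borel))"
  unfolding tmid_def by measurable

lemma measurable_swap_at [measurable (raw)]:
  assumes [measurable]: "a \<in> borel_measurable M" "b \<in> borel_measurable M" "c \<in> borel_measurable M" "x \<in> borel_measurable M"
  shows "(\<lambda>w. swap_at (a w) (b w) (c w) (x w)) \<in> borel_measurable M"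
  unfolding swap_at_def by measurable

lemma measurable_triple_seqs_nth: "1 \<le> i \<Longrightarrow> (\<lambda>w. w i) \<in> measurable triple_seqs (borel \<Otimes>\<^sub>M (borel \<Otimes>\<^sub>M borel))"
  unfolding triple_seqs_def measurable_cong_sets[OF refl sets_triples[symmetric]]
  by (rule measurable_component_singleton) simp

lemma measurable_nth_comp:
  assumes "1 \<le> i" "f \<in> borel_measurable (borel \<Otimes>\<^sub>M (borel \<Otimes>\<^sub>M borel))"
  shows "(\<lambda>w. f (w i)) \<in> borel_measurable triple_seqs"
  using measurable_compose[OF measurable_triple_seqs_nth[OF assms(1)] assms(2)] .

lemma measurable_fwd:
  assumes "h \<in> borel_measurable triple_seqs"
  shows "(\<lambda>w. fwd w s n (h w)) \<in> borel_measurable triple_seqs"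
proof (induction n)
  case (Suc n)
  then show ?case
    by (auto simp: tswap_def intro!: measurable_swap_at measurable_nth_comp)
qed (use assms in simp)

lemma measurable_bwd:
  assumes "h \<in> borel_measurable triple_seqs"
  shows "(\<lambda>w. bwd w n (h w)) \<in> borel_measurable triple_seqs"
  using assms
proof (induction n arbitrary: h)
  case (Suc n)
  have "(\<lambda>w. tswap_inv (w (Suc n)) (h w)) \<in> borel_measurable triple_seqs"
    unfolding tswap_inv_def
    by (intro measurable_swap_at borel_measurable_diff borel_measurable_add measurable_nth_comp
        measurable_tmin measurable_tmax measurable_tmid Suc.prems) auto
  from Suc.IH[OF this] show ?case by simp
qed simp

lemma fwd_upd: "k \<le> s \<or> s + n < k \<Longrightarrow> fwd (w(k := t)) s n x = fwd w s n x"
  by (induction n) auto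

lemma sets_tset_neq:
  assumes "1 \<le> k" "1 \<le> i"
  shows "{w \<in> space triple_seqs. \<forall>p\<in>tset (w i). \<forall>q\<in>tset (w k). q \<noteq> fwd w s n p} \<in> sets triple_seqs"
proof -
  have t: "tset t = {fst t, fst (snd t), snd (snd t)}" for t :: triple
    by (simp add: tset_def split_beta')
  have m: "(\<lambda>w. fst (w j)) \<in> borel_measurable triple_seqs" "(\<lambda>w. fst (snd (w j))) \<in> borel_measurable triple_seqs"
    "(\<lambda>w. snd (snd (w j))) \<in> borel_measurable triple_seqs" if "1 \<le> j" for j
    by (rule measurable_nth_comp[OF that]; simp)+
  show ?thesis
    unfolding t ball_simps
    by (simp, intro sets.sets_Collect_conj borel_measurable_neq m measurable_fwd assms)
qed

text \<open>The orbit points in question depend on step \<open>i\<close> and on steps up to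
  \<open>s + n\<close>, all of them before \<open>k\<close>. Given those, step \<open>k\<close> has
  to avoid finitely many values.\<close>

lemma AE_triple_seqs_neq:
  assumes "1 \<le> i" "i < k" "s + n < k"
  shows "AE w in triple_seqs. \<forall>p\<in>tset (w i). \<forall>q\<in>tset (w k). q \<noteq> fwd w s n p"
proof (rule AE_triple_seqs_coordI[of k])
  show "{w \<in> space triple_seqs. \<forall>p\<in>tset (w i). \<forall>q\<in>tset (w k). q \<noteq> fwd w s n p} \<in> sets triple_seqs"
    using assms by (intro sets_tset_neq) auto
  fix w :: "nat \<Rightarrow> triple"
  have "finite (fwd w s n ` tset (w i))" by (simp add: tset_def split_beta')
  from AE_tset_disjoint[OF this]
  show "AE t in triples. \<forall>p\<in>tset ((w(k := t)) i). \<forall>q\<in>tset ((w(k := t)) k). q \<noteq> fwd (w(k := t)) s n p"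
    by eventually_elim (use assms in \<open>auto simp: fwd_upd\<close>)
qed (use assms in auto)

lemma pred_generic: "Measurable.pred (borel \<Otimes>\<^sub>M (borel \<Otimes>\<^sub>M borel)) generic"
  unfolding generic_def by simp

lemma AE_triple_seqs_generic: "AE w in triple_seqs. \<forall>i\<ge>1. generic (w i)"
proof -
  have "AE w in triple_seqs. generic (w i)" if "1 \<le> i" for i
  proof (rule AE_triple_seqs_coordI[OF that])
    show "{w \<in> space triple_seqs. generic (w i)} \<in> sets triple_seqs"
      using measurable_compose[OF measurable_triple_seqs_nth[OF that] pred_generic] by measurable
  qed (use AE_generic in simp)
  then show ?thesis by (subst AE_all_countable) auto
qed

section \<open>Rotations preserve Lebesgue measure\<close>

lemma emeasure_Ico_split:
  fixes l m h :: real
  assumes "l \<le> m" "m \<le> h" "A \<in> sets borel"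
  shows "emeasure lborel ({l..<h} \<inter> A) = emeasure lborel ({l..<m} \<inter> A) + emeasure lborel ({m..<h} \<inter> A)"
proof -
  have "{l..<h} \<inter> A = ({l..<m} \<inter> A) \<union> ({m..<h} \<inter> A)" using assms by auto
  then show ?thesis using assms by (simp only:) (subst plus_emeasure, auto)
qed

lemma emeasure_Ico_shift:
  fixes l h d :: real
  assumes A: "A \<in> sets borel"
  shows "emeasure lborel ({l..<h} \<inter> (\<lambda>x. x + d) -` A) = emeasure lborel ({l + d..<h + d} \<inter> A)"
proof -
  have "emeasure lborel ({l + d..<h + d} \<inter> A) = emeasure (distr lborel borel ((+) d)) ({l + d..<h + d} \<inter> A)"
    by (simp add: lborel_distr_plus)
  also have "\<dots> = emeasure lborel ((+) d -` ({l + d..<h + d} \<inter> A) \<inter> space lborel)"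
    using A by (intro emeasure_distr) auto
  also have "(+) d -` ({l + d..<h + d} \<inter> A) \<inter> space lborel = {l..<h} \<inter> (\<lambda>x. x + d) -` A"
    by (auto simp: add.commute)
  finally show ?thesis by simp
qed

text \<open>Both \<open>A\<close> and its preimage are cut into four pieces. The outer pieces agree,
  and the two middle ones are translates of each other in exchanged order.\<close>

lemma emeasure_unif_swap_at:
  assumes "0 \<le> a" "a \<le> b" "b \<le> c" "c \<le> 1" and A: "A \<in> sets borel"
  shows "emeasure unif (swap_at a b c -` A) = emeasure unif A"
proof -
  let ?f = "swap_at a b c" and ?L = "emeasure lborel"
  have "?f \<in> borel_measurable borel" by measurable
  from measurable_sets[OF this A] have m: "?f -` A \<in> sets borel" by simp
  have split: "?L ({0..<1} \<inter> B) = ?L ({0..<a} \<inter> B) + (?L ({a..<z} \<inter> B) + (?L ({z..<c} \<inter> B) + ?L ({c..<1} \<inter> B)))"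
    if "B \<in> sets borel" "a \<le> z" "z \<le> c" for z B
  proof -
    have "?L ({0..<1} \<inter> B) = ?L ({0..<a} \<inter> B) + ?L ({a..<1} \<inter> B)"
      by (rule emeasure_Ico_split) (use assms that in linarith | fact)+
    also have "?L ({a..<1} \<inter> B) = ?L ({a..<z} \<inter> B) + ?L ({z..<1} \<inter> B)"
      by (rule emeasure_Ico_split) (use assms that in linarith | fact)+
    also have "?L ({z..<1} \<inter> B) = ?L ({z..<c} \<inter> B) + ?L ({c..<1} \<inter> B)"
      by (rule emeasure_Ico_split) (use assms that in linarith | fact)+
    finally show ?thesis .
  qed
  have p: "{0..<a} \<inter> ?f -` A = {0..<a} \<inter> A" "{c..<1} \<inter> ?f -` A = {c..<1} \<inter> A"
    "{a..<b} \<inter> ?f -` A = {a..<b} \<inter> (\<lambda>x. x + (c - b)) -` A"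
    "{b..<c} \<inter> ?f -` A = {b..<c} \<inter> (\<lambda>x. x + (a - b)) -` A"
    using assms(1-4) by (auto simp: swap_at_def algebra_simps)
  have "emeasure unif (?f -` A) = ?L ({0..<1} \<inter> ?f -` A)" using m by (rule emeasure_unif)
  also have "\<dots> = ?L ({0..<a} \<inter> A) + (?L ({a..<b} \<inter> (\<lambda>x. x + (c - b)) -` A)
      + (?L ({b..<c} \<inter> (\<lambda>x. x + (a - b)) -` A) + ?L ({c..<1} \<inter> A)))"
    using split[OF m assms(2,3)] by (simp only: p)
  also have "?L ({a..<b} \<inter> (\<lambda>x. x + (c - b)) -` A) = ?L ({a + c - b..<c} \<inter> A)"
    using emeasure_Ico_shift[OF A, of a b "c - b"] by (simp add: algebra_simps)
  also have "?L ({b..<c} \<inter> (\<lambda>x. x + (a - b)) -` A) = ?L ({a..<a + c - b} \<inter> A)"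
    using emeasure_Ico_shift[OF A, of b c "a - b"] by (simp add: algebra_simps)
  \<comment> \<open>The pieces are listed in source order; interchanging the middle two gives their
    order in the target, cut at \<open>a + c - b\<close>.\<close>
  also have "?L ({a + c - b..<c} \<inter> A) + (?L ({a..<a + c - b} \<inter> A) + ?L ({c..<1} \<inter> A))
      = ?L ({a..<a + c - b} \<inter> A) + (?L ({a + c - b..<c} \<inter> A) + ?L ({c..<1} \<inter> A))"
    by (rule add.left_commute)
  also have "?L ({0..<a} \<inter> A) + \<dots> = ?L ({0..<1} \<inter> A)"
    by (rule split[OF A, symmetric]) (use assms in linarith)+
  also have "\<dots> = emeasure unif A" using A by (rule emeasure_unif[symmetric])
  finally show ?thesis .
qed

text \<open>Weaker than \<open>generic\<close>: cut points may coincide or be 0, and the possibly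
  degenerate exchange still preserves the measure.\<close>

definition in01 :: "triple \<Rightarrow> bool" where
  "in01 t \<longleftrightarrow> tset t \<subseteq> {0..<1}"

lemma in01_sorted: "in01 t \<Longrightarrow> 0 \<le> tmin t \<and> tmin t \<le> tmid t \<and> tmid t \<le> tmax t \<and> tmax t \<le> 1"
  by (cases t) (auto simp: in01_def tset_def tmin_def tmid_def tmax_def min_def max_def)

lemma generic_in01: "generic t \<Longrightarrow> in01 t"
  by (cases t) (auto simp: generic_def in01_def tset_def)

lemma borel_measurable_tswap: "tswap t \<in> borel_measurable borel"
  unfolding tswap_def by simp

lemma borel_measurable_fwd: "fwd w s n \<in> borel_measurable borel"
proof (induction n)
  case (Suc n)
  then show ?case using measurable_compose[OF Suc borel_measurable_tswap] by simp
qed simp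

lemma emeasure_unif_fwd:
  assumes "\<And>k. s < k \<Longrightarrow> k \<le> s + n \<Longrightarrow> in01 (w k)" "A \<in> sets borel"
  shows "emeasure unif (fwd w s n -` A) = emeasure unif A"
  using assms
proof (induction n arbitrary: A)
  case (Suc n)
  let ?t = "w (Suc (s + n))"
  have m: "tswap ?t -` A \<in> sets borel"
    using measurable_sets[OF borel_measurable_tswap Suc.prems(2)] by simp
  have "fwd w s (Suc n) -` A = fwd w s n -` (tswap ?t -` A)" by auto
  then have "emeasure unif (fwd w s (Suc n) -` A) = emeasure unif (tswap ?t -` A)"
    using Suc.IH[OF _ m] Suc.prems(1) by simp
  also have "\<dots> = emeasure unif A"
    unfolding tswap_def using in01_sorted[of ?t] Suc.prems by (intro emeasure_unif_swap_at) auto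
  finally show ?case .
next
  case 0
  have "fwd w s 0 = (\<lambda>x. x)" by auto
  then show ?case by simp
qed

section \<open>Hitting a pair of arcs\<close>

lemma unif_between:
  assumes "p \<in> {0..<1}" "q \<in> {0..<1}"
  shows "emeasure unif {r. p < r \<and> r < q \<or> q < r \<and> r < p} = ennreal \<bar>p - q\<bar>"
proof -
  have "{r. p < r \<and> r < q \<or> q < r \<and> r < p} = {min p q<..<max p q}" by auto
  moreover have "{0..<1} \<inter> {min p q<..<max p q} = {min p q<..<max p q}" using assms by auto
  ultimately show ?thesis by (simp add: emeasure_unif max_def min_def)
qed

lemma emeasure_unif_le: "emeasure unif {a<..<b} \<le> ennreal (b - a)"
proof -
  have "emeasure unif {a<..<b} \<le> emeasure lborel {a<..<b}"
    by (subst emeasure_unif) (auto intro: emeasure_mono)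
  also have "\<dots> \<le> ennreal (b - a)" by (cases "a \<le> b") auto
  finally show ?thesis .
qed

text \<open>If \<open>r\<close> lies between \<open>p\<close> and \<open>q\<close>, then \<open>p\<close> and \<open>q\<close> are the outer cut points.\<close>

lemma emeasure_triples_separated:
  assumes S: "S1 \<in> sets borel" "S2 \<in> sets borel" and l: "0 \<le> l"
    and U: "emeasure unif S1 = ennreal l" "emeasure unif S2 = ennreal l"
  shows "{(p, q, r). p \<in> S1 \<and> q \<in> S2 \<and> (p < r \<and> r < q \<or> q < r \<and> r < p)} \<in> sets triples" (is "?D \<in> _")
    and "ennreal (l ^ 3 / 8) \<le> emeasure triples {(p, q, r). p \<in> S1 \<and> q \<in> S2 \<and> (p < r \<and> r < q \<or> q < r \<and> r < p)}"
proof -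
  note [measurable] = S
  have "Measurable.pred (borel \<Otimes>\<^sub>M borel \<Otimes>\<^sub>M borel) (\<lambda>(p, q, r). p \<in> S1 \<and> q \<in> S2 \<and> (p < r \<and> r < q \<or> q < r \<and> r < p))"
    by measurable
  then show D: "?D \<in> sets triples"
    by (simp add: pred_def space_pair_measure)
  interpret uu: prob_space "unif \<Otimes>\<^sub>M unif" by (intro prob_space_pair prob_space_unif)
  have inner: "ennreal (l\<^sup>2 / 8) \<le> emeasure (unif \<Otimes>\<^sub>M unif) (Pair p -` ?D)" if p: "p \<in> S1" "p \<in> {0..<1}" for p
  proof -
    have Dp: "Pair p -` ?D \<in> sets (unif \<Otimes>\<^sub>M unif)"
      using D unfolding triples_def by (rule sets_Pair1)
    \<comment> \<open>Origin of \<open>l ^ 3 / 8\<close>: \<open>p\<close> has mass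
      \<open>l\<close>; removing the ball of radius \<open>l / 4\<close> around \<open>p\<close>
      leaves mass at least \<open>l / 2\<close> for \<open>q\<close>; then \<open>r\<close> falls
      between them with probability at least \<open>l / 4\<close>. The removal is what handles
      overlapping \<open>S1\<close> and \<open>S2\<close>, in particular two equal arcs.\<close>
    define B where "B = {p - l / 4<..<p + l / 4}"
    define T where "T = {0..<1} \<inter> S2 - B"
    have [measurable]: "T \<in> sets borel" by (simp add: T_def B_def S)
    have "ennreal l = emeasure unif ({0..<1} \<inter> S2)"
      using U S by (simp add: emeasure_unif Int_assoc[symmetric])
    also have "\<dots> \<le> emeasure unif (T \<union> B)"
      by (rule emeasure_mono) (auto simp: T_def B_def S)
    also have "\<dots> \<le> emeasure unif T + emeasure unif B"
      by (rule emeasure_subadditive) (simp_all add: B_def)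
    also have "\<dots> \<le> emeasure unif T + ennreal (l / 2)"
      using emeasure_unif_le[of "p - l / 4" "p + l / 4"] by (intro add_left_mono) (simp add: B_def)
    finally have "l \<le> measure unif T + l / 2"
      using l by (simp add: unif.emeasure_eq_measure ennreal_plus[symmetric] del: ennreal_plus)
    then have T: "ennreal (l / 2) \<le> emeasure unif T"
      by (simp add: unif.emeasure_eq_measure)
    have "ennreal (l\<^sup>2 / 8) = ennreal (l / 4) * ennreal (l / 2)"
      using l by (simp add: ennreal_mult[symmetric] power2_eq_square)
    also have "\<dots> \<le> ennreal (l / 4) * emeasure unif T"
      by (intro mult_left_mono T) simp
    also have "\<dots> = (\<integral>\<^sup>+q. ennreal (l / 4) * indicator T q \<partial>unif)"
      by (simp add: nn_integral_cmult_indicator)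
    also have "\<dots> \<le> (\<integral>\<^sup>+q. emeasure unif (Pair q -` (Pair p -` ?D)) \<partial>unif)"
    proof (rule nn_integral_mono)
      fix q
      show "ennreal (l / 4) * indicator T q \<le> emeasure unif (Pair q -` (Pair p -` ?D))"
      proof (cases "q \<in> T")
        case True
        then have "q \<in> {0..<1}" "q \<in> S2" "l / 4 \<le> \<bar>p - q\<bar>"
            by (auto simp: T_def B_def abs_if)
        moreover have "Pair q -` (Pair p -` ?D) = {r. p < r \<and> r < q \<or> q < r \<and> r < p}"
          using p \<open>q \<in> S2\<close> by auto
        ultimately show ?thesis using unif_between[OF p(2), of q] True by (simp add: ennreal_leI)
      qed simp
    qed
    also have "\<dots> = emeasure (unif \<Otimes>\<^sub>M unif) (Pair p -` ?D)"
      by (rule unif.emeasure_pair_measure_alt[symmetric, OF Dp])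
    finally show ?thesis .
  qed
  have "ennreal (l ^ 3 / 8) = ennreal (l\<^sup>2 / 8) * ennreal l"
    using l by (simp add: ennreal_mult[symmetric] power2_eq_square power3_eq_cube)
  also have "ennreal l = emeasure unif ({0..<1} \<inter> S1)"
    using U S by (simp add: emeasure_unif Int_assoc[symmetric])
  also have "ennreal (l\<^sup>2 / 8) * \<dots> = (\<integral>\<^sup>+p. ennreal (l\<^sup>2 / 8) * indicator ({0..<1} \<inter> S1) p \<partial>unif)"
    by (rule nn_integral_cmult_indicator[symmetric]) (simp add: S)
  also have "\<dots> \<le> (\<integral>\<^sup>+p. emeasure (unif \<Otimes>\<^sub>M unif) (Pair p -` ?D) \<partial>unif)"
    using inner by (intro nn_integral_mono) (auto split: split_indicator)
  also have "\<dots> = emeasure triples ?D"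
    using D unfolding triples_def by (rule uu.emeasure_pair_measure_alt[symmetric])
  finally show "ennreal (l ^ 3 / 8) \<le> emeasure triples ?D" .
qed

lemma hit_upd: "k < j \<Longrightarrow> hit (w(k := t)) j m I J = hit w j m I J"
  by (simp add: hit_def fwd_upd)

lemma hit_upd_self:
  "hit (w(k := t)) k m I J \<longleftrightarrow> fwd w k m (tmin t) \<in> I \<and> fwd w k m (tmax t) \<in> J \<or>
     fwd w k m (tmin t) \<in> J \<and> fwd w k m (tmax t) \<in> I"
  by (simp add: hit_def fwd_upd Let_def)

text \<open>Whatever the later steps are, they pull \<open>I\<close> and \<open>J\<close> back to
  sets of the same measure \<open>l\<close>. The failure bound is therefore uniform over these
  steps, although the events themselves vary with them.\<close>

lemma emeasure_not_hit:
  assumes w: "\<And>k. i < k \<Longrightarrow> k \<le> i + m \<Longrightarrow> in01 (w k)" and IJ: "I \<in> sets borel" "J \<in> sets borel"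
    and l: "0 \<le> l" and U: "emeasure unif I = ennreal l" "emeasure unif J = ennreal l"
  shows "emeasure triples {t. \<not> hit (w(i := t)) i m I J} \<le> ennreal (1 - l ^ 3 / 8)"
proof -
  let ?\<phi> = "fwd w i m"
  let ?D = "{(p, q, r). p \<in> ?\<phi> -` I \<and> q \<in> ?\<phi> -` J \<and> (p < r \<and> r < q \<or> q < r \<and> r < p)}"
  have pre: "?\<phi> -` I \<in> sets borel" "?\<phi> -` J \<in> sets borel"
    using measurable_sets[OF borel_measurable_fwd IJ(1)] measurable_sets[OF borel_measurable_fwd IJ(2)] by simp_all
  have "emeasure unif (?\<phi> -` I) = ennreal l" "emeasure unif (?\<phi> -` J) = ennreal l"
    using emeasure_unif_fwd[of i m w] w IJ U by simp_all
  note D = emeasure_triples_separated[OF pre l this]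
  have nD: "t \<notin> ?D" if "\<not> hit (w(i := t)) i m I J" for t
    using that by (cases t) (auto simp: hit_upd_self tmin_def tmax_def min_def max_def)
  have "emeasure triples {t. \<not> hit (w(i := t)) i m I J} \<le> emeasure triples (space triples - ?D)"
  proof (rule emeasure_mono)
    show "{t. \<not> hit (w(i := t)) i m I J} \<subseteq> space triples - ?D"
      unfolding space_triples using nD by blast
    show "space triples - ?D \<in> sets triples" using D(1) by (rule sets.compl_sets)
  qed
  also have "\<dots> = ennreal (1 - measure triples ?D)"
    using D(1) by (simp only: triples.emeasure_eq_measure triples.prob_compl)
  also have "\<dots> \<le> ennreal (1 - l ^ 3 / 8)"
    using D(2) l by (intro ennreal_leI) (simp add: triples.emeasure_eq_measure)
  finally show ?thesis .
qed

text \<open>All steps after \<open>j\<close> fail to produce the chord wanted at time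
  \<open>g\<close>; the event reads only coordinates beyond \<open>j\<close>. The condition
  \<open>in01\<close> is built in because the bound on a fibre must hold for every sequence of the
  event, and it relies on the later steps preserving measure.\<close>

definition miss :: "nat \<Rightarrow> real set \<Rightarrow> real set \<Rightarrow> nat \<Rightarrow> (nat \<Rightarrow> triple) \<Rightarrow> bool" where
  "miss g I J j w \<longleftrightarrow> (\<forall>k\<in>{j<..g}. in01 (w k) \<and> \<not> hit w k (g - k) I J)"

lemma sets_miss:
  assumes IJ: "I \<in> sets borel" "J \<in> sets borel"
  shows "{w \<in> space triple_seqs. miss g I J j w} \<in> sets triple_seqs"
proof -
  have i: "Measurable.pred (borel \<Otimes>\<^sub>M borel \<Otimes>\<^sub>M borel) in01"
    unfolding in01_def tset_def split_beta' by simp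
  have "{w \<in> space triple_seqs. in01 (w k) \<and> \<not> hit w k (g - k) I J} \<in> sets triple_seqs" if "1 \<le> k" for k
  proof -
    have [measurable]: "Measurable.pred triple_seqs (\<lambda>w. in01 (w k))"
      using measurable_compose[OF measurable_triple_seqs_nth[OF that] i] .
    have [measurable]: "(\<lambda>w. fwd w k (g - k) (tmin (w k))) \<in> borel_measurable triple_seqs"
      "(\<lambda>w. fwd w k (g - k) (tmax (w k))) \<in> borel_measurable triple_seqs"
      by (intro measurable_fwd measurable_nth_comp that measurable_tmin measurable_tmax)+
    note [measurable] = IJ
    show ?thesis unfolding hit_def Let_def by measurable
  qed
  then show ?thesis unfolding miss_def by (intro sets.sets_Collect_finite_All) auto
qed

text \<open>Here \<open>d\<close> counts the last steps already integrated out. Passing from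
  \<open>d\<close> to \<open>Suc d\<close> adds the earlier step \<open>g - d\<close>, which is
  independent of the failures already accounted for.\<close>

lemma emeasure_miss:
  assumes IJ: "I \<in> sets borel" "J \<in> sets borel"
    and l: "0 \<le> l" and U: "emeasure unif I = ennreal l" "emeasure unif J = ennreal l"
  shows "d \<le> g \<Longrightarrow> emeasure triple_seqs {w \<in> space triple_seqs. miss g I J (g - d) w} \<le> ennreal (1 - l ^ 3 / 8) ^ d"
proof (induction d)
  case 0
  then show ?case by (simp add: miss_def triple_seqs.emeasure_space_1)
next
  case (Suc d)
  define i where "i = g - d"
  have i: "1 \<le> i" "i \<le> g" "g - Suc d = i - 1" using Suc.prems by (auto simp: i_def)
  let ?R = "\<lambda>w. in01 (w i) \<and> \<not> hit w i (g - i) I J"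
  have "{i - 1<..g} = insert i {i<..g}" using i by auto
  then have eq: "miss g I J (i - 1) w \<longleftrightarrow> miss g I J i w \<and> ?R w" for w
    by (auto simp: miss_def)
  have "emeasure triple_seqs {w \<in> space triple_seqs. miss g I J i w \<and> ?R w}
      \<le> ennreal (1 - l ^ 3 / 8) * emeasure triple_seqs {w \<in> space triple_seqs. miss g I J i w}"
  proof (rule emeasure_triple_seqs_coord[OF i(1)])
    show "{w \<in> space triple_seqs. miss g I J i w} \<in> sets triple_seqs" by (rule sets_miss[OF IJ])
    show "{w \<in> space triple_seqs. miss g I J i w \<and> ?R w} \<in> sets triple_seqs"
      using sets_miss[OF IJ, of g "i - 1"] unfolding eq .
    show "miss g I J i (w(i := t)) = miss g I J i w" for w t
      by (auto simp: miss_def hit_upd)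
    fix w assume w: "miss g I J i w"
    have "emeasure triples {t. ?R (w(i := t))} \<le> emeasure triples {t. \<not> hit (w(i := t)) i (g - i) I J}"
    proof (rule emeasure_mono)
      have [measurable]: "fwd w i (g - i) \<in> borel_measurable borel" by (rule borel_measurable_fwd)
      note [measurable] = IJ
      have "Measurable.pred (borel \<Otimes>\<^sub>M borel \<Otimes>\<^sub>M borel) (\<lambda>t. \<not> hit (w(i := t)) i (g - i) I J)"
        unfolding hit_upd_self by measurable
      then show "{t. \<not> hit (w(i := t)) i (g - i) I J} \<in> sets triples"
        by (simp add: pred_def space_pair_measure)
    qed auto
    also have "\<dots> \<le> ennreal (1 - l ^ 3 / 8)"
      by (rule emeasure_not_hit[OF _ IJ l U]) (use w i in \<open>auto simp: miss_def\<close>)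
    finally show "emeasure triples {t. ?R (w(i := t))} \<le> ennreal (1 - l ^ 3 / 8)" .
  qed
  also have "\<dots> \<le> ennreal (1 - l ^ 3 / 8) * ennreal (1 - l ^ 3 / 8) ^ d"
    using Suc.IH Suc.prems by (intro mult_left_mono) (auto simp: i_def)
  finally show ?case unfolding i(3) eq by simp
qed

lemma emeasure_unif_grid_arc:
  assumes "k < n"
  shows "emeasure unif (grid_arc n k) = ennreal (1 / n)"
proof -
  let ?a = "real k / real n" and ?b = "real (Suc k) / real n"
  have "0 \<le> ?a" "?b \<le> 1" using assms by (simp_all add: divide_le_eq)
  moreover have "{0..<1} \<inter> {a<..<b} = {a<..<b}" if "0 \<le> a" "b \<le> 1" for a b :: real
    using that by auto
  ultimately have "{0..<1} \<inter> {?a<..<?b} = {?a<..<?b}" by blast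
  moreover have "?a \<le> ?b" by (intro divide_right_mono) auto
  moreover have "?b - ?a = 1 / n" by (simp add: diff_divide_distrib[symmetric])
  ultimately show ?thesis by (simp add: grid_arc_def emeasure_unif del: of_nat_Suc)
qed

text \<open>Since the preimages change with \<open>g\<close>, a success for one \<open>g\<close>
  says nothing about the next. The geometric bound is applied separately to every \<open>g\<close>,
  and summability over \<open>g\<close> gives success for all large \<open>g\<close>.\<close>

lemma AE_triple_seqs_hit:
  assumes "k < n" "l < n"
  shows "AE w in triple_seqs. \<forall>\<^sub>F g in sequentially. \<exists>j<g. hit w (Suc j) (g - Suc j) (grid_arc n k) (grid_arc n l)"
proof -
  let ?I = "grid_arc n k" and ?J = "grid_arc n l"
  let ?A = "\<lambda>g. {w \<in> space triple_seqs. miss g ?I ?J 0 w}"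
  have IJ: "?I \<in> sets borel" "?J \<in> sets borel" by (simp_all add: grid_arc_def)
  define r where "r = 1 - (1 / real n) ^ 3 / 8"
  have "0 < (1 / real n) ^ 3" "(1 / real n) ^ 3 \<le> 1"
    using assms by (auto simp: power_le_one)
  then have r: "0 \<le> r" "r < 1" by (auto simp: r_def)
  have "AE w in triple_seqs. eventually (\<lambda>g. w \<in> space triple_seqs - ?A g) sequentially"
  proof (rule borel_cantelli_AE1)
    show "?A g \<in> sets triple_seqs" for g by (rule sets_miss[OF IJ])
    show "emeasure triple_seqs (?A g) < \<infinity>" for g by (simp add: triple_seqs.emeasure_eq_measure)
    have "measure triple_seqs (?A g) \<le> r ^ g" for g
      using emeasure_miss[OF IJ _ emeasure_unif_grid_arc[OF assms(1)] emeasure_unif_grid_arc[OF assms(2)], of g g] r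
      by (simp add: r_def[symmetric] triple_seqs.emeasure_eq_measure ennreal_power)
    then show "summable (\<lambda>g. measure triple_seqs (?A g))"
      using r by (intro summable_comparison_test_ev[OF _ summable_geometric[of r]]) auto
  qed
  with AE_triple_seqs_generic AE_space show ?thesis
  proof eventually_elim
    case (elim w)
    from elim(3) show ?case
    proof eventually_elim
      case (elim g)
      then obtain i where i: "i \<in> {0<..g}" "\<not> (in01 (w i) \<and> \<not> hit w i (g - i) ?I ?J)"
        by (auto simp: miss_def)
      with \<open>\<forall>i\<ge>1. generic (w i)\<close> have "hit w i (g - i) ?I ?J" by (auto simp: generic_in01)
      with i show ?case by (intro exI[of _ "i - 1"]) auto
    qed
  qed
qed

section \<open>One-sided local minima of the excursion\<close>

text \<open>\<open>x (j 0)\<close> is the value of the path at a time \<open>u\<close> and \<open>x (j 1), x (j 2), \<dots>\<close> are its values at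
  times moving away from \<open>u\<close>, so \<open>j\<close> is increasing to the right of \<open>u\<close> and decreasing to the left. With
  lacunary times each increment dominates all the previous ones and hence has a fixed chance of
  bringing the path below its value at \<open>u\<close>.\<close>

primrec chain :: "(real \<Rightarrow> ennreal) \<Rightarrow> (nat \<Rightarrow> real \<Rightarrow> real \<Rightarrow> real \<Rightarrow> ennreal) \<Rightarrow> (nat \<Rightarrow> nat) \<Rightarrow> nat \<Rightarrow> (nat \<Rightarrow> real) \<Rightarrow> ennreal" where
  "chain \<phi> k j 0 x = \<phi> (x (j 0))"
| "chain \<phi> k j (Suc n) x = chain \<phi> k j n x * k n (x (j 0)) (x (j n)) (x (j (Suc n)))"

lemma chain_cong: "(\<And>i. i \<le> n \<Longrightarrow> x (j i) = y (j i)) \<Longrightarrow> chain \<phi> k j n x = chain \<phi> k j n y"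
  by (induction n) auto

lemma measurable_PiM_nth: "i \<in> I \<Longrightarrow> (\<lambda>x. x i) \<in> borel_measurable (\<Pi>\<^sub>M i\<in>I. lborel)"
  using measurable_component_singleton[of i I "\<lambda>_. lborel"] by simp

lemma measurable_chain:
  assumes [measurable]: "\<phi> \<in> borel_measurable borel"
    and k: "\<And>i. (\<lambda>(a, b, c). k i a b c) \<in> borel_measurable (borel \<Otimes>\<^sub>M borel \<Otimes>\<^sub>M borel)"
    and "j ` {..n} \<subseteq> I"
  shows "chain \<phi> k j n \<in> borel_measurable (\<Pi>\<^sub>M i\<in>I. lborel)"
  using assms(3)
proof (induction n)
  case 0
  then have [measurable]: "(\<lambda>x. x (j 0)) \<in> borel_measurable (\<Pi>\<^sub>M i\<in>I. lborel)"
    by (intro measurable_PiM_nth) auto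
  have "chain \<phi> k j 0 = (\<lambda>x. \<phi> (x (j 0)))" by auto
  then show ?case by simp
next
  case (Suc n)
  then have "chain \<phi> k j n \<in> borel_measurable (\<Pi>\<^sub>M i\<in>I. lborel)" by (intro Suc.IH) auto
  note [measurable] = this
  have j: "j 0 \<in> I" "j n \<in> I" "j (Suc n) \<in> I" using Suc.prems by auto
  note [measurable] = j[THEN measurable_PiM_nth]
  have "(\<lambda>x. (x (j 0), x (j n), x (j (Suc n)))) \<in> measurable (\<Pi>\<^sub>M i\<in>I. lborel) (borel \<Otimes>\<^sub>M borel \<Otimes>\<^sub>M borel)"
    by measurable
  from measurable_compose[OF this k[of n]]
  have [measurable]: "(\<lambda>x. k n (x (j 0)) (x (j n)) (x (j (Suc n)))) \<in> borel_measurable (\<Pi>\<^sub>M i\<in>I. lborel)"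
    by simp
  have "chain \<phi> k j (Suc n) = (\<lambda>x. chain \<phi> k j n x * k n (x (j 0)) (x (j n)) (x (j (Suc n))))" by auto
  then show ?case by simp
qed

interpretation lborel_product: product_sigma_finite "\<lambda>_::nat. lborel :: real measure"
  by standard

text \<open>The newest coordinate occurs only in the last kernel and in \<open>g\<close>, so it is
  integrated first. Taking \<open>g\<close> to be 1 yields the total mass, and taking the squared
  displacement from the start yields the second moment.\<close>

lemma nn_integral_chain_Suc:
  assumes \<phi>: "\<phi> \<in> borel_measurable borel"
    and k: "\<And>i. (\<lambda>(a, b, c). k i a b c) \<in> borel_measurable (borel \<Otimes>\<^sub>M borel \<Otimes>\<^sub>M borel)"
    and g: "(\<lambda>(a, b). g a b) \<in> borel_measurable (borel \<Otimes>\<^sub>M borel)"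
    and inj: "inj_on j {..Suc n}"
  shows "(\<integral>\<^sup>+x. chain \<phi> k j (Suc n) x * g (x (j 0)) (x (j (Suc n))) \<partial>(\<Pi>\<^sub>M i\<in>j ` {..Suc n}. lborel)) =
    (\<integral>\<^sup>+x. chain \<phi> k j n x * (\<integral>\<^sup>+y. k n (x (j 0)) (x (j n)) y * g (x (j 0)) y \<partial>lborel) \<partial>(\<Pi>\<^sub>M i\<in>j ` {..n}. lborel))"
proof -
  have ins: "j ` {..Suc n} = insert (j (Suc n)) (j ` {..n})" by (simp add: atMost_Suc)
  have ne: "j i \<noteq> j (Suc n)" if "i \<le> n" for i
    using inj that by (auto dest: inj_onD)
  then have nin: "j (Suc n) \<notin> j ` {..n}" by force
  have [measurable]: "(\<lambda>x. g (x (j 0)) (x (j (Suc n)))) \<in> borel_measurable (\<Pi>\<^sub>M i\<in>j ` {..Suc n}. lborel)"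
  proof -
    have "(\<lambda>x. (x (j 0), x (j (Suc n)))) \<in> measurable (\<Pi>\<^sub>M i\<in>j ` {..Suc n}. lborel) (borel \<Otimes>\<^sub>M borel)"
      by (intro measurable_Pair measurable_PiM_nth) auto
    from measurable_compose[OF this g] show ?thesis by simp
  qed
  have [measurable]: "chain \<phi> k j (Suc n) \<in> borel_measurable (\<Pi>\<^sub>M i\<in>j ` {..Suc n}. lborel)"
    by (rule measurable_chain[OF \<phi> k]) simp
  have "(\<lambda>x. chain \<phi> k j (Suc n) x * g (x (j 0)) (x (j (Suc n)))) \<in> borel_measurable (\<Pi>\<^sub>M i\<in>j ` {..Suc n}. lborel)"
    by measurable
  then have "(\<integral>\<^sup>+x. chain \<phi> k j (Suc n) x * g (x (j 0)) (x (j (Suc n))) \<partial>(\<Pi>\<^sub>M i\<in>j ` {..Suc n}. lborel)) =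
     (\<integral>\<^sup>+x. (\<integral>\<^sup>+y. chain \<phi> k j (Suc n) (x(j (Suc n) := y)) * g ((x(j (Suc n) := y)) (j 0)) ((x(j (Suc n) := y)) (j (Suc n))) \<partial>lborel)
        \<partial>(\<Pi>\<^sub>M i\<in>j ` {..n}. lborel))"
    unfolding ins by (intro lborel_product.product_nn_integral_insert nin) auto
  also have "\<dots> = (\<integral>\<^sup>+x. (\<integral>\<^sup>+y. chain \<phi> k j n x * (k n (x (j 0)) (x (j n)) y * g (x (j 0)) y) \<partial>lborel) \<partial>(\<Pi>\<^sub>M i\<in>j ` {..n}. lborel))"
  proof (intro nn_integral_cong)
    fix x y
    have "chain \<phi> k j n (x(j (Suc n) := y)) = chain \<phi> k j n x" by (rule chain_cong) (simp add: ne)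
    then show "chain \<phi> k j (Suc n) (x(j (Suc n) := y)) * g ((x(j (Suc n) := y)) (j 0)) ((x(j (Suc n) := y)) (j (Suc n)))
       = chain \<phi> k j n x * (k n (x (j 0)) (x (j n)) y * g (x (j 0)) y)"
      using ne[of 0] ne[of n] by (simp add: mult.assoc)
  qed
  also have "\<dots> = (\<integral>\<^sup>+x. chain \<phi> k j n x * (\<integral>\<^sup>+y. k n (x (j 0)) (x (j n)) y * g (x (j 0)) y \<partial>lborel) \<partial>(\<Pi>\<^sub>M i\<in>j ` {..n}. lborel))"
  proof (intro nn_integral_cong nn_integral_cmult)
    fix x :: "nat \<Rightarrow> real"
    have "(\<lambda>y. (x (j 0), x (j n), y)) \<in> measurable lborel (borel \<Otimes>\<^sub>M borel \<Otimes>\<^sub>M borel)" by measurable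
    from measurable_compose[OF this k[of n]]
    have [measurable]: "(\<lambda>y. k n (x (j 0)) (x (j n)) y) \<in> borel_measurable lborel" by simp
    have "(\<lambda>y. (x (j 0), y)) \<in> measurable lborel (borel \<Otimes>\<^sub>M borel)" by measurable
    from measurable_compose[OF this g] have [measurable]: "(\<lambda>y. g (x (j 0)) y) \<in> borel_measurable lborel" by simp
    show "(\<lambda>y. k n (x (j 0)) (x (j n)) y * g (x (j 0)) y) \<in> borel_measurable lborel" by measurable
  qed
  finally show ?thesis .
qed

lemma nn_integral_chain_0:
  assumes "\<phi> \<in> borel_measurable borel"
  shows "(\<integral>\<^sup>+x. chain \<phi> k j 0 x \<partial>(\<Pi>\<^sub>M i\<in>j ` {..0}. lborel)) = (\<integral>\<^sup>+y. \<phi> y \<partial>lborel)"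
  using assms lborel_product.product_nn_integral_singleton[of \<phi> "j 0"] by simp

section \<open>Gaussian walks with growing steps\<close>

abbreviation gauss :: "(nat \<Rightarrow> real) \<Rightarrow> nat \<Rightarrow> real \<Rightarrow> real \<Rightarrow> real \<Rightarrow> ennreal" where
  "gauss \<sigma> \<equiv> (\<lambda>i a b c. ennreal (normal_density b (\<sigma> i) c))"

text \<open>The walk is killed once it falls below its initial value \<open>a\<close>; for this
  reason \<open>chain\<close> hands \<open>x (j 0)\<close> to every kernel.\<close>

abbreviation gauss_ge :: "(nat \<Rightarrow> real) \<Rightarrow> nat \<Rightarrow> real \<Rightarrow> real \<Rightarrow> real \<Rightarrow> ennreal" where
  "gauss_ge \<sigma> \<equiv> (\<lambda>i a b c. ennreal (normal_density b (\<sigma> i) c) * indicator {a..} c)"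

lemma measurable_gauss: "(\<lambda>(a, b, c). gauss \<sigma> i a b c) \<in> borel_measurable (borel \<Otimes>\<^sub>M borel \<Otimes>\<^sub>M borel)"
  unfolding normal_density_def by measurable

lemma measurable_gauss_ge: "(\<lambda>(a, b, c). gauss_ge \<sigma> i a b c) \<in> borel_measurable (borel \<Otimes>\<^sub>M borel \<Otimes>\<^sub>M borel)"
proof -
  have "(\<lambda>(a, b, c). gauss_ge \<sigma> i a b c) = (\<lambda>(a, b, c). gauss \<sigma> i a b c * (if a \<le> c then 1 else 0))"
    by (auto simp: fun_eq_iff)
  then show ?thesis unfolding normal_density_def by simp
qed

lemma nn_integral_normal_density:
  assumes "0 < \<sigma>"
  shows "(\<integral>\<^sup>+y. ennreal (normal_density b \<sigma> y) \<partial>lborel) = 1"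
proof -
  interpret prob_space "density lborel (normal_density b \<sigma>)" using assms by (rule prob_space_normal_density)
  from emeasure_space_1 show ?thesis by (simp add: emeasure_density)
qed

lemma nn_integral_normal_second_moment:
  assumes "0 < \<sigma>"
  shows "(\<integral>\<^sup>+y. ennreal (normal_density b \<sigma> y) * ennreal ((y - a)\<^sup>2) \<partial>lborel) = ennreal ((b - a)\<^sup>2) + ennreal (\<sigma>\<^sup>2)"
proof -
  \<comment> \<open>The square \<open>(y - a)\<^sup>2\<close> is expanded around the mean
    \<open>b\<close>; the cross term integrates to zero.\<close>
  have "has_bochner_integral lborel (\<lambda>y. normal_density b \<sigma> y * (y - b)\<^sup>2 + 2 * (b - a) * (normal_density b \<sigma> y * (y - b)) + (b - a)\<^sup>2 * normal_density b \<sigma> y)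
     (\<sigma>\<^sup>2 + 2 * (b - a) * 0 + (b - a)\<^sup>2 * 1)"
  proof (intro has_bochner_integral_add has_bochner_integral_mult_right)
    show "has_bochner_integral lborel (\<lambda>y. normal_density b \<sigma> y * (y - b)\<^sup>2) (\<sigma>\<^sup>2)"
      using normal_moment_even[OF assms, of b 1] by (simp add: field_simps power2_eq_square)
    show "has_bochner_integral lborel (\<lambda>y. normal_density b \<sigma> y * (y - b)) 0"
      using normal_moment_odd[OF assms, of b 0] by simp
    show "has_bochner_integral lborel (normal_density b \<sigma>) 1"
      using normal_moment_even[OF assms, of b 0] by simp
  qed
  then have "has_bochner_integral lborel (\<lambda>y. normal_density b \<sigma> y * (y - a)\<^sup>2) ((b - a)\<^sup>2 + \<sigma>\<^sup>2)"
    by (rule back_subst[of "\<lambda>(f, c). has_bochner_integral lborel f c", of "(_, _)" "(_, _)", unfolded prod.case])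
       (auto simp: power2_eq_square algebra_simps)
  then have "(\<integral>\<^sup>+y. ennreal (normal_density b \<sigma> y * (y - a)\<^sup>2) \<partial>lborel) = ennreal ((b - a)\<^sup>2 + \<sigma>\<^sup>2)"
    by (subst nn_integral_eq_integral) (auto simp: has_bochner_integral_iff)
  then show ?thesis by (simp add: ennreal_mult)
qed

text \<open>A lower bound for the mass of a normal law between two and one standard deviations below
  its mean: the density at two deviations, times the length \<open>\<sigma>\<close> of that
  interval.\<close>

definition tail_const :: real where
  "tail_const = exp (- 2) / sqrt (2 * pi)"

lemma tail_const: "0 < tail_const" "tail_const < 1"
proof -
  have "exp (- 2) < (1::real)" by simp
  moreover have "1 < sqrt (2 * pi)" using pi_gt3 by simp
  ultimately have "exp (- 2) < sqrt (2 * pi)" by (rule order.strict_trans)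
  then show "tail_const < 1" by (simp add: tail_const_def divide_less_eq)
qed (simp add: tail_const_def)

lemma normal_tail:
  assumes \<sigma>: "0 < \<sigma>" and z: "b - \<sigma> \<le> z"
  shows "(\<integral>\<^sup>+y. ennreal (normal_density b \<sigma> y) * indicator {z..} y \<partial>lborel) \<le> ennreal (1 - tail_const)"
proof -
  let ?n = "\<lambda>y. ennreal (normal_density b \<sigma> y)"
  let ?B = "{b - 2 * \<sigma>..<b - \<sigma>}"
  have "tail_const / \<sigma> \<le> normal_density b \<sigma> y" if "y \<in> ?B" for y
  proof -
    have "\<bar>y - b\<bar> \<le> 2 * \<sigma>" using that \<sigma> by auto
    then have "(y - b)\<^sup>2 \<le> (2 * \<sigma>)\<^sup>2" using power_mono[of "\<bar>y - b\<bar>" "2 * \<sigma>" 2] by simp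
    then have "(y - b)\<^sup>2 / (2 * \<sigma>\<^sup>2) \<le> 2" using \<sigma> by (simp add: field_simps)
    then have "exp (- 2) \<le> exp (- (y - b)\<^sup>2 / (2 * \<sigma>\<^sup>2))" by simp
    then show ?thesis using \<sigma>
      by (simp add: tail_const_def normal_density_def real_sqrt_mult divide_right_mono)
  qed
  then have "(\<integral>\<^sup>+y. ennreal (tail_const / \<sigma>) * indicator ?B y \<partial>lborel) \<le> (\<integral>\<^sup>+y. ?n y * indicator ?B y \<partial>lborel)"
    by (intro nn_integral_mono) (auto split: split_indicator intro: ennreal_leI)
  then have B: "ennreal tail_const \<le> (\<integral>\<^sup>+y. ?n y * indicator ?B y \<partial>lborel)"
    using \<sigma> tail_const by (simp add: nn_integral_cmult_indicator ennreal_mult[symmetric])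
  have "(\<integral>\<^sup>+y. ?n y * indicator {z..} y \<partial>lborel) + ennreal tail_const
     \<le> (\<integral>\<^sup>+y. ?n y * indicator {z..} y \<partial>lborel) + (\<integral>\<^sup>+y. ?n y * indicator ?B y \<partial>lborel)"
    by (intro add_left_mono B)
  also have "\<dots> = (\<integral>\<^sup>+y. ?n y * indicator {z..} y + ?n y * indicator ?B y \<partial>lborel)"
    by (rule nn_integral_add[symmetric]) auto
  also have "\<dots> \<le> (\<integral>\<^sup>+y. ?n y \<partial>lborel)"
    using z by (intro nn_integral_mono) (auto split: split_indicator)
  also have "\<dots> = 1" by (rule nn_integral_normal_density[OF \<sigma>])
  finally have *: "(\<integral>\<^sup>+y. ?n y * indicator {z..} y \<partial>lborel) + ennreal tail_const \<le> 1" .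
  then have "(\<integral>\<^sup>+y. ?n y * indicator {z..} y \<partial>lborel) \<le> 1 - ennreal tail_const"
    by (simp add: ennreal_le_minus_iff add.commute) 
  also have "\<dots> = ennreal (1 - tail_const)"
    using tail_const by (simp add: ennreal_minus[symmetric])
  finally show ?thesis .
qed

text \<open>If the walk is at most one deviation above \<open>a\<close>, a fixed proportion falls
  below \<open>a\<close>. Otherwise the second summand is at least 1 and the bound is trivial.
  Chebyshev's inequality is thus built in, and only second moments have to be controlled.\<close>

lemma normal_tail_le:
  assumes \<sigma>: "0 < \<sigma>"
  shows "(\<integral>\<^sup>+y. ennreal (normal_density b \<sigma> y) * indicator {a..} y \<partial>lborel) \<le> ennreal (1 - tail_const) + ennreal ((b - a)\<^sup>2 / \<sigma>\<^sup>2)"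
proof (cases "b - \<sigma> \<le> a")
  case True
  show ?thesis by (rule order.trans[OF normal_tail[OF \<sigma> True]]) simp
next
  case False
  then have "\<sigma>\<^sup>2 \<le> (b - a)\<^sup>2" using \<sigma> by (intro power_mono) auto
  then have "1 \<le> (b - a)\<^sup>2 / \<sigma>\<^sup>2" using \<sigma> by simp
  have "(\<integral>\<^sup>+y. ennreal (normal_density b \<sigma> y) * indicator {a..} y \<partial>lborel) \<le> (\<integral>\<^sup>+y. ennreal (normal_density b \<sigma> y) \<partial>lborel)"
    by (intro nn_integral_mono) (auto split: split_indicator)
  also have "\<dots> = ennreal 1" using nn_integral_normal_density[OF \<sigma>] by simp
  also have "\<dots> \<le> ennreal ((b - a)\<^sup>2 / \<sigma>\<^sup>2)" using \<open>1 \<le> (b - a)\<^sup>2 / \<sigma>\<^sup>2\<close> by (rule ennreal_leI)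
  also have "\<dots> \<le> ennreal (1 - tail_const) + \<dots>" by simp
  finally show ?thesis .
qed


context
  fixes \<phi> :: "real \<Rightarrow> ennreal" and j :: "nat \<Rightarrow> nat" and \<sigma> :: "nat \<Rightarrow> real"
  assumes \<phi>: "\<phi> \<in> borel_measurable borel" and \<sigma>: "\<And>i. 0 < \<sigma> i"
begin

lemma nn_integral_gauss_chain:
  "inj_on j {..n} \<Longrightarrow> (\<integral>\<^sup>+x. chain \<phi> (gauss \<sigma>) j n x \<partial>(\<Pi>\<^sub>M i\<in>j ` {..n}. lborel)) = (\<integral>\<^sup>+y. \<phi> y \<partial>lborel)"
proof (induction n)
  case 0
  then show ?case using nn_integral_chain_0[OF \<phi>] by simp
next
  case (Suc n)
  have "inj_on j {..n}" using Suc.prems by (rule inj_on_subset) auto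
  then show ?case
    using Suc.IH nn_integral_chain_Suc[where k = "gauss \<sigma>" and g = "\<lambda>a b. 1", OF \<phi> measurable_gauss[where \<sigma> = \<sigma>] _ Suc.prems]
    by (simp add: nn_integral_normal_density \<sigma>)
qed

text \<open>The increments are centred and independent of the past, so their variances add.\<close>

lemma nn_integral_gauss_chain_square:
  "inj_on j {..n} \<Longrightarrow> (\<integral>\<^sup>+x. chain \<phi> (gauss \<sigma>) j n x * ennreal ((x (j n) - x (j 0))\<^sup>2) \<partial>(\<Pi>\<^sub>M i\<in>j ` {..n}. lborel))
    = ennreal (\<Sum>i<n. (\<sigma> i)\<^sup>2) * (\<integral>\<^sup>+y. \<phi> y \<partial>lborel)"
proof (induction n)
  case 0
  then show ?case by simp
next
  case (Suc n)
  have inj: "inj_on j {..n}" using Suc.prems by (rule inj_on_subset) auto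
  let ?P = "\<Pi>\<^sub>M i\<in>j ` {..n}. lborel"
  have m: "chain \<phi> (gauss \<sigma>) j n \<in> borel_measurable ?P" by (rule measurable_chain[OF \<phi> measurable_gauss]) simp
  have [measurable]: "(\<lambda>x. x (j n)) \<in> borel_measurable ?P" "(\<lambda>x. x (j 0)) \<in> borel_measurable ?P"
    by (intro measurable_PiM_nth; simp)+
  have "(\<integral>\<^sup>+x. chain \<phi> (gauss \<sigma>) j (Suc n) x * ennreal ((x (j (Suc n)) - x (j 0))\<^sup>2) \<partial>(\<Pi>\<^sub>M i\<in>j ` {..Suc n}. lborel))
     = (\<integral>\<^sup>+x. chain \<phi> (gauss \<sigma>) j n x * (ennreal ((x (j n) - x (j 0))\<^sup>2) + ennreal ((\<sigma> n)\<^sup>2)) \<partial>?P)"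
    using nn_integral_chain_Suc[where k = "gauss \<sigma>" and g = "\<lambda>a b. ennreal ((b - a)\<^sup>2)", OF \<phi> measurable_gauss[where \<sigma> = \<sigma>] _ Suc.prems]
    by (simp add: nn_integral_normal_second_moment \<sigma>)
  also have "\<dots> = (\<integral>\<^sup>+x. chain \<phi> (gauss \<sigma>) j n x * ennreal ((x (j n) - x (j 0))\<^sup>2) + ennreal ((\<sigma> n)\<^sup>2) * chain \<phi> (gauss \<sigma>) j n x \<partial>?P)"
    by (simp add: distrib_left mult.commute)
  also have "\<dots> = (\<integral>\<^sup>+x. chain \<phi> (gauss \<sigma>) j n x * ennreal ((x (j n) - x (j 0))\<^sup>2) \<partial>?P) + ennreal ((\<sigma> n)\<^sup>2) * (\<integral>\<^sup>+x. chain \<phi> (gauss \<sigma>) j n x \<partial>?P)"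
    using m by (subst nn_integral_add) (auto simp: nn_integral_cmult)
  also have "\<dots> = ennreal (\<Sum>i<n. (\<sigma> i)\<^sup>2) * (\<integral>\<^sup>+y. \<phi> y \<partial>lborel) + ennreal ((\<sigma> n)\<^sup>2) * (\<integral>\<^sup>+y. \<phi> y \<partial>lborel)"
    using Suc.IH[OF inj] nn_integral_gauss_chain[OF inj] by simp
  also have "\<dots> = ennreal (\<Sum>i<Suc n. (\<sigma> i)\<^sup>2) * (\<integral>\<^sup>+y. \<phi> y \<partial>lborel)"
    by (simp add: distrib_right[symmetric] ennreal_plus[symmetric] sum_nonneg del: ennreal_plus)
  finally show ?case .
qed

lemma chain_gauss_ge_le: "chain \<phi> (gauss_ge \<sigma>) j n x \<le> chain \<phi> (gauss \<sigma>) j n x"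
  by (induction n) (auto intro!: mult_mono split: split_indicator)

text \<open>Each step multiplies the surviving mass by at most \<open>1 - tail_const\<close> and
  adds an error of at most \<open>\<eta> * H\<close>. The term \<open>\<eta> / tail_const\<close> is
  the fixed point of the map \<open>z\<close> to
  \<open>(1 - tail_const) * z + \<eta>\<close>.\<close>

lemma nn_integral_gauss_ge_chain:
  assumes r: "\<And>n. (\<Sum>i<n. (\<sigma> i)\<^sup>2) \<le> \<eta> * (\<sigma> n)\<^sup>2" and H: "(\<integral>\<^sup>+y. \<phi> y \<partial>lborel) = ennreal H" "0 \<le> H"
  shows "inj_on j {..n} \<Longrightarrow> (\<integral>\<^sup>+x. chain \<phi> (gauss_ge \<sigma>) j n x \<partial>(\<Pi>\<^sub>M i\<in>j ` {..n}. lborel))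
    \<le> ennreal (((1 - tail_const) ^ n + \<eta> / tail_const) * H)"
proof (induction n)
  have "0 \<le> \<eta> * (\<sigma> 0)\<^sup>2" using r[of 0] by simp
  then have \<eta>: "0 \<le> \<eta>" using \<sigma>[of 0] by (simp add: zero_le_mult_iff)
  case 0
  have "H * 1 \<le> H * (1 + \<eta> / tail_const)" using \<eta> H(2) tail_const by (intro mult_left_mono) auto
  then show ?case
    using nn_integral_chain_0[OF \<phi>] H by (simp add: ennreal_leI mult.commute)
next
  case (Suc n)
  have "0 \<le> \<eta> * (\<sigma> 0)\<^sup>2" using r[of 0] by simp
  then have \<eta>: "0 \<le> \<eta>" using \<sigma>[of 0] by (simp add: zero_le_mult_iff)
  have inj: "inj_on j {..n}" using Suc.prems by (rule inj_on_subset) auto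
  let ?P = "\<Pi>\<^sub>M i\<in>j ` {..n}. lborel" and ?c = "1 - tail_const"
  let ?G = "chain \<phi> (gauss_ge \<sigma>) j n" and ?F = "chain \<phi> (gauss \<sigma>) j n"
  have m: "?F \<in> borel_measurable ?P" "?G \<in> borel_measurable ?P"
    by (rule measurable_chain[OF \<phi> measurable_gauss]; simp)
       (rule measurable_chain[OF \<phi> measurable_gauss_ge]; simp)
  have [measurable]: "(\<lambda>x. x (j n)) \<in> borel_measurable ?P" "(\<lambda>x. x (j 0)) \<in> borel_measurable ?P"
    by (intro measurable_PiM_nth; simp)+
  have sq: "ennreal (z / (\<sigma> n)\<^sup>2) = ennreal (1 / (\<sigma> n)\<^sup>2) * ennreal z" if "0 \<le> z" for z
    using that by (simp add: ennreal_mult[symmetric])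
  have "(\<integral>\<^sup>+x. chain \<phi> (gauss_ge \<sigma>) j (Suc n) x \<partial>(\<Pi>\<^sub>M i\<in>j ` {..Suc n}. lborel))
     = (\<integral>\<^sup>+x. ?G x * (\<integral>\<^sup>+y. ennreal (normal_density (x (j n)) (\<sigma> n) y) * indicator {x (j 0)..} y \<partial>lborel) \<partial>?P)"
    using nn_integral_chain_Suc[where k = "gauss_ge \<sigma>" and g = "\<lambda>a b. 1", OF \<phi> measurable_gauss_ge[where \<sigma> = \<sigma>] _ Suc.prems] by simp
  also have "\<dots> \<le> (\<integral>\<^sup>+x. ?G x * (ennreal ?c + ennreal ((x (j n) - x (j 0))\<^sup>2 / (\<sigma> n)\<^sup>2)) \<partial>?P)"
    by (intro nn_integral_mono mult_left_mono normal_tail_le \<sigma>) simp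
  \<comment> \<open>In the error term the constraint is dropped, which leaves the second moment of
    the unconstrained walk; the main term keeps the killed chain for the induction.\<close>
  also have "\<dots> \<le> (\<integral>\<^sup>+x. ennreal ?c * ?G x + ennreal (1 / (\<sigma> n)\<^sup>2) * (?F x * ennreal ((x (j n) - x (j 0))\<^sup>2)) \<partial>?P)"
    unfolding distrib_left
  proof (intro nn_integral_mono add_mono)
    fix x
    show "?G x * ennreal ?c \<le> ennreal ?c * ?G x" by (simp add: mult.commute)
    show "?G x * ennreal ((x (j n) - x (j 0))\<^sup>2 / (\<sigma> n)\<^sup>2) \<le> ennreal (1 / (\<sigma> n)\<^sup>2) * (?F x * ennreal ((x (j n) - x (j 0))\<^sup>2))"
      unfolding sq[OF zero_le_power2] using chain_gauss_ge_le[of n x]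
      by (subst mult.left_commute) (intro mult_left_mono mult_right_mono, auto)
  qed
  also have "\<dots> = ennreal ?c * (\<integral>\<^sup>+x. ?G x \<partial>?P) + ennreal (1 / (\<sigma> n)\<^sup>2) * (\<integral>\<^sup>+x. ?F x * ennreal ((x (j n) - x (j 0))\<^sup>2) \<partial>?P)"
    using m by (subst nn_integral_add) (auto simp: nn_integral_cmult)
  also have "(\<integral>\<^sup>+x. ?F x * ennreal ((x (j n) - x (j 0))\<^sup>2) \<partial>?P) = ennreal ((\<Sum>i<n. (\<sigma> i)\<^sup>2) * H)"
    using nn_integral_gauss_chain_square[OF inj] H by (simp add: ennreal_mult sum_nonneg)
  also have "ennreal (1 / (\<sigma> n)\<^sup>2) * \<dots> = ennreal ((\<Sum>i<n. (\<sigma> i)\<^sup>2) / (\<sigma> n)\<^sup>2 * H)"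
    using H(2) by (simp add: ennreal_mult[symmetric] sum_nonneg)
  also have "\<dots> \<le> ennreal (\<eta> * H)"
    using r[of n] \<sigma>[of n] H(2) by (intro ennreal_leI mult_right_mono) (simp_all add: divide_le_eq)
  also have "ennreal ?c * (\<integral>\<^sup>+x. ?G x \<partial>?P) + ennreal (\<eta> * H) \<le> ennreal ?c * ennreal ((?c ^ n + \<eta> / tail_const) * H) + ennreal (\<eta> * H)"
    by (intro add_right_mono mult_left_mono Suc.IH inj) simp
  also have "\<dots> = ennreal (?c * ((?c ^ n + \<eta> / tail_const) * H) + \<eta> * H)"
    using tail_const \<eta> H(2) by (simp add: ennreal_mult[symmetric] ennreal_plus[symmetric] del: ennreal_plus)
  also have "?c * ((?c ^ n + \<eta> / tail_const) * H) + \<eta> * H = (?c ^ Suc n + \<eta> / tail_const) * H"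
    using tail_const by (simp add: field_simps)
  finally show ?case by (simp add: add_left_mono)
qed

end

section \<open>Comparing excursion densities with Gaussian ones\<close>

lemma hitting_density_nonneg: "0 < t \<Longrightarrow> 0 \<le> x \<Longrightarrow> 0 \<le> hitting_density t x"
  by (simp add: hitting_density_def)

text \<open>With \<open>z = x / sqrt t\<close> the claim reduces to
  \<open>z \<le> exp (z\<^sup>2 / 2)\<close>, which follows from
  \<open>z \<le> 1 + z\<^sup>2 / 2\<close>.\<close>

lemma hitting_density_le:
  assumes "0 < t" "0 \<le> x"
  shows "hitting_density t x \<le> 1 / t"
proof -
  define z where "z = x / sqrt t"
  have z: "0 \<le> z" "z\<^sup>2 = x\<^sup>2 / t" using assms by (simp_all add: z_def power_divide)
  have "z \<le> 1 + z\<^sup>2 / 2" using zero_le_power2[of "z - 1"] by (simp add: power2_eq_square algebra_simps)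
  also have "\<dots> \<le> exp (z\<^sup>2 / 2)" by (rule exp_ge_add_one_self)
  finally have "z * exp (- (z\<^sup>2 / 2)) \<le> 1" by (simp add: exp_minus field_simps)
  moreover have "hitting_density t x = z * exp (- (z\<^sup>2 / 2)) / (sqrt (2 * pi) * t)"
  proof -
    have "sqrt (2 * pi * t ^ 3) = sqrt (2 * pi) * t * sqrt t"
      using assms by (simp add: real_sqrt_mult power3_eq_cube)
    then show ?thesis by (simp add: hitting_density_def z(2)) (simp add: z_def mult_ac)
  qed
  ultimately have "hitting_density t x \<le> 1 / (sqrt (2 * pi) * t)"
    using assms by (simp add: divide_right_mono)
  also have "\<dots> \<le> 1 / t"
  proof -
    have "1 \<le> sqrt (2 * pi)" using pi_gt3 by simp
    then have "t \<le> sqrt (2 * pi) * t" using assms by simp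
    then show ?thesis using assms by (intro divide_left_mono) auto
  qed
  finally show ?thesis .
qed

lemma hitting_density_le':
  assumes "0 < \<kappa>" "\<kappa> \<le> t" "0 \<le> x"
  shows "hitting_density t x \<le> 1 / \<kappa>"
proof -
  have "hitting_density t x \<le> 1 / t" using assms by (intro hitting_density_le) auto
  also have "\<dots> \<le> 1 / \<kappa>" using assms by (intro divide_left_mono) auto
  finally show ?thesis .
qed

definition hit_weight :: "real \<Rightarrow> real \<Rightarrow> ennreal" where
  "hit_weight t x = ennreal (hitting_density t x) * indicator {0..} x"

lemma measurable_hit_weight: "hit_weight t \<in> borel_measurable borel"
  unfolding hit_weight_def hitting_density_def by measurable

text \<open>The integral is over the space variable, in which the hitting density is an exact
  derivative of a Gaussian profile.\<close>

lemma nn_integral_hit_weight: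
  assumes t: "0 < t"
  shows "(\<integral>\<^sup>+x. hit_weight t x \<partial>lborel) = ennreal (t / sqrt (2 * pi * t ^ 3))"
proof -
  let ?K = "sqrt (2 * pi * t ^ 3)"
  let ?F = "\<lambda>x. - (t / ?K) * exp (- (x\<^sup>2) / (2 * t))"
  have "(\<integral>\<^sup>+x. ennreal (hitting_density t x) * indicator {0..} x \<partial>lborel) = ennreal (0 - ?F 0)"
  proof (rule nn_integral_FTC_atLeast)
    show "hitting_density t \<in> borel_measurable borel" unfolding hitting_density_def by measurable
    show "0 \<le> hitting_density t x" if "0 \<le> x" for x using t that by (rule hitting_density_nonneg)
    show "(?F has_real_derivative hitting_density t x) (at x)" for x
      unfolding hitting_density_def using t
      by (auto intro!: derivative_eq_intros simp: field_simps)
    have "((\<lambda>x. exp (- (x\<^sup>2) / (2 * t))) \<longlongrightarrow> 0) at_top"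
    proof (rule filterlim_compose[OF exp_at_bot])
      have "filterlim (\<lambda>x. x\<^sup>2 * (1 / (2 * t))) at_top at_top"
        using t by (intro filterlim_at_top_mult_tendsto_pos[OF tendsto_const] filterlim_pow_at_top filterlim_ident) auto
      then show "filterlim (\<lambda>x. - (x\<^sup>2) / (2 * t)) at_bot at_top"
        by (simp add: filterlim_uminus_at_bot)
    qed
    from tendsto_mult_left[OF this, of "- (t / ?K)"] show "(?F \<longlongrightarrow> 0) at_top" by simp
  qed
  then show ?thesis by (simp add: hit_weight_def)
qed

text \<open>Killing only subtracts the reflected term. Both orders of the Gaussian arguments are
  recorded because the walk moves away from \<open>u\<close> in either time direction.\<close>

lemma killed_density_bounds:
  assumes "0 < \<sigma>" "0 < x" "0 < y"
  shows "0 \<le> killed_density (\<sigma>\<^sup>2) x y" "killed_density (\<sigma>\<^sup>2) x y \<le> normal_density x \<sigma> y"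
    "killed_density (\<sigma>\<^sup>2) x y \<le> normal_density y \<sigma> x"
proof -
  have "(x - y)\<^sup>2 \<le> (x + y)\<^sup>2" using assms by (simp add: power2_eq_square algebra_simps)
  then have "- ((x + y)\<^sup>2) / (2 * \<sigma>\<^sup>2) \<le> - ((x - y)\<^sup>2) / (2 * \<sigma>\<^sup>2)"
    by (intro divide_right_mono) auto
  then show "0 \<le> killed_density (\<sigma>\<^sup>2) x y" by (simp add: killed_density_def)
  have "killed_density (\<sigma>\<^sup>2) x y \<le> exp (- ((x - y)\<^sup>2) / (2 * \<sigma>\<^sup>2)) / sqrt (2 * pi * \<sigma>\<^sup>2)"
    unfolding killed_density_def by (intro divide_right_mono) auto
  then show "killed_density (\<sigma>\<^sup>2) x y \<le> normal_density x \<sigma> y" "killed_density (\<sigma>\<^sup>2) x y \<le> normal_density y \<sigma> x"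
    by (simp_all add: normal_density_def power2_commute)
qed

lemma chain_gauss_ge_eq:
  assumes "\<And>i. i \<le> n \<Longrightarrow> x (j 0) \<le> x (j i)"
  shows "chain \<phi> (gauss_ge \<sigma>) j n x = \<phi> (x (j 0)) * ennreal (\<Prod>i<n. normal_density (x (j i)) (\<sigma> i) (x (j (Suc i))))"
  using assms
proof (induction n)
  case (Suc n)
  then have "x (j (Suc n)) \<in> {x (j 0)..}" by simp
  with Suc show ?case by (simp add: ennreal_mult prod_nonneg mult.assoc)
qed simp

text \<open>\<open>j\<close> lists the sampling times by increasing distance from \<open>u\<close>,
  so a single estimate serves both sides. \<open>T\<close> is the time from \<open>u\<close> to the
  end of the unit interval that the walk moves away from; the hitting factor at that end becomes the
  initial weight of the chain.\<close>

lemma emeasure_excursion_ge: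
  assumes M: "prob_space M" and e: "brownian_excursion M e"
    and t: "0 < t 0" "\<And>i. i < n \<Longrightarrow> t i < t (Suc i)" "t n < 1"
    and j: "bij_betw j {..n} {..n}" and \<sigma>: "\<And>i. 0 < \<sigma> i" and C: "0 \<le> C" and T: "0 < T"
    and le: "\<And>x. (\<And>i. i \<le> n \<Longrightarrow> 0 < x i) \<Longrightarrow>
      excursion_density n t x \<le> C * (hitting_density T (x (j 0)) * (\<Prod>i<n. normal_density (x (j i)) (\<sigma> i) (x (j (Suc i)))))"
    and r: "\<And>n. (\<Sum>i<n. (\<sigma> i)\<^sup>2) \<le> \<eta> * (\<sigma> n)\<^sup>2"
  shows "{\<omega> \<in> space M. \<forall>i\<le>n. e \<omega> (t (j 0)) \<le> e \<omega> (t (j i))} \<in> sets M" (is "?E \<in> _")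
    and "emeasure M {\<omega> \<in> space M. \<forall>i\<le>n. e \<omega> (t (j 0)) \<le> e \<omega> (t (j i))}
      \<le> ennreal (C * (((1 - tail_const) ^ n + \<eta> / tail_const) * (T / sqrt (2 * pi * T ^ 3))))"
proof -
  let ?P = "\<Pi>\<^sub>M i\<in>{..n}. (lborel :: real measure)" and ?X = "\<lambda>\<omega>. \<lambda>i\<in>{..n}. e \<omega> (t i)"
  let ?A = "{x \<in> space ?P. \<forall>i\<le>n. x (j 0) \<le> x (j i)}"
  let ?H = "T / sqrt (2 * pi * T ^ 3)"
  have D: "distributed M ?P ?X (\<lambda>x. ennreal (excursion_density n t x))"
    using e t unfolding brownian_excursion_def by blast
  have jn: "j i \<le> n" if "i \<le> n" for i using j that by (auto simp: bij_betw_def)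
  have A: "?A \<in> sets ?P"
  proof -
    have "{x \<in> space ?P. \<forall>i\<in>{..n}. x (j 0) \<le> x (j i)} \<in> sets ?P"
      by (intro sets.sets_Collect_finite_All borel_measurable_le measurable_PiM_nth) (auto simp: jn)
    then show ?thesis by (simp only: Ball_def atMost_iff)
  qed
  have X: "?X \<in> measurable M ?P" using D by (rule distributed_measurable)
  have eq: "?E = ?X -` ?A \<inter> space M"
    using measurable_space[OF X] by (auto simp: jn)
  show "?E \<in> sets M" unfolding eq by (rule measurable_sets[OF X A])
  have im: "j ` {..n} = {..n}" using j by (simp add: bij_betw_def)
  have "emeasure M ?E = (\<integral>\<^sup>+x. ennreal (excursion_density n t x) * indicator ?A x \<partial>?P)"
    unfolding eq by (rule distributed_emeasure[OF D A])
  also have "\<dots> \<le> (\<integral>\<^sup>+x. ennreal C * chain (hit_weight T) (gauss_ge \<sigma>) j n x \<partial>?P)"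
  proof (rule nn_integral_mono)
    fix x
    show "ennreal (excursion_density n t x) * indicator ?A x \<le> ennreal C * chain (hit_weight T) (gauss_ge \<sigma>) j n x"
    proof (cases "x \<in> ?A \<and> (\<forall>i\<le>n. 0 < x i)")
      case True
      then have "0 \<le> x (j 0)" using jn[of 0] by (simp add: less_imp_le)
      then have w: "hit_weight T (x (j 0)) = ennreal (hitting_density T (x (j 0)))" "0 \<le> hitting_density T (x (j 0))"
        using hitting_density_nonneg[OF T] by (simp_all add: hit_weight_def)
      have "ennreal (excursion_density n t x) \<le> ennreal (C * (hitting_density T (x (j 0)) * (\<Prod>i<n. normal_density (x (j i)) (\<sigma> i) (x (j (Suc i))))))"
        using True by (intro ennreal_leI le) auto
      also have "\<dots> = ennreal C * chain (hit_weight T) (gauss_ge \<sigma>) j n x"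
        using True C w by (subst chain_gauss_ge_eq) (auto simp: ennreal_mult prod_nonneg)
      finally show ?thesis using True by simp
    next
      case False
      then consider "x \<notin> ?A" | "\<not> (\<forall>i\<le>n. 0 < x i)" by blast
      then show ?thesis
      proof cases
        case 2
        then have "excursion_density n t x = 0" unfolding excursion_density_def by (rule if_not_P)
        then show ?thesis by simp
      qed simp
    qed
  qed
  also have "\<dots> = ennreal C * (\<integral>\<^sup>+x. chain (hit_weight T) (gauss_ge \<sigma>) j n x \<partial>?P)"
    by (rule nn_integral_cmult) (rule measurable_chain[OF measurable_hit_weight measurable_gauss_ge], simp add: im)
  also have "\<dots> \<le> ennreal C * ennreal (((1 - tail_const) ^ n + \<eta> / tail_const) * ?H)"
    using nn_integral_gauss_ge_chain[OF measurable_hit_weight \<sigma> r nn_integral_hit_weight[OF T] _ bij_betw_imp_inj_on[OF j]]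
    by (intro mult_left_mono) (simp_all add: im T less_imp_le)
  also have "\<dots> = ennreal (C * (((1 - tail_const) ^ n + \<eta> / tail_const) * ?H))"
    by (rule ennreal_mult'[OF C, symmetric])
  finally show "emeasure M ?E \<le> \<dots>" .
qed

text \<open>The hitting factor at the remote end is bounded by \<open>1 / \<kappa>\<close>. The one
  next to \<open>u\<close> is kept, because it provides the finite total mass of the starting
  value.\<close>

lemma excursion_density_le_left:
  assumes x: "\<And>i. i \<le> n \<Longrightarrow> 0 < x i" and t: "\<kappa> \<le> t 0" "0 < \<kappa>" "t n < 1"
    and \<sigma>: "\<And>i. 0 < \<sigma> i" "\<And>i. i < n \<Longrightarrow> t (Suc i) - t i = (\<sigma> i)\<^sup>2"
  shows "excursion_density n t x \<le> 2 * sqrt (2 * pi) / \<kappa> * (hitting_density (1 - t n) (x n) * (\<Prod>i<n. normal_density (x (Suc i)) (\<sigma> i) (x i)))"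
proof -
  have "(\<Prod>i<n. killed_density (t (Suc i) - t i) (x i) (x (Suc i))) \<le> (\<Prod>i<n. normal_density (x (Suc i)) (\<sigma> i) (x i))"
    using \<sigma> x by (intro prod_mono) (auto intro!: killed_density_bounds)
  moreover have "0 \<le> (\<Prod>i<n. killed_density (t (Suc i) - t i) (x i) (x (Suc i)))"
    using \<sigma> x by (intro prod_nonneg) (auto intro!: killed_density_bounds)
  moreover have "hitting_density (t 0) (x 0) \<le> 1 / \<kappa>"
    using x[of 0] t by (intro hitting_density_le') auto
  ultimately have "hitting_density (t 0) (x 0) * (\<Prod>i<n. killed_density (t (Suc i) - t i) (x i) (x (Suc i)))
      \<le> 1 / \<kappa> * (\<Prod>i<n. normal_density (x (Suc i)) (\<sigma> i) (x i))"
    using t by (intro mult_mono) auto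
  moreover have "0 \<le> hitting_density (1 - t n) (x n)"
    using t x[of n] by (intro hitting_density_nonneg) auto
  ultimately have "(2 * sqrt (2 * pi)) * ((hitting_density (t 0) (x 0) * (\<Prod>i<n. killed_density (t (Suc i) - t i) (x i) (x (Suc i)))) * hitting_density (1 - t n) (x n))
      \<le> (2 * sqrt (2 * pi)) * ((1 / \<kappa> * (\<Prod>i<n. normal_density (x (Suc i)) (\<sigma> i) (x i))) * hitting_density (1 - t n) (x n))"
    by (intro mult_left_mono mult_right_mono) auto
  then show ?thesis
    using x by (simp add: excursion_density_def mult_ac)
qed

lemma excursion_density_le_right:
  assumes x: "\<And>i. i \<le> n \<Longrightarrow> 0 < x i" and t: "0 < t 0" "0 < \<kappa>" "t n \<le> 1 - \<kappa>"
    and \<sigma>: "\<And>i. 0 < \<sigma> i" "\<And>i. i < n \<Longrightarrow> t (Suc i) - t i = (\<sigma> i)\<^sup>2"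
  shows "excursion_density n t x \<le> 2 * sqrt (2 * pi) / \<kappa> * (hitting_density (t 0) (x 0) * (\<Prod>i<n. normal_density (x i) (\<sigma> i) (x (Suc i))))"
proof -
  have "(\<Prod>i<n. killed_density (t (Suc i) - t i) (x i) (x (Suc i))) \<le> (\<Prod>i<n. normal_density (x i) (\<sigma> i) (x (Suc i)))"
    using \<sigma> x by (intro prod_mono) (auto intro!: killed_density_bounds)
  moreover have "0 \<le> (\<Prod>i<n. killed_density (t (Suc i) - t i) (x i) (x (Suc i)))"
    using \<sigma> x by (intro prod_nonneg) (auto intro!: killed_density_bounds)
  moreover have "hitting_density (1 - t n) (x n) \<le> 1 / \<kappa>"
    using x[of n] t by (intro hitting_density_le') auto
  moreover have "0 \<le> hitting_density (1 - t n) (x n)"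
    using t x[of n] by (intro hitting_density_nonneg) auto
  ultimately have "(\<Prod>i<n. killed_density (t (Suc i) - t i) (x i) (x (Suc i))) * hitting_density (1 - t n) (x n)
      \<le> (\<Prod>i<n. normal_density (x i) (\<sigma> i) (x (Suc i))) * (1 / \<kappa>)"
    by (intro mult_mono) (auto intro: prod_nonneg)
  moreover have "0 \<le> hitting_density (t 0) (x 0)"
    using t x[of 0] by (intro hitting_density_nonneg) auto
  ultimately have "(2 * sqrt (2 * pi)) * (hitting_density (t 0) (x 0) * ((\<Prod>i<n. killed_density (t (Suc i) - t i) (x i) (x (Suc i))) * hitting_density (1 - t n) (x n)))
      \<le> (2 * sqrt (2 * pi)) * (hitting_density (t 0) (x 0) * ((\<Prod>i<n. normal_density (x i) (\<sigma> i) (x (Suc i))) * (1 / \<kappa>)))"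
    by (intro mult_left_mono) auto
  then show ?thesis
    using x by (simp add: excursion_density_def mult_ac)
qed

text \<open>The variances are \<open>a * Q ^ i\<close>; the ratio \<open>Q = 1 + 1 / \<eta>\<close>
  makes the sum of all earlier ones at most \<open>\<eta>\<close> times the next. First
  \<open>\<eta>\<close> and \<open>n\<close> make the two error terms at most
  \<open>\<epsilon> / (2 * K)\<close> each, and \<open>a\<close> is chosen last so that the
  \<open>n\<close> steps fit into a window of length \<open>h\<close>.\<close>

lemma lacunary_scales:
  assumes "0 < h" "0 < K" "0 < (\<epsilon>::real)"
  obtains \<sigma> :: "nat \<Rightarrow> real" and \<eta> n where "\<forall>i. 0 < \<sigma> i" "\<forall>m. (\<Sum>i<m. (\<sigma> i)\<^sup>2) \<le> \<eta> * (\<sigma> m)\<^sup>2"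
    "(\<Sum>i<n. (\<sigma> i)\<^sup>2) < h" "K * ((1 - tail_const) ^ n + \<eta> / tail_const) \<le> \<epsilon>"
proof -
  define \<eta> where "\<eta> = min 1 (\<epsilon> * tail_const / (2 * K))"
  define Q where "Q = 1 + 1 / \<eta>"
  have \<eta>: "0 < \<eta>" "\<eta> \<le> 1" "\<eta> \<le> \<epsilon> * tail_const / (2 * K)"
    using assms tail_const by (auto simp: \<eta>_def)
  have Q: "1 < Q" "1 / (Q - 1) = \<eta>" using \<eta> by (auto simp: Q_def)
  have "(\<lambda>n. (1 - tail_const) ^ n) \<longlonglongrightarrow> 0" using tail_const by (intro LIMSEQ_realpow_zero) auto
  then have "\<forall>\<^sub>F n in sequentially. (1 - tail_const) ^ n < \<epsilon> / (2 * K)"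
    using assms by (intro order_tendstoD) auto
  then obtain n where n: "(1 - tail_const) ^ n < \<epsilon> / (2 * K)"
    by (auto simp: eventually_sequentially)
  define a where "a = h / (2 * Q ^ n)"
  have a: "0 < a" using assms Q by (simp add: a_def)
  define \<sigma> where "\<sigma> i = sqrt (a * Q ^ i)" for i
  have s2: "(\<sigma> i)\<^sup>2 = a * Q ^ i" for i using a Q by (simp add: \<sigma>_def)
  have r: "(\<Sum>i<m. (\<sigma> i)\<^sup>2) \<le> \<eta> * (\<sigma> m)\<^sup>2" for m
  proof -
    have "(\<Sum>i<m. (\<sigma> i)\<^sup>2) = a * (Q ^ m - 1) * \<eta>"
      using Q by (simp add: s2 sum_distrib_left[symmetric] geometric_sum Q(2)[symmetric])
    also have "\<dots> \<le> \<eta> * (\<sigma> m)\<^sup>2" using a \<eta> by (simp add: s2 algebra_simps)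
    finally show ?thesis .
  qed
  have "(\<Sum>i<n. (\<sigma> i)\<^sup>2) \<le> 1 * (\<sigma> n)\<^sup>2"
    by (rule order.trans[OF r]) (intro mult_right_mono \<eta>, simp)
  also have "\<dots> < h" using assms Q by (simp add: s2 a_def)
  finally have sn: "(\<Sum>i<n. (\<sigma> i)\<^sup>2) < h" .
  have "\<eta> / tail_const \<le> \<epsilon> / (2 * K)" using \<eta>(3) tail_const assms by (simp add: field_simps)
  then have "K * ((1 - tail_const) ^ n + \<eta> / tail_const) \<le> K * (\<epsilon> / (2 * K) + \<epsilon> / (2 * K))"
    using n assms by (intro mult_left_mono) auto
  also have "\<dots> = \<epsilon>" using assms by simp
  finally show ?thesis
    using that[of \<sigma> \<eta> n] r sn a Q by (simp add: \<sigma>_def)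
qed

text \<open>The exceptional event involves uncountably many times and is not known to be measurable,
  so it is only covered by measurable events of arbitrarily small mass.\<close>

lemma AE_I_small:
  assumes "\<And>\<epsilon>::real. 0 < \<epsilon> \<Longrightarrow> \<exists>E\<in>sets M. {\<omega> \<in> space M. \<not> P \<omega>} \<subseteq> E \<and> emeasure M E \<le> ennreal \<epsilon>"
  shows "AE \<omega> in M. P \<omega>"
proof -
  have "\<exists>E\<in>sets M. {\<omega> \<in> space M. \<not> P \<omega>} \<subseteq> E \<and> emeasure M E \<le> ennreal (1 / Suc k)" for k
    by (rule assms) simp
  then obtain E where E: "\<And>k. E k \<in> sets M" "\<And>k. {\<omega> \<in> space M. \<not> P \<omega>} \<subseteq> E k"
      "\<And>k. emeasure M (E k) \<le> ennreal (1 / Suc k)"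
    by metis
  have le: "emeasure M (\<Inter>k. E k) \<le> ennreal (1 / Suc k)" for k
    by (rule order.trans[OF emeasure_mono E(3)]) (use E(1) in auto)
  have "emeasure M (\<Inter>k. E k) \<le> 0"
  proof (rule tendsto_lowerbound)
    have "(\<lambda>k. ennreal (1 / Suc k)) \<longlonglongrightarrow> ennreal 0"
      by (intro tendsto_ennrealI LIMSEQ_Suc[OF lim_1_over_n[where 'a = real]])
    then show "(\<lambda>k. ennreal (1 / Suc k)) \<longlonglongrightarrow> 0" by simp
  qed (use le in auto)
  then show ?thesis
    using E(1,2) by (intro AE_I[of _ _ "\<Inter>k. E k"]) auto
qed

lemma AE_excursion_right:
  assumes M: "prob_space M" and e: "brownian_excursion M e" and u: "0 < u" "u < 1" and "0 < h"
  shows "AE \<omega> in M. \<exists>v. u < v \<and> v < u + h \<and> e \<omega> v < e \<omega> u"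
proof (rule AE_I_small)
  fix \<epsilon> :: real assume "0 < \<epsilon>"
  \<comment> \<open>Half of the room to the right of \<open>u\<close>: steps of total length below
    \<open>\<kappa>\<close> leave the last time at distance at least \<open>\<kappa>\<close> from 1,
    where its hitting factor is bounded.\<close>
  define \<kappa> where "\<kappa> = (1 - u) / 2"
  have \<kappa>: "0 < \<kappa>" using u by (simp add: \<kappa>_def)
  define C where "C = 2 * sqrt (2 * pi) / \<kappa>"
  define H where "H = u / sqrt (2 * pi * u ^ 3)"
  have C: "0 < C" and H: "0 < H" using \<kappa> u by (simp_all add: C_def H_def)
  have pos: "0 < min h \<kappa>" "0 < C * H" using \<open>0 < h\<close> \<kappa> C H by auto
  obtain \<sigma> \<eta> n where
    \<sigma>': "\<forall>i. 0 < \<sigma> i" and r': "\<forall>m. (\<Sum>i<m. (\<sigma> i)\<^sup>2) \<le> \<eta> * (\<sigma> m)\<^sup>2"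
    and sn: "(\<Sum>i<n. (\<sigma> i)\<^sup>2) < min h \<kappa>" and b: "C * H * ((1 - tail_const) ^ n + \<eta> / tail_const) \<le> \<epsilon>"
    by (rule lacunary_scales[OF pos \<open>0 < \<epsilon>\<close>])
  note \<sigma> = \<sigma>'[rule_format] and r = r'[rule_format]
  define t where "t i = u + (\<Sum>l<i. (\<sigma> l)\<^sup>2)" for i
  have t: "0 < t 0" "t (Suc i) - t i = (\<sigma> i)\<^sup>2" "t i < t (Suc i)" for i
    using u \<sigma>[of i] by (simp_all add: t_def)
  have t00: "t 0 = u" by (simp add: t_def)
  have t4: "t n \<le> 1 - \<kappa>"
    using sn by (simp add: t_def \<kappa>_def field_simps)
  have t1: "t n < 1" using t4 \<kappa> by simp
  have tn: "u < t i \<and> t i < u + h" if "i \<le> n" "i \<noteq> 0" for i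
  proof -
    have "0 < (\<Sum>l<i. (\<sigma> l)\<^sup>2)" using that \<sigma> by (intro sum_pos) (auto simp: less_imp_neq[symmetric] lessThan_empty_iff)
    moreover have "(\<Sum>l<i. (\<sigma> l)\<^sup>2) \<le> (\<Sum>l<n. (\<sigma> l)\<^sup>2)" using that by (intro sum_mono2) auto
    ultimately show ?thesis using sn by (simp add: t_def)
  qed
  have le: "excursion_density n t x \<le> C * (hitting_density u (x 0) * (\<Prod>i<n. normal_density (x i) (\<sigma> i) (x (Suc i))))"
    if "\<And>i. i \<le> n \<Longrightarrow> 0 < x i" for x
    using excursion_density_le_right[of n x t \<kappa> \<sigma>, OF that t(1) \<kappa> t4 \<sigma> t(2)] t00 by (simp add: C_def)
  let ?E = "{\<omega> \<in> space M. \<forall>i\<le>n. e \<omega> (t 0) \<le> e \<omega> (t i)}"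
  have bij: "bij_betw (\<lambda>i. i) {..n} {..n}" by (simp add: bij_betw_def)
  note E = emeasure_excursion_ge[OF M e t(1) t(3) t1 bij \<sigma> less_imp_le[OF C] u(1) le r]
  have "{\<omega> \<in> space M. \<not> (\<exists>v. u < v \<and> v < u + h \<and> e \<omega> v < e \<omega> u)} \<subseteq> ?E"
  proof safe
    fix \<omega> i assume *: "\<not> (\<exists>v. u < v \<and> v < u + h \<and> e \<omega> v < e \<omega> u)" "i \<le> n"
    show "e \<omega> (t 0) \<le> e \<omega> (t i)"
    proof (cases "i = 0")
      case False
      then have "e \<omega> u \<le> e \<omega> (t i)" using *(1) tn[OF *(2)] by (meson not_less)
      then show ?thesis by (simp add: t00)
    qed simp
  qed
  moreover have "emeasure M ?E \<le> ennreal \<epsilon>"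
    by (rule order.trans[OF E(2)]) (use b in \<open>auto intro!: ennreal_leI simp: H_def mult_ac\<close>)
  ultimately show "\<exists>E\<in>sets M. {\<omega> \<in> space M. \<not> (\<exists>v. u < v \<and> v < u + h \<and> e \<omega> v < e \<omega> u)} \<subseteq> E \<and> emeasure M E \<le> ennreal \<epsilon>"
    using E(1) by blast
qed

lemma AE_excursion_left:
  assumes M: "prob_space M" and e: "brownian_excursion M e" and u: "0 < u" "u < 1" and "0 < h"
  shows "AE \<omega> in M. \<exists>v. u - h < v \<and> v < u \<and> e \<omega> v < e \<omega> u"
proof (rule AE_I_small)
  fix \<epsilon> :: real assume "0 < \<epsilon>"
  define \<kappa> where "\<kappa> = u / 2"
  have \<kappa>: "0 < \<kappa>" using u by (simp add: \<kappa>_def)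
  define C where "C = 2 * sqrt (2 * pi) / \<kappa>"
  define H where "H = (1 - u) / sqrt (2 * pi * (1 - u) ^ 3)"
  have C: "0 < C" and H: "0 < H" using \<kappa> u by (simp_all add: C_def H_def)
  have pos: "0 < min h \<kappa>" "0 < C * H" using \<open>0 < h\<close> \<kappa> C H by auto
  obtain \<sigma> \<eta> n where
    \<sigma>': "\<forall>i. 0 < \<sigma> i" and r': "\<forall>m. (\<Sum>i<m. (\<sigma> i)\<^sup>2) \<le> \<eta> * (\<sigma> m)\<^sup>2"
    and sn: "(\<Sum>i<n. (\<sigma> i)\<^sup>2) < min h \<kappa>" and b: "C * H * ((1 - tail_const) ^ n + \<eta> / tail_const) \<le> \<epsilon>"
    by (rule lacunary_scales[OF pos \<open>0 < \<epsilon>\<close>])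
  note \<sigma> = \<sigma>'[rule_format] and r = r'[rule_format]
  \<comment> \<open>The density formula requires increasing times, so the lacunary steps are laid
    out from the far end and \<open>u\<close> becomes the last time \<open>t n\<close>;
    \<open>?j\<close> reverses the order again.\<close>
  define t where "t i = u - (\<Sum>l<n - i. (\<sigma> l)\<^sup>2)" for i
  have tS: "t (Suc i) - t i = (\<sigma> (n - Suc i))\<^sup>2" if "i < n" for i
  proof -
    have "n - i = Suc (n - Suc i)" using that by simp
    then show ?thesis by (simp add: t_def)
  qed
  have t: "\<kappa> \<le> t 0" "t n = u" "t n < 1"
    using u sn by (simp_all add: t_def \<kappa>_def)
  have t0: "0 < t 0" using t(1) \<kappa> by simp
  have ts: "t i < t (Suc i)" if "i < n" for i
    using tS[OF that] \<sigma>[of "n - Suc i"] by (metis diff_gt_0_iff_gt zero_less_power)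
  have tn: "u - h < t i \<and> t i < u" if "i < n" for i
  proof -
    have "0 < (\<Sum>l<n - i. (\<sigma> l)\<^sup>2)" using that \<sigma> by (intro sum_pos) (auto simp: less_imp_neq[symmetric] lessThan_empty_iff)
    moreover have "(\<Sum>l<n - i. (\<sigma> l)\<^sup>2) \<le> (\<Sum>l<n. (\<sigma> l)\<^sup>2)" by (intro sum_mono2) auto
    ultimately show ?thesis using sn by (simp add: t_def)
  qed
  let ?j = "\<lambda>i. n - i"
  have le: "excursion_density n t x \<le> C * (hitting_density (1 - u) (x (?j 0)) * (\<Prod>i<n. normal_density (x (?j i)) (\<sigma> i) (x (?j (Suc i)))))"
    if "\<And>i. i \<le> n \<Longrightarrow> 0 < x i" for x
  proof -
    have "excursion_density n t x \<le> C * (hitting_density (1 - t n) (x n) * (\<Prod>i<n. normal_density (x (Suc i)) (\<sigma> (n - Suc i)) (x i)))"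
      unfolding C_def using that t tS \<kappa> \<sigma> by (intro excursion_density_le_left) auto
    also have "(\<Prod>i<n. normal_density (x (Suc i)) (\<sigma> (n - Suc i)) (x i)) = (\<Prod>i<n. normal_density (x (?j i)) (\<sigma> i) (x (?j (Suc i))))"
      by (subst prod.nat_diff_reindex[symmetric]) (auto intro!: prod.cong simp: Suc_diff_Suc)
    finally show ?thesis by (simp add: t(2))
  qed
  let ?E = "{\<omega> \<in> space M. \<forall>i\<le>n. e \<omega> (t (?j 0)) \<le> e \<omega> (t (?j i))}"
  have bij: "bij_betw ?j {..n} {..n}"
    by (rule bij_betw_byWitness[where f' = ?j]) auto
  have u1: "0 < 1 - u" using u by simp
  note E = emeasure_excursion_ge[OF M e t0 ts t(3) bij \<sigma> less_imp_le[OF C] u1 le r]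
  have "{\<omega> \<in> space M. \<not> (\<exists>v. u - h < v \<and> v < u \<and> e \<omega> v < e \<omega> u)} \<subseteq> ?E"
  proof safe
    fix \<omega> i assume *: "\<not> (\<exists>v. u - h < v \<and> v < u \<and> e \<omega> v < e \<omega> u)" "i \<le> n"
    show "e \<omega> (t (n - 0)) \<le> e \<omega> (t (n - i))"
    proof (cases "i = 0")
      case False
      then have "n - i < n" using *(2) by simp
      then have "e \<omega> u \<le> e \<omega> (t (n - i))" using *(1) tn by (meson not_less)
      then show ?thesis by (simp add: t(2))
    qed simp
  qed
  moreover have "emeasure M ?E \<le> ennreal \<epsilon>"
    by (rule order.trans[OF E(2)]) (use b in \<open>auto intro!: ennreal_leI simp: H_def mult_ac\<close>)
  ultimately show "\<exists>E\<in>sets M. {\<omega> \<in> space M. \<not> (\<exists>v. u - h < v \<and> v < u \<and> e \<omega> v < e \<omega> u)} \<subseteq> E \<and> emeasure M E \<le> ennreal \<epsilon>"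
    using E(1) by blast
qed

section \<open>Joint measurability in path and time\<close>

definition dyadic :: "nat \<Rightarrow> real \<Rightarrow> real" where
  "dyadic n u = min 1 (real (nat \<lfloor>2 ^ n * u\<rfloor>) / 2 ^ n)"

text \<open>\<open>nat\<close> and the cap at 1 ensure this for every real \<open>u\<close>, so that
  reading a path at \<open>dyadic n u\<close> always reads a coordinate of the product
  space.\<close>

lemma dyadic_mem: "dyadic n u \<in> {0..1}"
  by (simp add: dyadic_def)

lemma dyadic_tendsto:
  assumes "0 \<le> u" "u \<le> 1"
  shows "(\<lambda>n. dyadic n u) \<longlonglongrightarrow> u"
proof (rule real_tendsto_sandwich[OF _ _ _ tendsto_const])
  have b: "2 ^ n * u - 1 \<le> real (nat \<lfloor>2 ^ n * u\<rfloor>)" "real (nat \<lfloor>2 ^ n * u\<rfloor>) \<le> 2 ^ n * u" for n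
    using assms by (simp_all add: of_nat_nat)
  have "real (nat \<lfloor>2 ^ n * u\<rfloor>) / 2 ^ n \<le> u" for n
    using b(2)[of n] by (simp add: field_simps)
  then have 1: "dyadic n u \<le> u" for n
    unfolding dyadic_def by (rule min.coboundedI2)
  have "u - (1/2) ^ n \<le> real (nat \<lfloor>2 ^ n * u\<rfloor>) / 2 ^ n" for n
    using divide_right_mono[OF b(1)[of n], of "2 ^ n"] by (simp add: diff_divide_distrib power_divide)
  moreover have "u - (1/2) ^ n \<le> 1" for n :: nat
    using assms by (rule_tac order.trans[of _ u]) auto
  ultimately have 2: "u - (1/2) ^ n \<le> dyadic n u" for n
    unfolding dyadic_def by (rule_tac min.boundedI)
  from 1 2 show "\<forall>\<^sub>F n in sequentially. u - (1/2) ^ n \<le> dyadic n u" "\<forall>\<^sub>F n in sequentially. dyadic n u \<le> u"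
    by auto
  have "(\<lambda>n. u - (1/2) ^ n) \<longlonglongrightarrow> u - 0"
    by (intro tendsto_diff tendsto_const LIMSEQ_realpow_zero) auto
  then show "(\<lambda>n. u - (1/2) ^ n) \<longlonglongrightarrow> u" by simp
qed

text \<open>For continuous \<open>f\<close> this is equivalent to \<open>wiggle f u\<close>, but it is jointly measurable in \<open>f\<close> and \<open>u\<close>,
  since it reads \<open>f\<close> only at countably many fixed times.\<close>

definition dyadic_lt :: "(real \<Rightarrow> real) \<Rightarrow> real \<Rightarrow> real \<Rightarrow> bool" where
  "dyadic_lt f v u \<longleftrightarrow> (\<exists>k N. \<forall>n\<ge>N. f v + 1 / real (Suc k) < f (dyadic n u))"

definition dyadic_wiggle :: "(real \<Rightarrow> real) \<Rightarrow> real \<Rightarrow> bool" where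
  "dyadic_wiggle f u \<longleftrightarrow> (\<forall>m. (\<exists>q\<in>\<rat> \<inter> {0..1}. u - 1 / real (Suc m) < q \<and> q < u \<and> dyadic_lt f q u) \<and>
     (\<exists>q\<in>\<rat> \<inter> {0..1}. u < q \<and> q < u + 1 / real (Suc m) \<and> dyadic_lt f q u))"

text \<open>The margin \<open>1 / real (Suc k)\<close> survives the limit along the dyadic
  approximations, whereas a bare strict inequality would weaken to a non-strict one.\<close>

lemma dyadic_lt_iff:
  assumes f: "continuous_on {0..1} f" and u: "0 < u" "u < 1"
  shows "dyadic_lt f v u \<longleftrightarrow> f v < f u"
proof -
  have lim: "(\<lambda>n. f (dyadic n u)) \<longlonglongrightarrow> f u"
    by (rule continuous_on_tendsto_compose[OF f dyadic_tendsto]) (use u dyadic_mem in auto)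
  show ?thesis
  proof
    assume "dyadic_lt f v u"
    then obtain k N where kN: "\<forall>n\<ge>N. f v + 1 / real (Suc k) < f (dyadic n u)" by (auto simp: dyadic_lt_def)
    have "f v + 1 / real (Suc k) \<le> f u"
      by (rule tendsto_lowerbound[OF lim]) (use kN in \<open>auto simp: eventually_sequentially intro!: exI[of _ N] less_imp_le\<close>)
    then show "f v < f u" by (smt (verit) divide_pos_pos of_nat_0_less_iff zero_less_Suc)
  next
    assume "f v < f u"
    then obtain k where k: "1 / real (Suc k) < f u - f v" using nat_approx_posE[of "f u - f v"] by auto
    then have "f v + 1 / real (Suc k) < f u" by simp
    from order_tendstoD(1)[OF lim this] show "dyadic_lt f v u"
      by (auto simp: dyadic_lt_def eventually_sequentially)
  qed
qed

text \<open>Allows the excursion to be exchanged for its restriction to the unit interval, which is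
  what lives in the product space of paths.\<close>

lemma dyadic_wiggle_cong:
  assumes "\<And>x. x \<in> {0..1} \<Longrightarrow> f x = g x"
  shows "dyadic_wiggle f u \<longleftrightarrow> dyadic_wiggle g u"
proof -
  have "dyadic_lt f q u \<longleftrightarrow> dyadic_lt g q u" if "q \<in> {0..1}" for q
    using that assms dyadic_mem by (simp add: dyadic_lt_def)
  then show ?thesis unfolding dyadic_wiggle_def
    by (intro all_cong1 arg_cong2[of _ _ _ _ "(\<and>)"] bex_cong refl) auto
qed

lemma rational_below:
  fixes f :: "real \<Rightarrow> real"
  assumes f: "continuous_on {0..1} f" and "0 \<le> a" "b \<le> 1" "a < v" "v < b" "f v < y"
  shows "\<exists>q\<in>\<rat> \<inter> {0..1}. a < q \<and> q < b \<and> f q < y"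
proof -
  have "continuous_on {a<..<b} f" using f by (rule continuous_on_subset) (use assms in auto)
  then have "open ({a<..<b} \<inter> f -` {..<y})"
    by (rule continuous_open_preimage) auto
  moreover have "v \<in> {a<..<b} \<inter> f -` {..<y}" using assms by auto
  ultimately obtain d where d: "d > 0" "\<And>z. dist z v < d \<Longrightarrow> z \<in> {a<..<b} \<inter> f -` {..<y}"
    unfolding open_dist by blast
  obtain q where q: "q \<in> \<rat>" "v < q" "q < v + d" using Rats_dense_in_real[of v "v + d"] d by auto
  then have "q \<in> {a<..<b} \<inter> f -` {..<y}" by (intro d) (auto simp: dist_real_def)
  then show ?thesis using q assms by (intro bexI[of _ q]) auto
qed

lemma dyadic_wiggle_iff:
  assumes f: "continuous_on {0..1} f" and u: "0 < u" "u < 1"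
  shows "dyadic_wiggle f u \<longleftrightarrow> wiggle f u"
proof
  assume w: "dyadic_wiggle f u"
  show "wiggle f u"
    unfolding wiggle_def
  proof (intro allI impI)
    fix h :: real assume "0 < h"
    then obtain m where m: "1 / real (Suc m) < h" using nat_approx_posE by blast
    from w have "(\<exists>q\<in>\<rat> \<inter> {0..1}. u - 1 / real (Suc m) < q \<and> q < u \<and> f q < f u) \<and>
       (\<exists>q\<in>\<rat> \<inter> {0..1}. u < q \<and> q < u + 1 / real (Suc m) \<and> f q < f u)"
      unfolding dyadic_wiggle_def dyadic_lt_iff[OF f u] by blast
    with m show "(\<exists>v. u - h < v \<and> v < u \<and> f v < f u) \<and> (\<exists>v. u < v \<and> v < u + h \<and> f v < f u)"
      by (smt (verit))
  qed
next
  assume w: "wiggle f u"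
  show "dyadic_wiggle f u"
    unfolding dyadic_wiggle_def dyadic_lt_iff[OF f u]
  proof
    fix m :: nat
    define h where "h = min (1 / real (Suc m)) (min u (1 - u))"
    have h: "0 < h" "h \<le> 1 / real (Suc m)" "h \<le> u" "h \<le> 1 - u" using u by (auto simp: h_def)
    from w h(1) obtain v1 v2 where v: "u - h < v1" "v1 < u" "f v1 < f u" "u < v2" "v2 < u + h" "f v2 < f u"
      unfolding wiggle_def by blast
    obtain q1 where "q1 \<in> \<rat> \<inter> {0..1}" "u - h < q1" "q1 < u" "f q1 < f u"
      using rational_below[OF f _ _ v(1-3)] h u by auto
    moreover obtain q2 where "q2 \<in> \<rat> \<inter> {0..1}" "u < q2" "q2 < u + h" "f q2 < f u"
      using rational_below[OF f _ _ v(4-6)] h u by auto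
    ultimately show "(\<exists>q\<in>\<rat> \<inter> {0..1}. u - 1 / real (Suc m) < q \<and> q < u \<and> f q < f u) \<and>
       (\<exists>q\<in>\<rat> \<inter> {0..1}. u < q \<and> q < u + 1 / real (Suc m) \<and> f q < f u)"
      using h by (smt (verit))
  qed
qed

abbreviation (input) paths :: "(real \<Rightarrow> real) measure" where
  "paths \<equiv> \<Pi>\<^sub>M t\<in>{0..1}. borel"

lemma measurable_dyadic_wiggle:
  assumes F: "F \<in> measurable N paths" and U: "U \<in> borel_measurable N"
  shows "Measurable.pred N (\<lambda>x. dyadic_wiggle (F x) (U x))"
proof -
  note [measurable] = U
  have [measurable]: "(\<lambda>x. F x t) \<in> borel_measurable N" if "t \<in> {0..1}" for t
    using measurable_compose[OF F measurable_component_singleton[OF that]] .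
  \<comment> \<open>The rounded time takes countably many values, and for each fixed value the path
    is read at a single coordinate.\<close>
  have [measurable]: "(\<lambda>x. F x (dyadic n (U x))) \<in> borel_measurable N" for n
    unfolding dyadic_def
  proof (rule measurable_compose_countable[where f = "\<lambda>i x. F x (min 1 (real i / 2 ^ n))" and g = "\<lambda>x. nat \<lfloor>2 ^ n * U x\<rfloor>"])
    show "(\<lambda>x. F x (min 1 (real i / 2 ^ n))) \<in> borel_measurable N" for i by measurable
    show "(\<lambda>x. nat \<lfloor>2 ^ n * U x\<rfloor>) \<in> measurable N (count_space UNIV)" by measurable
  qed
  have lt: "Measurable.pred N (\<lambda>x. dyadic_lt (F x) q (U x))" if "q \<in> \<rat> \<inter> {0..1}" for q
  proof -
    have [measurable]: "(\<lambda>x. F x q) \<in> borel_measurable N" using that by simp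
    show ?thesis unfolding dyadic_lt_def by measurable
  qed
  have bex: "Measurable.pred N (\<lambda>x. \<exists>q\<in>\<rat> \<inter> {0..1}. R q x)"
    if "\<And>q. q \<in> \<rat> \<inter> {0..1} \<Longrightarrow> Measurable.pred N (R q)" for R :: "real \<Rightarrow> _"
    using that unfolding pred_def by (intro sets.sets_Collect_countable_Ex') (simp_all add: countable_rat)
  show ?thesis
    unfolding dyadic_wiggle_def
  proof (intro pred_intros_countable(1) pred_intros_logic bex)
    fix m :: nat and q :: real assume q: "q \<in> \<rat> \<inter> {0..1}"
    show "Measurable.pred N (\<lambda>x. U x - 1 / real (Suc m) < q)" "Measurable.pred N (\<lambda>x. q < U x)"
      "Measurable.pred N (\<lambda>x. U x < q)" "Measurable.pred N (\<lambda>x. q < U x + 1 / real (Suc m))"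
      by measurable
  qed (fact lt)+
qed

section \<open>Back to the circle\<close>

definition angle :: "complex \<Rightarrow> real" where
  "angle z = Arg2pi z / (2 * pi)"

definition angle3 :: "complex \<times> complex \<times> complex \<Rightarrow> triple" where
  "angle3 = (\<lambda>(a, b, c). (angle a, angle b, angle c))"

definition circ3 :: "triple \<Rightarrow> complex \<times> complex \<times> complex" where
  "circ3 = (\<lambda>(p, q, r). (circ p, circ q, circ r))"

text \<open>\<open>Arg2pi\<close> jumps at the nonnegative reals but vanishes there, so it is glued
  from a continuous function and a constant.\<close>

lemma measurable_angle [measurable]: "angle \<in> borel_measurable borel"
proof -
  have "(\<lambda>z. if z \<in> \<real>\<^sub>\<ge>\<^sub>0 then 0 else Arg2pi z) \<in> borel_measurable borel"
  proof (rule borel_measurable_continuous_on_if)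
    show "continuous_on (- \<real>\<^sub>\<ge>\<^sub>0) Arg2pi"
      by (auto intro!: continuous_at_imp_continuous_on continuous_at_Arg2pi)
  qed (auto intro: borel_closed)
  moreover have "(\<lambda>z. if z \<in> \<real>\<^sub>\<ge>\<^sub>0 then 0 else Arg2pi z) = Arg2pi"
    by (auto simp: fun_eq_iff Arg2pi_eq_0 elim!: nonneg_Reals_cases)
  ultimately show ?thesis by (simp add: angle_def[abs_def])
qed

lemma measurable_circ [measurable]: "circ \<in> borel_measurable borel"
  unfolding circ_def cis_conv_exp by measurable

lemma circ_angle: "z \<in> sphere 0 1 \<Longrightarrow> circ (angle z) = z"
  using Arg2pi_eq[of z] by (simp add: circ_def angle_def cis_conv_exp)

lemma angle_circ: "0 \<le> x \<Longrightarrow> x < 1 \<Longrightarrow> angle (circ x) = x"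
  by (simp add: angle_def Arg2pi_circ)

lemma uniform_triple_eq: "uniform_triple = distr triples (borel \<Otimes>\<^sub>M borel \<Otimes>\<^sub>M borel) circ3"
proof -
  have u: "uniform_circle = distr unif borel circ"
    by (simp add: uniform_circle_def unif_def circ_def[abs_def])
  interpret u: prob_space uniform_circle unfolding u by (rule unif.prob_space_distr) simp
  have 2: "uniform_circle \<Otimes>\<^sub>M uniform_circle = distr (unif \<Otimes>\<^sub>M unif) (borel \<Otimes>\<^sub>M borel) (\<lambda>(q, r). (circ q, circ r))"
    unfolding u by (rule pair_measure_distr) (simp_all, fold u, rule u.sigma_finite_measure_axioms)
  interpret uu: prob_space "uniform_circle \<Otimes>\<^sub>M uniform_circle" by (intro prob_space_pair u.prob_space_axioms)
  have "uniform_triple = distr unif borel circ \<Otimes>\<^sub>M distr (unif \<Otimes>\<^sub>M unif) (borel \<Otimes>\<^sub>M borel) (\<lambda>(q, r). (circ q, circ r))"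
    by (simp add: uniform_triple_def 2[symmetric]) (simp add: u)
  also have "\<dots> = distr triples (borel \<Otimes>\<^sub>M borel \<Otimes>\<^sub>M borel) (\<lambda>(p, s). (circ p, (case s of (q, r) \<Rightarrow> (circ q, circ r))))"
    unfolding triples_def
    by (rule pair_measure_distr) (simp_all, fold 2, rule uu.sigma_finite_measure_axioms)
  also have "(\<lambda>(p, s). (circ p, (case s of (q, r) \<Rightarrow> (circ q, circ r)))) = circ3"
    by (auto simp: circ3_def)
  finally show ?thesis .
qed

lemma sets_uniform_triple [simp, measurable_cong]: "sets uniform_triple = sets (borel \<Otimes>\<^sub>M borel \<Otimes>\<^sub>M borel)"
  by (simp add: uniform_triple_eq)

lemma measurable_angle3: "angle3 \<in> measurable uniform_triple triples"
proof -
  have "angle3 \<in> measurable (borel \<Otimes>\<^sub>M borel \<Otimes>\<^sub>M borel) (borel \<Otimes>\<^sub>M borel \<Otimes>\<^sub>M borel)"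
    unfolding angle3_def by measurable
  then show ?thesis by (simp cong: measurable_cong_sets)
qed

lemma measurable_circ3: "circ3 \<in> measurable triples (borel \<Otimes>\<^sub>M borel \<Otimes>\<^sub>M borel)"
proof -
  have "circ3 \<in> measurable (borel \<Otimes>\<^sub>M borel \<Otimes>\<^sub>M borel) (borel \<Otimes>\<^sub>M borel \<Otimes>\<^sub>M borel)"
    unfolding circ3_def by measurable
  then show ?thesis by (simp cong: measurable_cong_sets)
qed

text \<open>\<open>angle\<close> inverts \<open>circ\<close> only on the half-open unit interval,
  which carries the uniform law; the identity is therefore almost sure.\<close>

lemma distr_angle3: "distr uniform_triple triples angle3 = triples"
proof -
  have "distr uniform_triple triples angle3 = distr triples triples (angle3 \<circ> circ3)"
    unfolding uniform_triple_eq
    by (rule distr_distr) (use measurable_angle3 measurable_circ3 in \<open>simp_all cong: measurable_cong_sets\<close>)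
  also have "\<dots> = distr triples triples (\<lambda>t. t)"
  proof (rule distr_cong_AE)
    show "AE t in triples. (angle3 \<circ> circ3) t = t"
      using AE_generic by eventually_elim (auto simp: generic_def angle3_def circ3_def angle_circ)
    have "circ3 \<in> measurable triples uniform_triple" using measurable_circ3 by (simp cong: measurable_cong_sets)
    then show "angle3 \<circ> circ3 \<in> measurable triples triples" using measurable_angle3 by (rule measurable_comp)
  qed simp_all
  finally show ?thesis by simp
qed

lemma AE_uniform_triple_circ3_angle3: "AE t in uniform_triple. circ3 (angle3 t) = t"
proof -
  have m: "{t \<in> space (borel \<Otimes>\<^sub>M borel \<Otimes>\<^sub>M borel). circ3 (angle3 t) = t} \<in> sets (borel \<Otimes>\<^sub>M borel \<Otimes>\<^sub>M borel)"
  proof -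
    have "{t \<in> space (borel \<Otimes>\<^sub>M borel \<Otimes>\<^sub>M borel). circ3 (angle3 t) = t} =
      {t \<in> space (borel \<Otimes>\<^sub>M borel \<Otimes>\<^sub>M borel). circ (angle (fst t)) = fst t \<and> circ (angle (fst (snd t))) = fst (snd t) \<and>
        circ (angle (snd (snd t))) = snd (snd t)}"
      by (auto simp: circ3_def angle3_def)
    also have "\<dots> \<in> sets (borel \<Otimes>\<^sub>M borel \<Otimes>\<^sub>M borel)" by measurable
    finally show ?thesis .
  qed
  show ?thesis
    unfolding uniform_triple_eq AE_distr_iff[OF measurable_circ3 m]
    by (auto simp: circ3_def angle3_def circ_angle split_beta')
qed

lemma iterated_rotation_cong:
  assumes "\<And>i. 1 \<le> i \<Longrightarrow> T i = T' i"
  shows "iterated_rotation T g \<C> = iterated_rotation T' g \<C>"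
  by (induction g) (simp_all add: assms)

theorem proposition1p6:
  fixes M :: "'w measure"
    and e :: "'w \<Rightarrow> real \<Rightarrow> real"
    and A B C :: "nat \<Rightarrow> 'w \<Rightarrow> complex"
  assumes "prob_space M"
    and "brownian_excursion M e"
    and "prob_space.indep_vars M (\<lambda>i. uniform_triple) (\<lambda>i \<omega>. (A i \<omega>, B i \<omega>, C i \<omega>)) {1..}"
    and "\<And>i. 1 \<le> i \<Longrightarrow>
           distr M uniform_triple (\<lambda>\<omega>. (A i \<omega>, B i \<omega>, C i \<omega>)) = uniform_triple"
    and "indep_variables M
           (\<Pi>\<^sub>M t\<in>{0..1}. borel) (\<lambda>\<omega>. \<lambda>t\<in>{0..1}. e \<omega> t)
           (\<Pi>\<^sub>M i\<in>{1..}. uniform_triple) (\<lambda>\<omega>. \<lambda>i\<in>{1..}. (A i \<omega>, B i \<omega>, C i \<omega>))"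
  shows "AE \<omega> in M.
           (\<lambda>g. hausdorff_dist
                  (rotated_sieve (\<lambda>i. {A i \<omega>, B i \<omega>, C i \<omega>}) (e \<omega>) g)
                  (cball 0 1))
           \<longlonglongrightarrow> 0"
proof -
  interpret prob_space M by fact
  define Z where "Z i \<omega> = (A i \<omega>, B i \<omega>, C i \<omega>)" for i \<omega>
  define P where "P \<omega> = (\<lambda>t\<in>{0..1}. e \<omega> t)" for \<omega>
  define W where "W \<omega> = (\<lambda>i\<in>{1..}. angle3 (Z i \<omega>))" for \<omega>
  define law where "law = distr M paths P"
  have indepZ: "indep_vars (\<lambda>i. uniform_triple) Z {1..}"
    using assms(3) by (simp add: Z_def[abs_def])
  have lawZ: "distr M uniform_triple (Z i) = uniform_triple" if "1 \<le> i" for i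
    using assms(4)[OF that] by (simp add: Z_def[abs_def])
  have mZ: "random_variable uniform_triple (Z i)" if "1 \<le> i" for i
    using indepZ that by (auto simp: indep_vars_def)
  have indep: "indep_variables M paths P (\<Pi>\<^sub>M i\<in>{1..}. uniform_triple) (\<lambda>\<omega>. \<lambda>i\<in>{1..}. Z i \<omega>)"
    using assms(5) by (simp add: Z_def P_def[abs_def])
  then have mP: "random_variable paths P" by (simp add: indep_variables_def)
  interpret law: prob_space law unfolding law_def by (rule prob_space_distr[OF mP])

  have mG: "(\<lambda>y. \<lambda>i\<in>{1..}. angle3 (y i)) \<in> measurable (\<Pi>\<^sub>M i\<in>{1..}. uniform_triple) triple_seqs"
    unfolding triple_seqs_def
  proof (rule measurable_restrict)
    fix i :: nat assume "i \<in> {1..}"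
    from measurable_compose[OF measurable_component_singleton[OF this, of "\<lambda>_. uniform_triple"] measurable_angle3]
    show "(\<lambda>y. angle3 (y i)) \<in> measurable (\<Pi>\<^sub>M i\<in>{1..}. uniform_triple) triples" .
  qed
  have mZs: "(\<lambda>\<omega>. \<lambda>i\<in>{1..}. Z i \<omega>) \<in> measurable M (\<Pi>\<^sub>M i\<in>{1..}. uniform_triple)"
    using indep by (simp add: indep_variables_def)
  have W_eq: "W \<omega> = (\<lambda>i\<in>{1..}. angle3 ((\<lambda>i\<in>{1..}. Z i \<omega>) i))" for \<omega>
    by (auto simp: W_def)
  have mW: "random_variable triple_seqs W"
    using measurable_compose[OF mZs mG] by (simp add: W_eq[abs_def])
  have lawW: "distr M triple_seqs W = triple_seqs"
  proof -
    have ind: "indep_vars (\<lambda>i. triples) (\<lambda>i \<omega>. angle3 (Z i \<omega>)) {1..}"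
      by (rule indep_vars_compose2[OF indepZ]) (rule measurable_angle3)
    have "distr M (\<Pi>\<^sub>M i\<in>{1..}. triples) (\<lambda>\<omega>. \<lambda>i\<in>{1..}. angle3 (Z i \<omega>)) = (\<Pi>\<^sub>M i\<in>{1..}. distr M triples (\<lambda>\<omega>. angle3 (Z i \<omega>)))"
      by (rule iffD1[OF indep_vars_iff_distr_eq_PiM' ind])
         (use measurable_compose[OF mZ measurable_angle3] in auto)
    also have "\<dots> = triple_seqs"
      unfolding triple_seqs_def
    proof (rule PiM_cong[OF refl])
      fix i :: nat assume "i \<in> {1..}"
      then have i: "1 \<le> i" by simp
      have "distr M triples (\<lambda>\<omega>. angle3 (Z i \<omega>)) = distr (distr M uniform_triple (Z i)) triples angle3"
        by (subst distr_distr[OF measurable_angle3 mZ[OF i]]) (simp add: comp_def)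
      then show "distr M triples (\<lambda>\<omega>. angle3 (Z i \<omega>)) = triples"
        by (simp only: lawZ[OF i] distr_angle3)
    qed
    finally show ?thesis by (simp add: triple_seqs_def W_def[abs_def])
  qed
  \<comment> \<open>Independence turns the joint law of steps and path into a product law;
    rectangles suffice to verify it.\<close>
  have joint: "triple_seqs \<Otimes>\<^sub>M law = distr M (triple_seqs \<Otimes>\<^sub>M paths) (\<lambda>\<omega>. (W \<omega>, P \<omega>))"
  proof (rule pair_measure_eqI)
    show "sets (triple_seqs \<Otimes>\<^sub>M law) = sets (distr M (triple_seqs \<Otimes>\<^sub>M paths) (\<lambda>\<omega>. (W \<omega>, P \<omega>)))"
      by (simp add: law_def cong: sets_pair_measure_cong)
    fix E F assume E: "E \<in> sets triple_seqs" and "F \<in> sets law"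
    then have F: "F \<in> sets paths" by (simp add: law_def)
    let ?E = "(\<lambda>y. \<lambda>i\<in>{1..}. angle3 (y i)) -` E \<inter> space (\<Pi>\<^sub>M i\<in>{1..}. uniform_triple)"
    have "W -` E \<inter> space M = (\<lambda>\<omega>. \<lambda>i\<in>{1..}. Z i \<omega>) -` ?E \<inter> space M"
      using measurable_space[OF mZs] by (auto simp: W_eq)
    then have WE: "W -` E \<inter> space M \<in> {(\<lambda>\<omega>. \<lambda>i\<in>{1..}. Z i \<omega>) -` E \<inter> space M |E. E \<in> sets (\<Pi>\<^sub>M i\<in>{1..}. uniform_triple)}"
      using measurable_sets[OF mG E] by blast
    have PF: "P -` F \<inter> space M \<in> {P -` E \<inter> space M |E. E \<in> sets paths}" using F by blast
    have "prob ((P -` F \<inter> space M) \<inter> (W -` E \<inter> space M)) = prob (P -` F \<inter> space M) * prob (W -` E \<inter> space M)"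
      using indep unfolding indep_variables_def by (blast intro: indep_setD[OF _ PF WE])
    moreover have "(\<lambda>\<omega>. (W \<omega>, P \<omega>)) -` (E \<times> F) \<inter> space M = (P -` F \<inter> space M) \<inter> (W -` E \<inter> space M)"
      by auto
    ultimately have "prob ((\<lambda>\<omega>. (W \<omega>, P \<omega>)) -` (E \<times> F) \<inter> space M) = prob (W -` E \<inter> space M) * prob (P -` F \<inter> space M)"
      by (simp add: mult.commute)
    moreover have "emeasure triple_seqs E = prob (W -` E \<inter> space M)"
      using emeasure_distr[OF mW E] by (simp add: lawW emeasure_eq_measure)
    moreover have "emeasure law F = prob (P -` F \<inter> space M)"
      using emeasure_distr[OF mP F] by (simp add: law_def emeasure_eq_measure)
    moreover have "emeasure (distr M (triple_seqs \<Otimes>\<^sub>M paths) (\<lambda>\<omega>. (W \<omega>, P \<omega>))) (E \<times> F)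
        = prob ((\<lambda>\<omega>. (W \<omega>, P \<omega>)) -` (E \<times> F) \<inter> space M)"
      using mW mP E F by (subst emeasure_distr) (auto simp: emeasure_eq_measure)
    ultimately show "emeasure triple_seqs E * emeasure law F = emeasure (distr M (triple_seqs \<Otimes>\<^sub>M paths) (\<lambda>\<omega>. (W \<omega>, P \<omega>))) (E \<times> F)"
      by (simp add: ennreal_mult)
  qed (rule triple_seqs.sigma_finite_measure_axioms law.sigma_finite_measure_axioms)+

  have AE_W: "AE \<omega> in M. Q (W \<omega>)" if "AE w in triple_seqs. Q w" for Q
    by (rule AE_distrD[OF mW], unfold lawW, rule that)
  have exc: "AE \<omega> in M. continuous_on {0..1} (e \<omega>) \<and> (\<forall>t\<in>{0<..<1}. 0 < e \<omega> t)"
    using assms(2) unfolding brownian_excursion_def by (auto elim: eventually_mono)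

  have "AE \<omega> in M. dyadic_wiggle (P \<omega>) u" if u: "0 < u" "u < 1" for u
  proof -
    \<comment> \<open>Windows of length \<open>1 / real (Suc m)\<close> reduce the quantifier over
      all \<open>h\<close> to a countable one, so the exceptional null sets can be united.\<close>
    have "AE \<omega> in M. \<forall>m. (\<exists>v. u - 1 / real (Suc m) < v \<and> v < u \<and> e \<omega> v < e \<omega> u) \<and>
        (\<exists>v. u < v \<and> v < u + 1 / real (Suc m) \<and> e \<omega> v < e \<omega> u)"
      unfolding AE_all_countable
      by (intro allI AE_conjI AE_excursion_left AE_excursion_right assms u) simp_all
    with exc show ?thesis
    proof eventually_elim
      case (elim \<omega>)
      have "wiggle (e \<omega>) u"
        unfolding wiggle_def
      proof (intro allI impI)
        fix h :: real assume "0 < h"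
        then obtain m where m: "1 / real (Suc m) < h" using nat_approx_posE by blast
        then show "(\<exists>v. u - h < v \<and> v < u \<and> e \<omega> v < e \<omega> u) \<and> (\<exists>v. u < v \<and> v < u + h \<and> e \<omega> v < e \<omega> u)"
          using elim(2)[rule_format, of m] by (smt (verit))
      qed
      then have "dyadic_wiggle (e \<omega>) u" using elim(1) u by (simp add: dyadic_wiggle_iff)
      then show ?case by (subst dyadic_wiggle_cong[of _ "e \<omega>"]) (auto simp: P_def)
    qed
  qed
  then have fixed: "AE f in law. dyadic_wiggle f u" if "0 < u" "u < 1" for u
    unfolding law_def
    using that measurable_dyadic_wiggle[of "\<lambda>f. f" paths "\<lambda>_. u"]
    by (subst AE_distr_iff[OF mP]) (auto simp: pred_def)

  have wig: "AE \<omega> in M. \<forall>j. dyadic_wiggle (P \<omega>) (1 - bwd (W \<omega>) j (tmid (W \<omega> (Suc j))))"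
    unfolding AE_all_countable
  proof
    fix j
    interpret pr: pair_sigma_finite triple_seqs law ..
    let ?U = "\<lambda>w. 1 - bwd w j (tmid (w (Suc j)))"
    have mU: "?U \<in> borel_measurable triple_seqs"
      by (intro borel_measurable_diff measurable_bwd measurable_nth_comp measurable_tmid) auto
    \<comment> \<open>For a frozen sequence of steps the tested time is a fixed number in the open
      unit interval, so the statement for fixed times applies to almost every path.\<close>
    have "AE x in triple_seqs \<Otimes>\<^sub>M law. dyadic_wiggle (snd x) (?U (fst x))"
    proof (rule pr.AE_pair_measure)
      have "Measurable.pred (triple_seqs \<Otimes>\<^sub>M law) (\<lambda>x. dyadic_wiggle (snd x) (?U (fst x)))"
      proof (rule measurable_dyadic_wiggle)
        have "snd \<in> measurable (triple_seqs \<Otimes>\<^sub>M law) law" by (rule measurable_snd)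
        then show "snd \<in> measurable (triple_seqs \<Otimes>\<^sub>M law) paths" by (simp add: law_def cong: measurable_cong_sets)
        show "(\<lambda>x. ?U (fst x)) \<in> borel_measurable (triple_seqs \<Otimes>\<^sub>M law)"
          by (rule measurable_compose[OF measurable_fst mU])
      qed
      then show "{x \<in> space (triple_seqs \<Otimes>\<^sub>M law). dyadic_wiggle (snd x) (?U (fst x))} \<in> sets (triple_seqs \<Otimes>\<^sub>M law)"
        by (simp add: pred_def)
      show "AE w in triple_seqs. AE f in law. dyadic_wiggle (snd (w, f)) (?U (fst (w, f)))"
        using AE_triple_seqs_generic
      proof eventually_elim
        case (elim w)
        then have "0 < tmid (w (Suc j))" "tmid (w (Suc j)) < 1"
          using generic_sorted[of "w (Suc j)"] by auto
        then have "0 < ?U w" "?U w < 1" using bwd_mem[of j w "tmid (w (Suc j))"] elim by auto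
        from fixed[OF this] show ?case by simp
      qed
    qed
    from AE_distrD[OF measurable_Pair[OF mW mP] this[unfolded joint]]
    show "AE \<omega> in M. dyadic_wiggle (P \<omega>) (?U (W \<omega>))" by simp
  qed

  have "AE w in triple_seqs. \<forall>i k s n. 1 \<le> i \<longrightarrow> i < k \<longrightarrow> s + n < k \<longrightarrow> (\<forall>p\<in>tset (w i). \<forall>q\<in>tset (w k). q \<noteq> fwd w s n p)"
    unfolding AE_all_countable by (auto intro: AE_triple_seqs_neq AE_impI)
  note neq = AE_W[OF this]
  have "AE w in triple_seqs. \<forall>n k l. k < n \<longrightarrow> l < n \<longrightarrow>
      (\<forall>\<^sub>F g in sequentially. \<exists>j<g. hit w (Suc j) (g - Suc j) (grid_arc n k) (grid_arc n l))"
    unfolding AE_all_countable by (auto intro: AE_triple_seqs_hit)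
  note hits = AE_W[OF this]
  \<comment> \<open>The points are complex random variables that lie on the circle only almost
    surely; on that event they are recovered from their angles.\<close>
  have circle: "AE \<omega> in M. \<forall>i. 1 \<le> i \<longrightarrow> circ3 (angle3 (Z i \<omega>)) = Z i \<omega>"
    unfolding AE_all_countable
  proof (intro allI)
    fix i :: nat
    show "AE \<omega> in M. 1 \<le> i \<longrightarrow> circ3 (angle3 (Z i \<omega>)) = Z i \<omega>"
    proof (cases "1 \<le> i")
      case True
      have "AE \<omega> in M. circ3 (angle3 (Z i \<omega>)) = Z i \<omega>"
        by (rule AE_distrD[OF mZ[OF True]]) (simp only: lawZ[OF True] AE_uniform_triple_circ3_angle3)
      then show ?thesis by eventually_elim simp
    qed simp
  qed
  show ?thesis
    using exc wig neq hits circle AE_W[OF AE_triple_seqs_generic]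
  proof eventually_elim
    case (elim \<omega>)
    have f: "continuous_on {0..1} (e \<omega>)" "\<And>t. t \<in> {0<..<1} \<Longrightarrow> 0 < e \<omega> t" using elim(1) by auto
    have "wiggle (e \<omega>) (1 - bwd (W \<omega>) j (tmid (W \<omega> (Suc j))))" for j
    proof -
      let ?m = "tmid (W \<omega> (Suc j))"
      have "0 < ?m" "?m < 1" using generic_sorted[of "W \<omega> (Suc j)"] elim(6) by auto
      then have "0 < 1 - bwd (W \<omega>) j ?m" "1 - bwd (W \<omega>) j ?m < 1" using bwd_mem[of j "W \<omega>" ?m] elim(6) by auto
      moreover have "dyadic_wiggle (e \<omega>) (1 - bwd (W \<omega>) j ?m)"
        using elim(2) by (subst dyadic_wiggle_cong[of _ "P \<omega>"]) (auto simp: P_def)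
      ultimately show ?thesis using dyadic_wiggle_iff[OF f(1)] by blast
    qed
    then have good: "good_path (e \<omega>) (W \<omega>)"
      unfolding good_path_def using elim(3,6) by blast
    have "(\<lambda>g. hausdorff_dist (rotated_sieve (cuts (W \<omega>)) (e \<omega>) g) (cball 0 1)) \<longlonglongrightarrow> 0"
    proof (rule rotated_sieve_tendsto)
      show "\<forall>\<^sub>F g in sequentially. \<exists>j<g. hit (W \<omega>) (Suc j) (g - Suc j) (grid_arc n k) (grid_arc n l)"
        if "k < n" "l < n" for n k l
        using elim(4) that by blast
    qed (fact f good)+
    \<comment> \<open>Agreement from index 1 on is enough, since the \<open>g\<close>-th iterate
      uses the cut sets with indices \<open>1, ..., g\<close>.\<close>
    moreover have "cuts (W \<omega>) i = {A i \<omega>, B i \<omega>, C i \<omega>}" if "1 \<le> i" for i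
      using elim(5)[rule_format, OF that] that
      by (simp add: cuts_def W_def Z_def angle3_def circ3_def tset_def)
    ultimately show ?case
      unfolding rotated_sieve_def
      using iterated_rotation_cong[of "cuts (W \<omega>)" "\<lambda>i. {A i \<omega>, B i \<omega>, C i \<omega>}"] by simp
  qed
qed

end
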